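(* Let $X$ be a (nonempty) compact Hausdorff space, $\alpha:X\to X$ a continuous map that is a finite-sheeted cover on $X_\alpha$, i.e. $\sup_{x\in X_\alpha}|\alpha^{-1}(x)\cap X_\alpha|<\infty$, and $A:C(X)\to C(X)$ an $X_\alpha$-compatible transfer operator for $(X,\alpha)$ with cocycle $\rho$. Suppose that the inverse rami-rate is zero, $\omega(\alpha)=0$, and that $\rho$ is continuous on $X_\alpha$ (in particular, both conditions hold when $\alpha$ is a homeomorphism on $X_\alpha$). Then for every $g\in C(X)$, $g\ge0$, $$\ell(g)=\max_{\mu\in EM_\alpha(X)}\int_{X_\alpha}\ln(g\rho)\,d\mu=\max_{\mu\in M_\alpha(X)}\int_{X_\alpha}\ln(g\rho)\,d\mu.$$
   Context: A transfer operator for $(X,\alpha)$ is a positive linear operator $A:C(X)\to C(X)$ with $A((f\circ\alpha)g)=f\,Ag$ for all $f,g\in C(X)$. For $g\in C(X)$, $g\ge0$, let $Ag$ denote the operator $f\mapsto A(gf)$ on $C(X)$, and let $\ell(g)$ be the logarithm of its spectral radius, with $\ln0=-\infty$. $M_\alpha(X)$ is the set of regular Borel $\alpha$-invariant probability measures on $X$, $EM_\alpha(X)$ the subset of ergodic ones. Integrals of logarithms take values in $[-\infty,\infty)$. A point $x\in X$ is essential if every neighborhood $V$ of $x$ satisfies $\mu(V)>0$ for some $\mu\in M_\alpha(X)$; $X_\alpha$ is the (closed) set of essential points; $\alpha(X_\alpha)=X_\alpha$ and every $\mu\in M_\alpha(X)$ is supported in $X_\alpha$. For $x\in X_\alpha$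 put $\tilde\alpha^{-n}(x):=\alpha^{-n}(x)\cap X_\alpha$. Inverse rami-rate: $\omega(\alpha):=\ln\limsup_{n\to\infty}\sup_{x\in X_\alpha}|\tilde\alpha^{-n}(x)|^{1/n}$. Compatibility and cocycle: for $x\in X$ let $\nu_x$ be the regular Borel measure (possibly $0$) with $\int f\,d\nu_x=[Af](x)$ for $f\in C(X)$; its support lies in $\alpha^{-1}(x)$. $A$ is $X_\alpha$-compatible if for every $f\in C(X_\alpha)$ the function $x\mapsto\int_{X_\alpha}f\,d\nu_x$ is continuous on $X_\alpha$; then $[A_{X_\alpha}f](x):=\int_{X_\alpha}f\,d\nu_x$ defines a transfer operator on $C(X_\alpha)$. It has the form $[A_{X_\alpha}f](x)=\sum_{y\in\tilde\alpha^{-1}(x)}\rho(y)f(y)$, where $\rho(y)=\nu_{\alpha(y)}(\{y\})\ge0$, $y\in X_\alpha$; $\rho$ is called the cocycle. *)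

theory Defs
  imports "HOL-Analysis.Analysis" "HOL-Probability.Probability_Measure"
begin

text \<open>
  The space \<open>X\<close> is the type \<open>'a :: t2_space\<close> together with the assumption
  \<open>compact (UNIV :: 'a set)\<close>; types being nonempty, so is \<open>X\<close>.  The algebra \<open>C(X)\<close> of continuous
  complex functions is then \<open>'a \<Rightarrow>\<^sub>C complex\<close>, with the supremum norm.
\<close>

section \<open>The algebra of continuous functions\<close>

definition bc_mult :: "('a::topological_space \<Rightarrow>\<^sub>C complex) \<Rightarrow> ('a \<Rightarrow>\<^sub>C complex) \<Rightarrow> ('a \<Rightarrow>\<^sub>C complex)" where
  "bc_mult f g = Bcontfun (\<lambda>x. f x * g x)"

lemma apply_bc_mult: "apply_bcontfun (bc_mult f g) x = f x * g x"
proof -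
  from bounded_apply_bcontfun[of f] obtain a where a: "\<And>x. norm (f x) \<le> a"
    by (auto simp: bounded_iff)
  from bounded_apply_bcontfun[of g] obtain b where b: "\<And>x. norm (g x) \<le> b"
    by (auto simp: bounded_iff)
  have "norm (f x * g x) \<le> a * b" for x
    unfolding norm_mult using a[of x] b[of x]
    by (intro mult_mono) (auto intro: order_trans[OF norm_ge_zero])
  hence "bounded (range (\<lambda>x. f x * g x))" unfolding bounded_iff by blast
  moreover have "continuous_on UNIV (\<lambda>x. f x * g x)"
    by (intro continuous_intros) auto
  ultimately have "(\<lambda>x. f x * g x) \<in> bcontfun" by (simp add: bcontfun_def)
  thus ?thesis by (simp add: bc_mult_def Bcontfun_inverse)
qed

definition bc_scale :: "complex \<Rightarrow> ('a::topological_space \<Rightarrow>\<^sub>C complex) \<Rightarrow> ('a \<Rightarrow>\<^sub>C complex)" where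
  "bc_scale c f = bc_mult (const_bcontfun c) f"

text \<open>Meaningful only for continuous \<open>\<alpha>\<close>; otherwise \<open>f \<circ> \<alpha>\<close> need not be in the domain of \<open>Bcontfun\<close>.\<close>

definition bc_comp :: "('a::topological_space \<Rightarrow>\<^sub>C complex) \<Rightarrow> ('a \<Rightarrow> 'a) \<Rightarrow> ('a \<Rightarrow>\<^sub>C complex)" where
  "bc_comp f \<alpha> = Bcontfun (\<lambda>x. f (\<alpha> x))"

definition bc_nonneg :: "('a::topological_space \<Rightarrow>\<^sub>C complex) \<Rightarrow> bool" where
  "bc_nonneg f \<longleftrightarrow> (\<forall>x. f x \<in> \<real>\<^sub>\<ge>\<^sub>0)"

definition transfer_operator ::
  "('a::topological_space \<Rightarrow> 'a) \<Rightarrow> (('a \<Rightarrow>\<^sub>C complex) \<Rightarrow> ('a \<Rightarrow>\<^sub>C complex)) \<Rightarrow> bool" where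
  "transfer_operator \<alpha> A \<longleftrightarrow>
     (\<forall>f g. A (f + g) = A f + A g) \<and>
     (\<forall>c f. A (bc_scale c f) = bc_scale c (A f)) \<and>
     (\<forall>f. bc_nonneg f \<longrightarrow> bc_nonneg (A f)) \<and>
     (\<forall>f g. A (bc_mult (bc_comp f \<alpha>) g) = bc_mult f (A g))"

section \<open>Spectral radius\<close>

text \<open>
  The spectrum in the algebra of bounded complex-linear operators. The constant \<open>bounded_linear\<close>
  refers to real scalars only, but a two-sided inverse of a complex-linear map is complex-linear.
\<close>

definition op_spectrum ::
  "(('a::topological_space \<Rightarrow>\<^sub>C complex) \<Rightarrow> ('a \<Rightarrow>\<^sub>C complex)) \<Rightarrow> complex set" where
  "op_spectrum T = {c. \<not> (\<exists>S. bounded_linear S \<and>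
     (\<forall>f. S (bc_scale c f - T f) = f) \<and> (\<forall>f. bc_scale c (S f) - T (S f) = f))}"

definition spectral_radius ::
  "(('a::topological_space \<Rightarrow>\<^sub>C complex) \<Rightarrow> ('a \<Rightarrow>\<^sub>C complex)) \<Rightarrow> ennreal" where
  "spectral_radius T = (SUP c\<in>op_spectrum T. ennreal (cmod c))"

definition elog :: "ennreal \<Rightarrow> ereal" where
  "elog t = (if t = 0 then - \<infinity> else if t = \<infinity> then \<infinity> else ereal (ln (enn2real t)))"

definition spectral_exponent ::
  "(('a::topological_space \<Rightarrow>\<^sub>C complex) \<Rightarrow> ('a \<Rightarrow>\<^sub>C complex)) \<Rightarrow> ('a \<Rightarrow>\<^sub>C complex) \<Rightarrow> ereal" where
  "spectral_exponent A g = elog (spectral_radius (\<lambda>f. A (bc_mult g f)))"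

section \<open>Invariant measures and essential points\<close>

definition regular_borel :: "'a::topological_space measure \<Rightarrow> bool" where
  "regular_borel \<mu> \<longleftrightarrow> sets \<mu> = sets borel \<and> finite_measure \<mu> \<and>
     (\<forall>B\<in>sets borel.
        emeasure \<mu> B = (INF U\<in>{U. open U \<and> B \<subseteq> U}. emeasure \<mu> U) \<and>
        emeasure \<mu> B = (SUP K\<in>{K. compact K \<and> K \<subseteq> B}. emeasure \<mu> K))"

definition invariant_measures :: "('a::topological_space \<Rightarrow> 'a) \<Rightarrow> 'a measure set" where
  "invariant_measures \<alpha> = {\<mu>. prob_space \<mu> \<and> regular_borel \<mu> \<and>
     (\<forall>B\<in>sets borel. emeasure \<mu> (\<alpha> -` B) = emeasure \<mu> B)}"

definition ergodic_measures :: "('a::topological_space \<Rightarrow> 'a) \<Rightarrow> 'a measure set" where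
  "ergodic_measures \<alpha> = {\<mu>\<in>invariant_measures \<alpha>.
     \<forall>B\<in>sets borel. \<alpha> -` B = B \<longrightarrow> emeasure \<mu> B = 0 \<or> emeasure \<mu> B = 1}"

definition essential_points :: "('a::topological_space \<Rightarrow> 'a) \<Rightarrow> 'a set" where
  "essential_points \<alpha> =
     {x. \<forall>V. open V \<and> x \<in> V \<longrightarrow> (\<exists>\<mu>\<in>invariant_measures \<alpha>. emeasure \<mu> V > 0)}"

definition ess_preimage :: "('a::topological_space \<Rightarrow> 'a) \<Rightarrow> nat \<Rightarrow> 'a \<Rightarrow> 'a set" where
  "ess_preimage \<alpha> n x = (\<alpha> ^^ n) -` {x} \<inter> essential_points \<alpha>"

definition finite_sheeted :: "('a::topological_space \<Rightarrow> 'a) \<Rightarrow> bool" where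
  "finite_sheeted \<alpha> \<longleftrightarrow> (\<exists>N. \<forall>x\<in>essential_points \<alpha>.
     finite (ess_preimage \<alpha> 1 x) \<and> card (ess_preimage \<alpha> 1 x) \<le> N)"

definition inverse_rami_rate :: "('a::topological_space \<Rightarrow> 'a) \<Rightarrow> ereal" where
  "inverse_rami_rate \<alpha> = elog (limsup (\<lambda>n. SUP x\<in>essential_points \<alpha>.
     if finite (ess_preimage \<alpha> n x) then ennreal (root n (real (card (ess_preimage \<alpha> n x)))) else \<infinity>))"

section \<open>Compatibility and cocycle\<close>

text \<open>By the Riesz representation theorem there is exactly one such measure for a transfer operator.\<close>

definition transfer_measure ::
  "(('a::topological_space \<Rightarrow>\<^sub>C complex) \<Rightarrow> ('a \<Rightarrow>\<^sub>C complex)) \<Rightarrow> 'a \<Rightarrow> 'a measure" where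
  "transfer_measure A x = (THE \<nu>. regular_borel \<nu> \<and> (\<forall>f. (\<integral>y. apply_bcontfun f y \<partial>\<nu>) = apply_bcontfun (A f) x))"

definition ess_compatible ::
  "('a::topological_space \<Rightarrow> 'a) \<Rightarrow> (('a \<Rightarrow>\<^sub>C complex) \<Rightarrow> ('a \<Rightarrow>\<^sub>C complex)) \<Rightarrow> bool" where
  "ess_compatible \<alpha> A \<longleftrightarrow> (\<forall>f :: 'a \<Rightarrow> complex. continuous_on (essential_points \<alpha>) f \<longrightarrow>
     continuous_on (essential_points \<alpha>) (\<lambda>x. LINT y:essential_points \<alpha>|transfer_measure A x. f y))"

definition cocycle ::
  "('a::topological_space \<Rightarrow> 'a) \<Rightarrow> (('a \<Rightarrow>\<^sub>C complex) \<Rightarrow> ('a \<Rightarrow>\<^sub>C complex)) \<Rightarrow> 'a \<Rightarrow> real" where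
  "cocycle \<alpha> A y = measure (transfer_measure A (\<alpha> y)) {y}"

section \<open>Integrals of logarithms\<close>

text \<open>
  Integral of the positive part minus integral of the negative part; note that \<open>e2ennreal\<close> sends
  negative values to \<open>0\<close>. For functions bounded above on a finite measure space the first term is
  finite.
\<close>

definition ereal_set_integral :: "'a measure \<Rightarrow> 'a set \<Rightarrow> ('a \<Rightarrow> ereal) \<Rightarrow> ereal" where
  "ereal_set_integral \<mu> S f =
     enn2ereal (\<integral>\<^sup>+x\<in>S. e2ennreal (f x) \<partial>\<mu>) - enn2ereal (\<integral>\<^sup>+x\<in>S. e2ennreal (- f x) \<partial>\<mu>)"

definition log_integral ::
  "('a::topological_space \<Rightarrow> 'a) \<Rightarrow> (('a \<Rightarrow>\<^sub>C complex) \<Rightarrow> ('a \<Rightarrow>\<^sub>C complex)) \<Rightarrow>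
   ('a \<Rightarrow>\<^sub>C complex) \<Rightarrow> 'a measure \<Rightarrow> ereal" where
  "log_integral \<alpha> A g \<mu> =
     ereal_set_integral \<mu> (essential_points \<alpha>) (\<lambda>x. elog (ennreal (Re (g x) * cocycle \<alpha> A x)))"

definition is_max_over :: "('b \<Rightarrow> ereal) \<Rightarrow> 'b set \<Rightarrow> ereal \<Rightarrow> bool" where
  "is_max_over F S m \<longleftrightarrow> (\<exists>s\<in>S. F s = m) \<and> (\<forall>s\<in>S. F s \<le> m)"

end

theory Submission
  imports Defs "HOL-Analysis.Urysohn"
begin

text \<open>
  Let \<open>T f = A (g f)\<close>. For a positive operator the spectral radius is the infimum of the rates \<open>l\<close> with
  \<open>T\<^sup>n 1 = O(l\<^sup>n)\<close>, so both bounds concern the growth of \<open>T\<^sup>n 1\<close>.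

  Lower bound: \<open>T\<^sup>n 1 (\<alpha>\<^sup>n y)\<close> is at least the product of \<open>g \<rho>\<close> along the first \<open>n\<close> points of the orbit
  of \<open>y\<close>; integrating the logarithm against an invariant \<open>\<mu>\<close> gives \<open>\<integral> ln (g \<rho>) d\<mu> \<le> ln l\<close>.

  Upper bound: let \<open>q\<close> be continuous with \<open>g \<rho> \<le> e\<^sup>q\<close> on the essential set, and let \<open>p \<ge> 0\<close> be
  continuous and vanish there. Since \<open>p\<close> has integral \<open>0\<close> for every invariant measure, Birkhoff sums of
  \<open>q + p\<close> are eventually at most \<open>n b\<close>, uniformly, for every \<open>b\<close> above the maximum of \<open>\<integral> q d\<mu>\<close>. Hence
  \<open>T\<^sup>n 1 \<le> e\<^sup>n\<^sup>b V\<^sup>n 1\<close> with \<open>V f = T (e\<^sup>-\<^sup>q\<^sup>-\<^sup>p f)\<close>. As \<open>p\<close> grows, \<open>V\<close> forgets everything off the essential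
  set, and by a Dini argument \<open>V\<^sup>n 1\<close> is bounded by the number of essential \<open>n\<close>-th preimages plus \<open>1\<close>,
  which is subexponential. Taking for \<open>q\<close> the logarithm of \<open>g \<rho>\<close> truncated from below and letting the
  truncation tend to \<open>- \<infinity>\<close>, an extreme point of the face of maximizing invariant states (which exists by
  Krein--Milman, and corresponds to an ergodic measure by Riesz) attains the bound.
\<close>

section \<open>Regular Borel measures on a compact Hausdorff space\<close>

text \<open>The spectral radius is taken on all of \<open>X\<close>, whereas the hypotheses on
  preimages and on \<rho> concern only the essential set: a transfer measure may charge other
  points, and fibres there can be infinite. The complement is suppressed by \<open>p\<close>, at no
  cost because invariant measures do not see it. No single \<open>p\<close> has to serve all
  iterates: for a suitable \<open>n\<close> some \<open>p\<close> works, and one good power already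
  bounds the growth.

  Continuity of \<rho> allows Tietze to extend g \<rho> to a continuous function w on the whole
  space, so that its truncated logarithms can be evaluated by states. The truncation is forced by
  the zeros of w, where the logarithm is -\<infinity> and its integral is only upper semicontinuous
  in the measure.

  \<open>X\<close> need not be metrizable, so sequences do not suffice for weak limits. States are
  therefore points of a product of intervals, and their limits are obtained from the finite
  intersection property. Ergodicity of the maximizer comes from extremality instead of an ergodic
  decomposition.\<close>

locale compact_t2 =
  assumes compact_UNIV: "compact (UNIV :: 'a::t2_space set)"
begin

abbreviation cont :: "('a \<Rightarrow> 'b::topological_space) \<Rightarrow> bool" where
  "cont f \<equiv> continuous_on UNIV f"

lemma closed_imp_compact: "closed (K :: 'a set) \<Longrightarrow> compact K"
  using compact_Int_closed[OF compact_UNIV] by fastforce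

lemma compact_iff_closed: "compact (K :: 'a set) \<longleftrightarrow> closed K"
  using closed_imp_compact compact_imp_closed by blast

lemma normal_space_euclidean: "normal_space (euclidean :: 'a topology)"
proof (rule compact_Hausdorff_or_regular_imp_normal_space)
  show "compact_space (euclidean :: 'a topology)"
    using compact_UNIV by (simp add: compact_space_def)
  show "Hausdorff_space (euclidean :: 'a topology) \<or> regular_space (euclidean :: 'a topology)"
    using hausdorff[where 'a='a] by (auto simp: Hausdorff_space_def disjnt_def)
qed

lemma urysohn:
  assumes "closed (K :: 'a set)" "open U" "K \<subseteq> U"
  obtains f :: "'a \<Rightarrow> real" where "cont f" "\<And>x. 0 \<le> f x" "\<And>x. f x \<le> 1"
    "\<And>x. x \<in> K \<Longrightarrow> f x = 1" "\<And>x. x \<notin> U \<Longrightarrow> f x = 0"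
proof -
  obtain f where f: "continuous_map euclidean (top_of_set {0..1::real}) f"
     "f ` (- U) \<subseteq> {0}" "f ` K \<subseteq> {1}"
    using Urysohn_lemma[of "euclidean :: 'a topology" "- U" K 0 1] normal_space_euclidean assms
    by (auto simp: disjnt_def closed_closedin[symmetric])
  then show thesis
    by (intro that[of f]) (auto simp: continuous_map_in_subtopology image_subset_iff Pi_iff)
qed

lemma tietze:
  fixes f :: "'a \<Rightarrow> real"
  assumes "closed S" "continuous_on S f"
  obtains g where "cont g" "\<And>x. x \<in> S \<Longrightarrow> g x = f x"
proof -
  have "continuous_map (top_of_set S) euclideanreal f" using assms by simp
  then obtain g where "continuous_map euclidean euclideanreal g" "\<And>x. x \<in> S \<Longrightarrow> g x = f x"
    using Tietze_extension_realinterval[of "euclidean :: 'a topology" S UNIV f] normal_space_euclidean assms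
    by (auto simp: closed_closedin[symmetric])
  then show thesis using that by simp
qed

lemma cont_bounded:
  fixes f :: "'a \<Rightarrow> 'b::real_normed_vector"
  assumes "cont f"
  obtains B where "B > 0" "\<And>x. norm (f x) \<le> B"
proof -
  have "bounded (range f)"
    using compact_continuous_image[OF assms compact_UNIV] compact_imp_bounded by blast
  then show thesis using that unfolding bounded_pos by auto
qed

lemma closed_sublevel: "cont f \<Longrightarrow> closed {x. c \<le> f x}" for f :: "'a \<Rightarrow> real"
  by (intro closed_Collect_le continuous_intros)

lemma open_superlevel: "cont f \<Longrightarrow> open {x. c < f x}" for f :: "'a \<Rightarrow> real"
  by (intro open_Collect_less continuous_intros)

lemma cont_measurable:
  fixes f :: "'a \<Rightarrow> 'b::topological_space"
  assumes "sets \<mu> = sets borel" "cont f"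
  shows "f \<in> borel_measurable \<mu>"
  using borel_measurable_continuous_onI[OF assms(2)] assms(1) measurable_cong_sets by blast

lemma cont_integrable:
  fixes f :: "'a \<Rightarrow> 'b::{banach,second_countable_topology}"
  assumes "sets \<mu> = sets borel" "finite_measure \<mu>" "cont f"
  shows "integrable \<mu> f"
proof -
  interpret finite_measure \<mu> by fact
  obtain B where "\<And>x. norm (f x) \<le> B" using cont_bounded[OF assms(3)] by blast
  then show ?thesis
    by (intro integrable_const_bound[where B=B] cont_measurable assms) auto
qed

text \<open>Complements of open sets approximating - B from outside approximate B from inside, and
  they are compact because the space is.\<close>

lemma regular_borelI_outer:
  fixes \<mu> :: "'a measure"
  assumes s: "sets \<mu> = sets borel" and fin: "finite_measure \<mu>"
    and out: "\<And>B e. B \<in> sets borel \<Longrightarrow> e > 0 \<Longrightarrow> \<exists>U. open U \<and> B \<subseteq> U \<and> measure \<mu> U \<le> measure \<mu> B + e"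
  shows "regular_borel \<mu>"
  unfolding regular_borel_def
proof (intro conjI ballI s fin)
  fix B :: "'a set" assume B: "B \<in> sets borel"
  interpret finite_measure \<mu> by fact
  have sp: "space \<mu> = UNIV" using sets_eq_imp_space_eq[OF s] by simp
  have meas: "U \<in> sets \<mu>" if "open U" for U using that s by simp
  have cmeas: "U \<in> sets \<mu>" if "closed U" for U using that s by simp
  show "emeasure \<mu> B = (INF U\<in>{U. open U \<and> B \<subseteq> U}. emeasure \<mu> U)"
  proof (intro antisym INF_greatest)
    show "(INF U\<in>{U. open U \<and> B \<subseteq> U}. emeasure \<mu> U) \<le> emeasure \<mu> B"
    proof (rule ennreal_le_epsilon)
      fix e :: real assume "e > 0"
      with out[OF B] obtain U where "open U" "B \<subseteq> U" "measure \<mu> U \<le> measure \<mu> B + e" by blast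
      then show "(INF U\<in>{U. open U \<and> B \<subseteq> U}. emeasure \<mu> U) \<le> emeasure \<mu> B + ennreal e"
        using \<open>e > 0\<close>
        by (intro INF_lower2[of U]) (auto simp: emeasure_eq_measure ennreal_plus[symmetric] simp del: ennreal_plus)
    qed
  qed (use meas in \<open>auto intro: emeasure_mono\<close>)
  show "emeasure \<mu> B = (SUP K\<in>{K. compact K \<and> K \<subseteq> B}. emeasure \<mu> K)"
  proof (intro antisym SUP_least)
    show "emeasure \<mu> B \<le> (SUP K\<in>{K. compact K \<and> K \<subseteq> B}. emeasure \<mu> K)"
    proof (rule ennreal_le_epsilon)
      fix e :: real assume "e > 0"
      have Bm: "B \<in> sets \<mu>" using B s by simp
      have "- B \<in> sets borel" using B by auto
      from out[OF this \<open>e > 0\<close>] obtain U where U: "open U" "- B \<subseteq> U" "measure \<mu> U \<le> measure \<mu> (- B) + e" by blast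
      have "measure \<mu> (- B) = measure \<mu> UNIV - measure \<mu> B"
        "measure \<mu> (- U) = measure \<mu> UNIV - measure \<mu> U"
        using finite_measure_compl[OF Bm] finite_measure_compl[OF meas[OF U(1)]] sp
        by (simp_all add: Compl_eq_Diff_UNIV)
      then have "measure \<mu> B \<le> measure \<mu> (- U) + e" using U by simp
      then have *: "emeasure \<mu> B \<le> emeasure \<mu> (- U) + ennreal e"
        using \<open>e > 0\<close> by (auto simp: emeasure_eq_measure ennreal_plus[symmetric] simp del: ennreal_plus)
      have "emeasure \<mu> (- U) \<le> (SUP K\<in>{K. compact K \<and> K \<subseteq> B}. emeasure \<mu> K)"
        using U by (intro SUP_upper) (auto simp: compact_iff_closed)
      with * show "emeasure \<mu> B \<le> (SUP K\<in>{K. compact K \<and> K \<subseteq> B}. emeasure \<mu> K) + ennreal e"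
        by (meson add_right_mono order_trans)
    qed
  qed (use B s in \<open>auto intro: emeasure_mono\<close>)
qed

lemma regular_borelI_inner:
  fixes \<mu> :: "'a measure"
  assumes s: "sets \<mu> = sets borel" and fin: "finite_measure \<mu>"
    and inn: "\<And>B e. B \<in> sets borel \<Longrightarrow> e > 0 \<Longrightarrow> \<exists>K. closed K \<and> K \<subseteq> B \<and> measure \<mu> B \<le> measure \<mu> K + e"
  shows "regular_borel \<mu>"
proof (rule regular_borelI_outer[OF s fin])
  fix B :: "'a set" and e :: real assume B: "B \<in> sets borel" and e: "e > 0"
  interpret finite_measure \<mu> by fact
  have sp: "space \<mu> = UNIV" using sets_eq_imp_space_eq[OF s] by simp
  have "- B \<in> sets borel" using B by auto
  from inn[OF this e] obtain K where K: "closed K" "K \<subseteq> - B" "measure \<mu> (- B) \<le> measure \<mu> K + e" by blast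
  have "B \<in> sets \<mu>" "K \<in> sets \<mu>" using B K s by auto
  then have "measure \<mu> (- B) = measure \<mu> UNIV - measure \<mu> B"
        "measure \<mu> (- K) = measure \<mu> UNIV - measure \<mu> K"
    using finite_measure_compl[of B] finite_measure_compl[of K] sp
    by (simp_all add: Compl_eq_Diff_UNIV)
  then show "\<exists>U. open U \<and> B \<subseteq> U \<and> measure \<mu> U \<le> measure \<mu> B + e"
    using K by (intro exI[of _ "- K"]) auto
qed

context
  fixes \<mu> :: "'a measure"
  assumes reg: "regular_borel \<mu>"
begin

lemma regular_sets: "sets \<mu> = sets borel"
  and regular_finite: "finite_measure \<mu>"
  using reg by (auto simp: regular_borel_def)

lemma regular_space: "space \<mu> = UNIV"
  using sets_eq_imp_space_eq[OF regular_sets] by simp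

lemma regular_outer:
  assumes "B \<in> sets borel" "e > 0"
  obtains U where "open U" "B \<subseteq> U" "measure \<mu> U < measure \<mu> B + e"
proof -
  interpret finite_measure \<mu> by (rule regular_finite)
  have "emeasure \<mu> B < ennreal (measure \<mu> B + e)"
    using assms by (simp add: emeasure_eq_measure ennreal_less_iff)
  then obtain U where "open U" "B \<subseteq> U" "emeasure \<mu> U < ennreal (measure \<mu> B + e)"
    using reg assms unfolding regular_borel_def by (auto simp: INF_less_iff)
  then show thesis using that by (auto simp: emeasure_eq_measure ennreal_less_iff)
qed

lemma regular_inner:
  assumes "B \<in> sets borel" "e > 0"
  obtains K where "closed K" "K \<subseteq> B" "measure \<mu> B < measure \<mu> K + e"
proof -
  interpret finite_measure \<mu> by (rule regular_finite)
  have "- B \<in> sets borel" using assms by auto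
  then obtain U where U: "open U" "- B \<subseteq> U" "measure \<mu> U < measure \<mu> (- B) + e"
    using regular_outer[OF _ assms(2)] by blast
  have "B \<in> sets \<mu>" "U \<in> sets \<mu>" using assms U regular_sets by auto
  then have "measure \<mu> (- B) = measure \<mu> UNIV - measure \<mu> B"
        "measure \<mu> (- U) = measure \<mu> UNIV - measure \<mu> U"
    using finite_measure_compl[of B] finite_measure_compl[of U] regular_space
    by (simp_all add: Compl_eq_Diff_UNIV)
  then show thesis using U by (intro that[of "- U"]) auto
qed

lemma regular_integrable: "cont f \<Longrightarrow> integrable \<mu> f" for f :: "'a \<Rightarrow> 'b::{banach,second_countable_topology}"
  by (rule cont_integrable[OF regular_sets regular_finite])

lemma measure_le_integral:
  fixes f :: "'a \<Rightarrow> real"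
  assumes "B \<in> sets borel" "integrable \<mu> f" "\<And>x. 0 \<le> f x" "\<And>x. x \<in> B \<Longrightarrow> 1 \<le> f x"
  shows "measure \<mu> B \<le> (\<integral>x. f x \<partial>\<mu>)"
proof -
  interpret finite_measure \<mu> by (rule regular_finite)
  have "(\<integral>x. indicator B x \<partial>\<mu>) \<le> (\<integral>x. f x \<partial>\<mu>)"
    using assms regular_sets
    by (intro integral_mono) (auto simp: integrable_real_indicator less_top[symmetric] split: split_indicator)
  then show ?thesis using assms regular_sets regular_space by simp
qed

lemma integral_le_measure:
  fixes f :: "'a \<Rightarrow> real"
  assumes "B \<in> sets borel" "integrable \<mu> f" "\<And>x. f x \<le> 1" "\<And>x. x \<notin> B \<Longrightarrow> f x \<le> 0"
  shows "(\<integral>x. f x \<partial>\<mu>) \<le> measure \<mu> B"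
proof -
  interpret finite_measure \<mu> by (rule regular_finite)
  have "(\<integral>x. f x \<partial>\<mu>) \<le> (\<integral>x. indicator B x \<partial>\<mu>)"
    using assms regular_sets
    by (intro integral_mono) (auto simp: integrable_real_indicator less_top[symmetric] split: split_indicator)
  then show ?thesis using assms regular_sets regular_space by simp
qed

end

text \<open>A Urysohn function squeezed between a closed K inside B and an open U around B turns
  equality of integrals into an inequality of measures.\<close>

lemma regular_le:
  fixes \<mu> \<nu> :: "'a measure"
  assumes "regular_borel \<mu>" "regular_borel \<nu>"
    and eq: "\<And>f :: 'a \<Rightarrow> real. cont f \<Longrightarrow> (\<integral>x. f x \<partial>\<mu>) = (\<integral>x. f x \<partial>\<nu>)"
    and B: "B \<in> sets borel"
  shows "measure \<mu> B \<le> measure \<nu> B"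
proof (rule field_le_epsilon)
  fix e :: real assume e: "e > 0"
  obtain K where K: "closed K" "K \<subseteq> B" "measure \<mu> B < measure \<mu> K + e/2"
    by (rule regular_inner[OF assms(1) B half_gt_zero[OF e]])
  obtain U where U: "open U" "B \<subseteq> U" "measure \<nu> U < measure \<nu> B + e/2"
    by (rule regular_outer[OF assms(2) B half_gt_zero[OF e]])
  have "K \<subseteq> U" using K U by blast
  then obtain f :: "'a \<Rightarrow> real" where f: "cont f" "\<And>x. 0 \<le> f x" "\<And>x. f x \<le> 1"
    "\<And>x. x \<in> K \<Longrightarrow> f x = 1" "\<And>x. x \<notin> U \<Longrightarrow> f x = 0"
    using urysohn[OF K(1) U(1)] by blast
  have "measure \<mu> K \<le> (\<integral>x. f x \<partial>\<mu>)"
    using f K by (intro measure_le_integral assms regular_integrable) auto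
  moreover have "(\<integral>x. f x \<partial>\<nu>) \<le> measure \<nu> U"
    using f U by (intro integral_le_measure assms regular_integrable) auto
  ultimately show "measure \<mu> B \<le> measure \<nu> B + e"
    using K U eq[OF f(1)] by simp
qed

lemma regular_unique:
  fixes \<mu> \<nu> :: "'a measure"
  assumes "regular_borel \<mu>" "regular_borel \<nu>"
    and "\<And>f :: 'a \<Rightarrow> real. cont f \<Longrightarrow> (\<integral>x. f x \<partial>\<mu>) = (\<integral>x. f x \<partial>\<nu>)"
  shows "\<mu> = \<nu>"
proof (rule measure_eqI)
  show "sets \<mu> = sets \<nu>" using assms regular_sets by metis
  fix B assume "B \<in> sets \<mu>"
  then have "B \<in> sets borel" using assms regular_sets by metis
  then have "measure \<mu> B = measure \<nu> B"
    using regular_le[OF assms] regular_le[OF assms(2,1)] assms(3) by (simp add: antisym)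
  then show "emeasure \<mu> B = emeasure \<nu> B"
    using assms regular_finite by (simp add: finite_measure.emeasure_eq_measure)
qed

text \<open>The inner criterion suits image measures: \<alpha> maps compact sets to compact sets,
  while images of open sets need not be open.\<close>

lemma regular_distr:
  fixes \<mu> :: "'a measure"
    and \<alpha> :: "'a \<Rightarrow> 'a"
  assumes "regular_borel \<mu>" "cont \<alpha>"
  shows "regular_borel (distr \<mu> borel \<alpha>)"
proof (rule regular_borelI_inner)
  interpret finite_measure \<mu> by (rule regular_finite) fact
  have am: "\<alpha> \<in> measurable \<mu> borel"
    using assms by (intro cont_measurable regular_sets)
  show "finite_measure (distr \<mu> borel \<alpha>)" by (rule finite_measure_distr[OF am])
  fix B :: "'a set" and e :: real assume B: "B \<in> sets borel" and e: "e > 0"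
  have sp: "space \<mu> = UNIV" using assms regular_space by blast
  have aB: "\<alpha> -` B \<in> sets borel"
    using measurable_sets[OF am B] sp regular_sets[OF assms(1)] by simp
  from regular_inner[OF assms(1) this e] obtain K where
    K: "closed K" "K \<subseteq> \<alpha> -` B" "measure \<mu> (\<alpha> -` B) < measure \<mu> K + e" by blast
  have cl: "closed (\<alpha> ` K)"
    using K assms(2) by (metis closed_imp_compact compact_continuous_image compact_imp_closed continuous_on_subset subset_UNIV)
  have ak: "\<alpha> -` \<alpha> ` K \<in> sets \<mu>" using measurable_sets[OF am, of "\<alpha> ` K"] sp cl by simp
  have "measure \<mu> K \<le> measure \<mu> (\<alpha> -` \<alpha> ` K)"
    using ak by (intro finite_measure_mono) auto
  then have "measure (distr \<mu> borel \<alpha>) B \<le> measure (distr \<mu> borel \<alpha>) (\<alpha> ` K) + e"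
    using K B cl am sp by (simp add: measure_distr)
  then show "\<exists>K. closed K \<and> K \<subseteq> B \<and> measure (distr \<mu> borel \<alpha>) B \<le> measure (distr \<mu> borel \<alpha>) K + e"
    using K cl by (intro exI[of _ "\<alpha> ` K"]) auto
qed simp

end

section \<open>The Riesz representation theorem\<close>

lemma ennreal_le_all_epsilon:
  fixes x y :: ennreal and c :: real
  assumes "c \<ge> 0" "\<And>e. 0 < e \<Longrightarrow> e < 1 \<Longrightarrow> x \<le> y + ennreal (e * c)"
  shows "x \<le> y"
proof (rule ennreal_le_epsilon)
  fix d :: real assume d: "d > 0"
  \<comment> \<open>\<open>c + 1\<close> because c may be 0.\<close>
  define e where "e = min (1/2) (d / (c + 1))"
  have "e > 0" "e < 1" using d assms(1) by (auto simp: e_def)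
  moreover have "e * c \<le> d"
  proof -
    have "e * c \<le> (d / (c + 1)) * c" using assms(1) by (intro mult_right_mono) (auto simp: e_def)
    also have "\<dots> \<le> d" using d assms(1) by (simp add: field_simps)
    finally show ?thesis .
  qed
  ultimately show "x \<le> y + ennreal d"
    using assms(2)[of e] by (meson add_left_mono ennreal_leI order_trans)
qed

text \<open>The functional is a total function on all real functions, but only its values at
  continuous ones are constrained.\<close>

definition pos_functional :: "(('a::topological_space \<Rightarrow> real) \<Rightarrow> real) \<Rightarrow> bool" where
  "pos_functional \<phi> \<longleftrightarrow>
     (\<forall>f g. continuous_on UNIV f \<longrightarrow> continuous_on UNIV g \<longrightarrow> \<phi> (\<lambda>x. f x + g x) = \<phi> f + \<phi> g) \<and>
     (\<forall>c f. continuous_on UNIV f \<longrightarrow> \<phi> (\<lambda>x. c * f x) = c * \<phi> f) \<and>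
     (\<forall>f. continuous_on UNIV f \<longrightarrow> (\<forall>x. 0 \<le> f x) \<longrightarrow> 0 \<le> \<phi> f)"

lemma pos_functional_add:
  "pos_functional \<phi> \<Longrightarrow> continuous_on UNIV f \<Longrightarrow> continuous_on UNIV g \<Longrightarrow>
   \<phi> (\<lambda>x. f x + g x) = \<phi> f + \<phi> g"
  and pos_functional_cmult:
  "pos_functional \<phi> \<Longrightarrow> continuous_on UNIV f \<Longrightarrow> \<phi> (\<lambda>x. c * f x) = c * \<phi> f"
  and pos_functional_nonneg:
  "pos_functional \<phi> \<Longrightarrow> continuous_on UNIV f \<Longrightarrow> (\<And>x. 0 \<le> f x) \<Longrightarrow> 0 \<le> \<phi> f"
  by (auto simp: pos_functional_def)

lemma pos_functional_diff:
  assumes "pos_functional \<phi>" "continuous_on UNIV f" "continuous_on UNIV g"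
  shows "\<phi> (\<lambda>x. f x - g x) = \<phi> f - \<phi> g"
proof -
  have c: "continuous_on UNIV (\<lambda>x. f x - g x)" using assms by (intro continuous_intros)
  have "\<phi> f = \<phi> (\<lambda>x. (f x - g x) + g x)" by simp
  also have "\<dots> = \<phi> (\<lambda>x. f x - g x) + \<phi> g" by (rule pos_functional_add[OF assms(1) c assms(3)])
  finally show ?thesis by simp
qed

lemma pos_functional_mono:
  assumes "pos_functional \<phi>" "continuous_on UNIV f" "continuous_on UNIV g" "\<And>x. f x \<le> g x"
  shows "\<phi> f \<le> \<phi> g"
proof -
  have c: "continuous_on UNIV (\<lambda>x. g x - f x)" using assms by (intro continuous_intros)
  have "0 \<le> \<phi> (\<lambda>x. g x - f x)" by (rule pos_functional_nonneg[OF assms(1) c]) (use assms in simp)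
  then show ?thesis using pos_functional_diff[OF assms(1,3,2)] by simp
qed

lemma pos_functional_const:
  assumes "pos_functional \<phi>"
  shows "\<phi> (\<lambda>_. c) = c * \<phi> (\<lambda>_. 1)"
  using pos_functional_cmult[OF assms, of "\<lambda>_. 1" c] by simp

lemma pos_functional_sum:
  assumes "pos_functional \<phi>" "finite I" "\<And>i. i \<in> I \<Longrightarrow> continuous_on UNIV (f i)"
  shows "\<phi> (\<lambda>x. \<Sum>i\<in>I. f i x) = (\<Sum>i\<in>I. \<phi> (f i))"
  using assms(2,3)
proof (induction I rule: finite_induct)
  case empty
  then show ?case using pos_functional_const[OF assms(1), of 0] by simp
next
  case (insert j I)
  have "continuous_on UNIV (\<lambda>x. \<Sum>i\<in>I. f i x)" using insert by (intro continuous_on_sum) auto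
  then show ?case using insert pos_functional_add[OF assms(1), of "f j" "\<lambda>x. \<Sum>i\<in>I. f i x"] by simp
qed

context compact_t2
begin

section \<open>The outer measure of a positive functional\<close>

context
  fixes \<phi> :: "('a \<Rightarrow> real) \<Rightarrow> real"
  assumes pos: "pos_functional \<phi>"
begin

lemmas phi_add = pos_functional_add[OF pos]
lemmas phi_cmult = pos_functional_cmult[OF pos]
lemmas phi_mono = pos_functional_mono[OF pos]

text \<open>Vanishing outside U is asked instead of compact support inside U; the missing
  compactness is recovered by cutting off.\<close>

definition subordinate :: "'a set \<Rightarrow> ('a \<Rightarrow> real) set" where
  "subordinate U = {f. cont f \<and> (\<forall>x. 0 \<le> f x \<and> f x \<le> 1) \<and> (\<forall>x. x \<notin> U \<longrightarrow> f x = 0)}"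

definition content :: "'a set \<Rightarrow> ennreal" where
  "content U = (SUP f\<in>subordinate U. ennreal (\<phi> f))"

definition riesz_outer :: "'a set \<Rightarrow> ennreal" where
  "riesz_outer E = (INF U\<in>{U. open U \<and> E \<subseteq> U}. content U)"

lemma phi_nonneg: "f \<in> subordinate U \<Longrightarrow> 0 \<le> \<phi> f"
  unfolding subordinate_def using pos_functional_nonneg[OF pos] by blast

lemma phi_one_nonneg: "0 \<le> \<phi> (\<lambda>_. 1)"
  using pos_functional_nonneg[OF pos, of "\<lambda>_. 1"] by simp

lemma content_upper: "f \<in> subordinate U \<Longrightarrow> ennreal (\<phi> f) \<le> content U"
  unfolding content_def by (rule SUP_upper)

lemma content_le_total: "content U \<le> ennreal (\<phi> (\<lambda>_. 1))"
  unfolding content_def subordinate_def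
  by (intro SUP_least ennreal_leI phi_mono) auto

lemma content_mono: "U \<subseteq> V \<Longrightarrow> content U \<le> content V"
  unfolding content_def by (intro SUP_subset_mono) (auto simp: subordinate_def)

lemma content_empty: "content {} = 0"
proof -
  have "\<phi> f = 0" if "f \<in> subordinate {}" for f
  proof -
    have "f = (\<lambda>_. 0)" using that by (auto simp: subordinate_def)
    then show ?thesis using pos_functional_const[OF pos, of 0] by simp
  qed
  then have "content {} \<le> 0" unfolding content_def by (intro SUP_least) auto
  then show ?thesis by simp
qed

text \<open>Cutting off at height \<open>e\<close> replaces a subordinate function by one whose support \<open>{x. e \<le> f x}\<close> is
  a compact subset of \<open>U\<close>, at the cost of \<open>e\<close> times the total mass.\<close>

lemma cutoff:
  assumes f: "f \<in> subordinate U" and e: "0 \<le> e"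
  defines "g \<equiv> \<lambda>x. max (f x - e) 0"
  shows "g \<in> subordinate U" "g x \<noteq> 0 \<Longrightarrow> e \<le> f x" "\<phi> f \<le> \<phi> g + e * \<phi> (\<lambda>_. 1)"
proof -
  have cf: "cont f" using f by (simp add: subordinate_def)
  have cg: "cont g" unfolding g_def using cf by (intro continuous_intros)
  have "0 \<le> f x \<and> f x \<le> 1" for x using f by (auto simp: subordinate_def)
  then have "g x \<le> 1" for x using e by (auto simp: g_def) (smt (verit))
  then show "g \<in> subordinate U"
    using f e cg by (auto simp: subordinate_def g_def)
  show "g x \<noteq> 0 \<Longrightarrow> e \<le> f x" by (auto simp: g_def max_def split: if_splits)
  have "\<phi> f \<le> \<phi> (\<lambda>x. g x + e)"
    by (intro phi_mono cf continuous_intros cg) (auto simp: g_def)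
  also have "\<dots> = \<phi> g + e * \<phi> (\<lambda>_. 1)"
    using phi_add[OF cg, of "\<lambda>_. e"] pos_functional_const[OF pos, of e] by simp
  finally show "\<phi> f \<le> \<phi> g + e * \<phi> (\<lambda>_. 1)" .
qed

text \<open>It suffices to bound f up to the loss caused by a cut-off at height e, so arguments may
  work with the cut-off function and its closed support set.\<close>

lemma content_leI:
  assumes "\<And>f e. f \<in> subordinate U \<Longrightarrow> 0 < e \<Longrightarrow> e < 1 \<Longrightarrow> ennreal (\<phi> f) \<le> c + ennreal (e * \<phi> (\<lambda>_. 1))"
  shows "content U \<le> c"
  unfolding content_def
proof (rule SUP_least)
  fix f assume f: "f \<in> subordinate U"
  show "ennreal (\<phi> f) \<le> c"
    by (rule ennreal_le_all_epsilon[OF phi_one_nonneg assms[OF f]])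
qed

text \<open>A two-piece partition of unity: h is 1 on the part of the support set that V misses and
  0 outside U, so h g is subordinate to U and (1 - h) g to V.\<close>

lemma content_Un:
  assumes U: "open U" and V: "open V"
  shows "content (U \<union> V) \<le> content U + content V"
proof (rule content_leI)
  fix f and e :: real assume f: "f \<in> subordinate (U \<union> V)" and e: "0 < e" "e < 1"
  define g where "g = (\<lambda>x. max (f x - e) 0)"
  note g = cutoff[OF f less_imp_le[OF e(1)], folded g_def]
  have g2: "g x \<noteq> 0 \<Longrightarrow> e \<le> f x" for x by (simp add: g_def max_def split: if_splits)
  have cf: "cont f" and cg: "cont g" using f g(1) by (auto simp: subordinate_def)
  let ?K = "{x. e \<le> f x} - V"
  have "closed ?K" using closed_sublevel[OF cf] V by (intro closed_Diff)
  moreover have "?K \<subseteq> U" using f e by (force simp: subordinate_def)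
  ultimately obtain h :: "'a \<Rightarrow> real" where h: "cont h" "\<And>x. 0 \<le> h x" "\<And>x. h x \<le> 1"
    "\<And>x. x \<in> ?K \<Longrightarrow> h x = 1" "\<And>x. x \<notin> U \<Longrightarrow> h x = 0" using urysohn[OF _ U] by blast
  have g01: "0 \<le> g x" "g x \<le> 1" for x using g(1) by (auto simp: subordinate_def)
  have c1: "cont (\<lambda>x. h x * g x)" and c2: "cont (\<lambda>x. (1 - h x) * g x)"
    using h(1) cg by (auto intro!: continuous_intros)
  have "(\<lambda>x. h x * g x) \<in> subordinate U"
    using c1 h g01 by (auto simp: subordinate_def mult_le_one)
  moreover have "(\<lambda>x. (1 - h x) * g x) \<in> subordinate V"
  proof -
    have "(1 - h x) * g x = 0" if "x \<notin> V" for x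
      using that g2[of x] h(4)[of x] by auto
    then show ?thesis using c2 h(2,3) g01 by (auto simp: subordinate_def mult_le_one simp del: mult_eq_0_iff)
  qed
  ultimately have "ennreal (\<phi> (\<lambda>x. h x * g x)) + ennreal (\<phi> (\<lambda>x. (1 - h x) * g x)) \<le> content U + content V"
    by (intro add_mono content_upper)
  moreover have "\<phi> g = \<phi> (\<lambda>x. h x * g x) + \<phi> (\<lambda>x. (1 - h x) * g x)"
    using phi_add[OF c1 c2] by (simp add: algebra_simps)
  moreover have "0 \<le> \<phi> (\<lambda>x. h x * g x)" "0 \<le> \<phi> (\<lambda>x. (1 - h x) * g x)"
    using \<open>_ \<in> subordinate U\<close> \<open>_ \<in> subordinate V\<close> phi_nonneg by auto
  ultimately have "ennreal (\<phi> g) \<le> content U + content V" by simp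
  moreover have "ennreal (\<phi> f) \<le> ennreal (\<phi> g) + ennreal (e * \<phi> (\<lambda>_. 1))"
    using g(3) phi_nonneg[OF g(1)] e phi_one_nonneg
    by (simp add: ennreal_plus[symmetric] ennreal_leI del: ennreal_plus)
  ultimately show "ennreal (\<phi> f) \<le> content U + content V + ennreal (e * \<phi> (\<lambda>_. 1))"
    by (meson add_right_mono order_trans)
qed

lemma content_UN_finite:
  assumes "finite I" "\<And>i. i \<in> I \<Longrightarrow> open (U i)"
  shows "content (\<Union>i\<in>I. U i) \<le> (\<Sum>i\<in>I. content (U i))"
  using assms
proof (induction I rule: finite_induct)
  case (insert j I)
  have "content (U j \<union> (\<Union>i\<in>I. U i)) \<le> content (U j) + content (\<Union>i\<in>I. U i)"
    using insert by (intro content_Un) auto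
  also have "\<dots> \<le> content (U j) + (\<Sum>i\<in>I. content (U i))" using insert by (intro add_left_mono) auto
  finally show ?case using insert by simp
qed (simp add: content_empty)

text \<open>Compactness of the set where f is at least e leaves only finitely many of the U i to
  consider.\<close>

lemma content_UN:
  fixes U :: "nat \<Rightarrow> 'a set"
  assumes "\<And>i. open (U i)"
  shows "content (\<Union>i. U i) \<le> (\<Sum>i. content (U i))"
proof (rule content_leI)
  fix f and e :: real assume f: "f \<in> subordinate (\<Union>i. U i)" and e: "0 < e" "e < 1"
  define g where "g = (\<lambda>x. max (f x - e) 0)"
  note g = cutoff[OF f less_imp_le[OF e(1)], folded g_def]
  have g2: "g x \<noteq> 0 \<Longrightarrow> e \<le> f x" for x by (simp add: g_def max_def split: if_splits)
  have cf: "cont f" using f by (auto simp: subordinate_def)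
  have "{x. e \<le> f x} \<subseteq> (\<Union>i. U i)" using f e by (force simp: subordinate_def)
  then obtain I where I: "finite I" "{x. e \<le> f x} \<subseteq> (\<Union>i\<in>I. U i)"
    using compactE_image[OF closed_imp_compact[OF closed_sublevel[OF cf]], of UNIV U e] assms by metis
  have "g \<in> subordinate (\<Union>i\<in>I. U i)"
    unfolding subordinate_def
  proof (intro CollectI conjI allI impI)
    show "g x = 0" if "x \<notin> (\<Union>i\<in>I. U i)" for x using that g2[of x] I(2) by blast
  qed (use g(1) in \<open>auto simp: subordinate_def\<close>)
  then have "ennreal (\<phi> g) \<le> content (\<Union>i\<in>I. U i)" by (rule content_upper)
  also have "\<dots> \<le> (\<Sum>i\<in>I. content (U i))" using I assms by (intro content_UN_finite)
  also have "\<dots> \<le> (\<Sum>i. content (U i))" using I by (intro sum_le_suminf) auto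
  finally have "ennreal (\<phi> g) \<le> (\<Sum>i. content (U i))" .
  moreover have "ennreal (\<phi> f) \<le> ennreal (\<phi> g) + ennreal (e * \<phi> (\<lambda>_. 1))"
    using g(3) phi_nonneg[OF g(1)] e phi_one_nonneg
    by (simp add: ennreal_plus[symmetric] ennreal_leI del: ennreal_plus)
  ultimately show "ennreal (\<phi> f) \<le> (\<Sum>i. content (U i)) + ennreal (e * \<phi> (\<lambda>_. 1))"
    by (meson add_right_mono order_trans)
qed

lemma riesz_outer_open: "open U \<Longrightarrow> riesz_outer U = content U"
  unfolding riesz_outer_def by (intro antisym INF_greatest INF_lower content_mono) auto

lemma riesz_outer_mono: "E \<subseteq> F \<Longrightarrow> riesz_outer E \<le> riesz_outer F"
  unfolding riesz_outer_def by (intro INF_superset_mono) auto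

lemma riesz_outer_le_total: "riesz_outer E \<le> ennreal (\<phi> (\<lambda>_. 1))"
  using riesz_outer_mono[of E UNIV] riesz_outer_open[of UNIV] content_le_total[of UNIV] by simp

lemma riesz_outer_approx:
  assumes "0 < (e::ennreal)"
  obtains U where "open U" "E \<subseteq> U" "content U < riesz_outer E + e"
proof -
  have "riesz_outer E < riesz_outer E + e"
    using assms riesz_outer_le_total[of E] by (auto simp: top_unique)
  then show thesis using that unfolding riesz_outer_def by (subst (asm) INF_less_iff) auto
qed

lemma outer_measure_space_riesz_outer: "outer_measure_space (Pow UNIV) riesz_outer"
  unfolding outer_measure_space_def
proof (intro conjI)
  show "positive (Pow UNIV) riesz_outer"
    using riesz_outer_open[of "{}"] by (simp add: positive_def content_empty)
  show "increasing (Pow UNIV) riesz_outer" by (simp add: increasing_def riesz_outer_mono)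
  have "riesz_outer (\<Union>i. E i) \<le> (\<Sum>i. riesz_outer (E i))" for E :: "nat \<Rightarrow> 'a set"
  proof (rule ennreal_le_epsilon)
    fix e :: real assume e: "e > 0"
    have "\<exists>U. open U \<and> E i \<subseteq> U \<and> content U \<le> riesz_outer (E i) + ennreal (e * (1/2)^Suc i)" for i
      using riesz_outer_approx[of "ennreal (e * (1/2)^Suc i)" "E i"] e
      by (metis ennreal_less_zero_iff less_imp_le mult_pos_pos zero_less_divide_1_iff zero_less_numeral zero_less_power)
    then obtain U where U: "\<And>i. open (U i)" "\<And>i. E i \<subseteq> U i"
      "\<And>i. content (U i) \<le> riesz_outer (E i) + ennreal (e * (1/2)^Suc i)" by metis
    have "riesz_outer (\<Union>i. E i) \<le> riesz_outer (\<Union>i. U i)" using U(2) by (intro riesz_outer_mono) blast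
    also have "\<dots> = content (\<Union>i. U i)" using U(1) by (intro riesz_outer_open) auto
    also have "\<dots> \<le> (\<Sum>i. content (U i))" by (rule content_UN[OF U(1)])
    also have "\<dots> \<le> (\<Sum>i. riesz_outer (E i) + ennreal (e * (1/2)^Suc i))"
      by (intro suminf_le U(3)) auto
    also have "\<dots> = (\<Sum>i. riesz_outer (E i)) + (\<Sum>i. ennreal (e * (1/2)^Suc i))"
      by (intro suminf_add[symmetric]) auto
    also have "(\<Sum>i. ennreal (e * (1/2)^Suc i)) = ennreal e"
    proof -
      have "(\<lambda>i. e * (1/2)^Suc i) sums (e * 1)" by (intro sums_mult power_half_series)
      then show ?thesis using e by (subst suminf_ennreal2) (auto simp: sums_iff)
    qed
    finally show "riesz_outer (\<Union>i. E i) \<le> (\<Sum>i. riesz_outer (E i)) + ennreal e" .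
  qed
  then show "countably_subadditive (Pow UNIV) riesz_outer"
    by (simp add: countably_subadditive_def)
qed

lemma riesz_outer_Un: "riesz_outer (E \<union> F) \<le> riesz_outer E + riesz_outer F"
proof (rule ennreal_le_epsilon)
  fix e :: real assume e: "e > 0"
  obtain U where U: "open U" "E \<subseteq> U" "content U < riesz_outer E + ennreal (e/2)"
    by (rule riesz_outer_approx[of "ennreal (e/2)" E]) (use e in auto)
  obtain V where V: "open V" "F \<subseteq> V" "content V < riesz_outer F + ennreal (e/2)"
    by (rule riesz_outer_approx[of "ennreal (e/2)" F]) (use e in auto)
  have "riesz_outer (E \<union> F) \<le> content (U \<union> V)"
    unfolding riesz_outer_open[OF open_Un[OF U(1) V(1)], symmetric]
    using U(2) V(2) by (intro riesz_outer_mono) blast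
  also have "\<dots> \<le> content U + content V" by (rule content_Un[OF U(1) V(1)])
  also have "\<dots> \<le> (riesz_outer E + ennreal (e/2)) + (riesz_outer F + ennreal (e/2))"
    using U V by (intro add_mono less_imp_le)
  also have "\<dots> = riesz_outer E + riesz_outer F + (ennreal (e/2) + ennreal (e/2))"
    by (simp add: ac_simps)
  also have "ennreal (e/2) + ennreal (e/2) = ennreal e"
    using e by (subst ennreal_plus[symmetric]) auto
  finally show "riesz_outer (E \<union> F) \<le> riesz_outer E + riesz_outer F + ennreal e" .
qed

text \<open>Caratheodory's condition. If g nearly exhausts the content of V \<inter> U and h lives
  on V minus the support set of g, then g + h is again subordinate to V, so the two contents add up
  to at most that of V.\<close>

lemma open_lambda_system:
  assumes U: "open U"
  shows "U \<in> lambda_system UNIV (Pow UNIV) riesz_outer"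
proof -
  interpret sigma_algebra UNIV "Pow (UNIV :: 'a set)" by (rule sigma_algebra_Pow)
  \<comment> \<open>Open test sets come first; an arbitrary E is then reduced to its open
    supersets.\<close>
  have opn: "content (V \<inter> U) + riesz_outer (V - U) \<le> content V" if V: "open V" for V
  proof -
    have "ennreal (\<phi> f) + riesz_outer (V - U) \<le> content V" if f: "f \<in> subordinate (V \<inter> U)" for f
    proof (rule ennreal_le_all_epsilon[OF phi_one_nonneg])
      fix e :: real assume e: "0 < e" "e < 1"
      define g where "g = (\<lambda>x. max (f x - e) 0)"
      note g = cutoff[OF f less_imp_le[OF e(1)], folded g_def]
  have g2: "g x \<noteq> 0 \<Longrightarrow> e \<le> f x" for x by (simp add: g_def max_def split: if_splits)
      let ?K = "{x. e \<le> f x}"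
      have cf: "cont f" using f by (auto simp: subordinate_def)
      have K: "closed ?K" "?K \<subseteq> V \<inter> U"
        using closed_sublevel[OF cf] f e by (auto simp: subordinate_def intro: ccontr)
      have oVK: "open (V - ?K)" using V K(1) by (rule open_Diff)
      have *: "ennreal (\<phi> g) + ennreal (\<phi> h) \<le> content V" if h: "h \<in> subordinate (V - ?K)" for h
      proof -
        have c: "cont g" "cont h" using g(1) h by (auto simp: subordinate_def)
        have "(\<lambda>x. g x + h x) \<in> subordinate V"
          unfolding subordinate_def
        proof (intro CollectI conjI allI impI)
          show "cont (\<lambda>x. g x + h x)" using c by (rule continuous_on_add)
          fix x
          show "0 \<le> g x + h x" using g(1) h by (auto simp: subordinate_def)
          \<comment> \<open>At each point at most one of g and h is nonzero.\<close>
          show "g x + h x \<le> 1"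
          proof (cases "g x = 0")
            case False
            then have "h x = 0" using g2[of x] h by (auto simp: subordinate_def)
            then show ?thesis using g(1) by (auto simp: subordinate_def)
          qed (use h in \<open>auto simp: subordinate_def\<close>)
          show "g x + h x = 0" if "x \<notin> V" using g(1) h that by (auto simp: subordinate_def)
        qed
        then have "ennreal (\<phi> (\<lambda>x. g x + h x)) \<le> content V" by (rule content_upper)
        then show ?thesis using phi_add[OF c] phi_nonneg[OF g(1)] phi_nonneg[OF h] by simp
      qed
      have ne: "subordinate (V - ?K) \<noteq> {}"
        by (auto simp: subordinate_def intro!: exI[of _ "\<lambda>_. 0"])
      have "ennreal (\<phi> g) + riesz_outer (V - U) \<le> ennreal (\<phi> g) + content (V - ?K)"
        using riesz_outer_mono[of "V - U" "V - ?K"] riesz_outer_open[OF oVK] K(2)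
        by (intro add_left_mono) auto
      also have "\<dots> \<le> content V"
        unfolding content_def[of "V - ?K"] ennreal_SUP_add_right[OF ne]
        by (intro SUP_least *)
      finally have "ennreal (\<phi> g) + riesz_outer (V - U) \<le> content V" .
      moreover have "ennreal (\<phi> f) \<le> ennreal (\<phi> g) + ennreal (e * \<phi> (\<lambda>_. 1))"
        using g(3) phi_nonneg[OF g(1)] e phi_one_nonneg
        by (simp add: ennreal_plus[symmetric] ennreal_leI del: ennreal_plus)
      ultimately have "ennreal (\<phi> f) + riesz_outer (V - U) \<le>
          (ennreal (\<phi> g) + riesz_outer (V - U)) + ennreal (e * \<phi> (\<lambda>_. 1))"
        by (metis add.commute add.left_commute add_right_mono)
      also have "\<dots> \<le> content V + ennreal (e * \<phi> (\<lambda>_. 1))"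
        using \<open>ennreal (\<phi> g) + riesz_outer (V - U) \<le> content V\<close> by (rule add_right_mono)
      finally show "ennreal (\<phi> f) + riesz_outer (V - U) \<le> content V + ennreal (e * \<phi> (\<lambda>_. 1))" .
    qed note 1 = this
    have ne: "subordinate (V \<inter> U) \<noteq> {}"
      by (auto simp: subordinate_def intro!: exI[of _ "\<lambda>_. 0"])
    show ?thesis
      unfolding content_def[of "V \<inter> U"] ennreal_SUP_add_left[OF ne, symmetric]
      by (intro SUP_least 1)
  qed
  have "riesz_outer (E \<inter> U) + riesz_outer (E - U) = riesz_outer E" for E
  proof (rule antisym)
    show "riesz_outer (E \<inter> U) + riesz_outer (E - U) \<le> riesz_outer E"
      unfolding riesz_outer_def[of E]
    proof (rule INF_greatest, safe)
      fix V assume V: "open V" "E \<subseteq> V"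
      have "riesz_outer (E \<inter> U) + riesz_outer (E - U) \<le> riesz_outer (V \<inter> U) + riesz_outer (V - U)"
        using V by (intro add_mono riesz_outer_mono) auto
      also have "\<dots> \<le> content V"
        unfolding riesz_outer_open[OF open_Int[OF V(1) U]] by (rule opn[OF V(1)])
      finally show "riesz_outer (E \<inter> U) + riesz_outer (E - U) \<le> content V" .
    qed
    show "riesz_outer E \<le> riesz_outer (E \<inter> U) + riesz_outer (E - U)"
      using riesz_outer_Un[of "E \<inter> U" "E - U"] by (simp add: Int_Diff_Un)
  qed
  then show ?thesis unfolding lambda_system_eq by blast
qed

section \<open>The representing measure\<close>

definition riesz_measure :: "'a measure" where
  "riesz_measure = measure_of UNIV (sets borel) riesz_outer"

lemma sets_riesz_measure: "sets riesz_measure = sets borel"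
  unfolding riesz_measure_def by (metis sets.sets_measure_of_eq space_borel)

text \<open>The Caratheodory measurable sets form a sigma-algebra containing the open sets, hence
  the Borel sets, and the outer measure is countably additive on it.\<close>

lemma emeasure_riesz_measure:
  assumes "B \<in> sets borel"
  shows "emeasure riesz_measure B = riesz_outer B"
proof -
  interpret sigma_algebra UNIV "Pow (UNIV :: 'a set)" by (rule sigma_algebra_Pow)
  let ?L = "lambda_system UNIV (Pow UNIV) riesz_outer"
  have L: "measure_space UNIV ?L riesz_outer"
    by (rule caratheodory_lemma[OF outer_measure_space_riesz_outer])
  then interpret L: sigma_algebra UNIV ?L by (simp add: measure_space_def)
  have "{S. open S} \<subseteq> ?L" using open_lambda_system by blast
  then have "sets (borel :: 'a measure) \<subseteq> ?L"
    unfolding borel_def by (subst sets_measure_of) (auto simp del: Pow_UNIV dest!: L.sigma_sets_subset[THEN subsetD, rotated])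
  moreover have "sigma_algebra UNIV (sets (borel :: 'a measure))"
    by (metis sets.sigma_algebra_axioms space_borel)
  ultimately have "measure_space UNIV (sets borel) riesz_outer"
    using measure_down[OF L] by blast
  then show ?thesis
    unfolding riesz_measure_def using assms
    by (intro emeasure_measure_of_sigma) (auto simp: measure_space_def)
qed

lemma finite_measure_riesz_measure: "finite_measure riesz_measure"
proof
  have "space riesz_measure = UNIV" using sets_eq_imp_space_eq[OF sets_riesz_measure] by simp
  then show "emeasure riesz_measure (space riesz_measure) \<noteq> \<infinity>"
    using emeasure_riesz_measure[of UNIV] riesz_outer_le_total[of UNIV] by (auto simp: top_unique)
qed

lemma regular_riesz_measure: "regular_borel riesz_measure"
proof (rule regular_borelI_outer[OF sets_riesz_measure finite_measure_riesz_measure])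
  interpret finite_measure riesz_measure by (rule finite_measure_riesz_measure)
  fix B :: "'a set" and e :: real assume B: "B \<in> sets borel" and e: "e > 0"
  obtain U where U: "open U" "B \<subseteq> U" "content U < riesz_outer B + ennreal e"
    by (rule riesz_outer_approx[of "ennreal e" B]) (use e in auto)
  have "emeasure riesz_measure U \<le> emeasure riesz_measure B + ennreal e"
    using U B riesz_outer_open[OF U(1)] by (simp add: emeasure_riesz_measure)
  then have "measure riesz_measure U \<le> measure riesz_measure B + e"
    using e by (simp add: emeasure_eq_measure ennreal_plus[symmetric] del: ennreal_plus)
  then show "\<exists>U. open U \<and> B \<subseteq> U \<and> measure riesz_measure U \<le> measure riesz_measure B + e"
    using U by blast
qed

lemma measure_riesz_open:
  assumes "open U"
  shows "ennreal (measure riesz_measure U) = content U"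
  using emeasure_riesz_measure[of U] riesz_outer_open[OF assms] assms
    finite_measure.emeasure_eq_measure[OF finite_measure_riesz_measure, of U] by simp

text \<open>Cut f horizontally into n slices u k, each lying between the indicators of U (k+1) and U
  k. Both the integral and \<phi> of a slice lie between the measures of these two sets, so the
  total discrepancy telescopes to at most the total mass; the scaling by n turns this into an error
  of order 1/n.\<close>

lemma integral_riesz_measure_unit:
  assumes f: "cont f" and f01: "\<And>x. 0 \<le> f x" "\<And>x. f x \<le> 1"
  shows "(\<integral>x. f x \<partial>riesz_measure) = \<phi> f"
proof -
  interpret finite_measure riesz_measure by (rule finite_measure_riesz_measure)
  note reg = regular_riesz_measure
  let ?M = "measure riesz_measure"
  have "\<bar>(\<integral>x. f x \<partial>riesz_measure) - \<phi> f\<bar> \<le> inverse (real (Suc m)) * \<phi> (\<lambda>_. 1)" for m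
  proof -
    define n where "n = Suc m"
    have n: "real n > 0" by (simp add: n_def)
    define u where "u k x = real n * min (max (f x - real k / n) 0) (1 / n)" for k x
    define U where "U k = {x. real k / n < f x}" for k
    have cu: "cont (u k)" for k unfolding u_def using f by (intro continuous_intros)
    have oU: "open (U k)" for k unfolding U_def by (rule open_superlevel[OF f])
    have u01: "0 \<le> u k x" "u k x \<le> 1" for k x
    proof -
      have "u k x \<le> real n * (1 / n)" unfolding u_def using n by (intro mult_left_mono) auto
      then show "u k x \<le> 1" using n by simp
      show "0 \<le> u k x" by (auto simp: u_def)
    qed
    have u0: "u k x = 0" if "x \<notin> U k" for k x using that by (auto simp: u_def U_def min_def max_def)
    have u1: "u k x = 1" if "x \<in> U (Suc k)" for k x
    proof -
      have "1 / n \<le> f x - real k / n" using that by (simp add: U_def add_divide_distrib)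
      moreover have "1 / real n > 0" using n by simp
      ultimately have "min (max (f x - real k / n) 0) (1 / n) = 1 / real n" by linarith
      then have "u k x = real n * (1 / n)" by (simp add: u_def)
      then show ?thesis using n by simp
    qed
    have us: "u k \<in> subordinate (U k)" for k using cu u01 u0 by (auto simp: subordinate_def)
    have phi_le: "\<phi> (u k) \<le> ?M (U k)" for k
      using content_upper[OF us] measure_riesz_open[OF oU, of k] by (metis ennreal_le_iff measure_nonneg)
    \<comment> \<open>u k is 1 on U (k+1), so it dominates every function competing in the content
      of that set.\<close>
    have phi_ge: "?M (U (Suc k)) \<le> \<phi> (u k)" for k
    proof -
      have "\<phi> h \<le> \<phi> (u k)" if h: "h \<in> subordinate (U (Suc k))" for h
      proof (rule phi_mono)
        show "cont h" using h by (auto simp: subordinate_def)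
        show "h x \<le> u k x" for x
          using h u1[of x k] u01[of k x] by (cases "x \<in> U (Suc k)") (auto simp: subordinate_def)
      qed (rule cu)
      then have "content (U (Suc k)) \<le> ennreal (\<phi> (u k))"
        unfolding content_def by (intro SUP_least ennreal_leI)
      then show ?thesis
        using measure_riesz_open[OF oU, of "Suc k"] phi_nonneg[OF us, of k] by (metis ennreal_le_iff)
    qed
    have int_le: "(\<integral>x. u k x \<partial>riesz_measure) \<le> ?M (U k)" for k
      using u01 u0 oU by (intro integral_le_measure[OF reg] regular_integrable[OF reg] cu) auto
    have int_ge: "?M (U (Suc k)) \<le> (\<integral>x. u k x \<partial>riesz_measure)" for k
      using u01 u1 oU by (intro measure_le_integral[OF reg] regular_integrable[OF reg] cu) auto
    have split: "(\<Sum>k<j. u k x) = real n * min (f x) (real j / n)" for j x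
    proof (induction j)
      case 0 then show ?case using f01[of x] by simp
    next
      case (Suc j)
      have *: "real (Suc j) / n = real j / n + 1 / n" by (simp add: add_divide_distrib)
      have "1 / real n > 0" using n by simp
      then have "min (f x) (real j / n) + min (max (f x - real j / n) 0) (1 / n) = min (f x) (real (Suc j) / n)"
        unfolding * by linarith
      then show ?case unfolding sum.lessThan_Suc Suc by (simp add: u_def distrib_left[symmetric] del: of_nat_Suc)
    qed
    have sum: "(\<Sum>k<n. u k x) = real n * f x" for x
      using split[of x n] n f01(2)[of x] by (simp add: min_def)
    have "real n * \<phi> f = (\<Sum>k<n. \<phi> (u k))"
      using pos_functional_sum[OF pos, of "{..<n}" u] cu sum phi_cmult[OF f, of "real n"] by simp
    moreover have "real n * (\<integral>x. f x \<partial>riesz_measure) = (\<Sum>k<n. (\<integral>x. u k x \<partial>riesz_measure))"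
      using Bochner_Integration.integral_sum[of "{..<n}" riesz_measure u] regular_integrable[OF reg cu] sum by simp
    ultimately have "real n * \<bar>(\<integral>x. f x \<partial>riesz_measure) - \<phi> f\<bar>
        = \<bar>\<Sum>k<n. (\<integral>x. u k x \<partial>riesz_measure) - \<phi> (u k)\<bar>"
      using n by (simp add: sum_subtractf abs_mult[symmetric] right_diff_distrib[symmetric] del: abs_mult)
         (metis abs_mult abs_of_pos n right_diff_distrib)
    also have "\<dots> \<le> (\<Sum>k<n. \<bar>(\<integral>x. u k x \<partial>riesz_measure) - \<phi> (u k)\<bar>)" by (rule sum_abs)
    also have "\<dots> \<le> (\<Sum>k<n. ?M (U k) - ?M (U (Suc k)))"
      using phi_le phi_ge int_le int_ge by (intro sum_mono) (smt (verit))
    also have "\<dots> = ?M (U 0) - ?M (U n)" by (rule sum_lessThan_telescope')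
    also have "\<dots> \<le> ?M (U 0)" by simp
    also have "\<dots> \<le> \<phi> (\<lambda>_. 1)"
      using measure_riesz_open[OF oU, of 0] content_le_total[of "U 0"] phi_one_nonneg by (metis ennreal_le_iff)
    finally show ?thesis using n by (simp add: n_def[symmetric] field_simps)
  qed
  then have "(\<lambda>m. inverse (real (Suc m)) * \<phi> (\<lambda>_. 1)) \<longlonglongrightarrow> 0 * \<phi> (\<lambda>_. 1) \<Longrightarrow>
      \<bar>(\<integral>x. f x \<partial>riesz_measure) - \<phi> f\<bar> \<le> 0 * \<phi> (\<lambda>_. 1)"
    by (intro LIMSEQ_le_const) auto
  then show ?thesis using tendsto_mult_right[OF LIMSEQ_inverse_real_of_nat, of "\<phi> (\<lambda>_. 1)"] by simp
qed

lemma integral_riesz_measure: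
  assumes f: "cont f"
  shows "(\<integral>x. f x \<partial>riesz_measure) = \<phi> f"
proof -
  interpret finite_measure riesz_measure by (rule finite_measure_riesz_measure)
  obtain B where B: "B > 0" "\<And>x. norm (f x) \<le> B" using cont_bounded[OF f] by blast
  define g where "g x = inverse (2 * B) * (f x + B)" for x
  have cg: "cont g" unfolding g_def using f by (intro continuous_intros)
  have g01: "0 \<le> g x" "g x \<le> 1" for x
    using B(1) B(2)[of x] by (auto simp: g_def field_simps abs_le_iff)
  have fg: "f = (\<lambda>x. 2 * B * g x - B)" using B(1) by (auto simp: g_def field_simps fun_eq_iff)
  have 1: "(\<integral>x. g x \<partial>riesz_measure) = \<phi> g" by (rule integral_riesz_measure_unit[OF cg g01])
  have 2: "(\<integral>x. 1 \<partial>riesz_measure) = \<phi> (\<lambda>_. 1)"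
    by (rule integral_riesz_measure_unit) auto
  have c: "cont (\<lambda>x. 2 * B * g x)" using cg by (intro continuous_intros)
  have "\<phi> f = 2 * B * \<phi> g - B * \<phi> (\<lambda>_. 1)"
    unfolding fg
    using pos_functional_diff[OF pos c, of "\<lambda>_. B"] phi_cmult[OF cg, of "2 * B"] pos_functional_const[OF pos, of B]
    by simp
  moreover have "(\<integral>x. f x \<partial>riesz_measure) = 2 * B * (\<integral>x. g x \<partial>riesz_measure) - B * (\<integral>x. 1 \<partial>riesz_measure)"
    unfolding fg using regular_integrable[OF regular_riesz_measure c] by (subst Bochner_Integration.integral_diff) auto
  ultimately show ?thesis using 1 2 by simp
qed

end

theorem riesz_representation:
  assumes "pos_functional (\<phi> :: ('a \<Rightarrow> real) \<Rightarrow> real)"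
  obtains \<mu> where "regular_borel \<mu>" "\<And>f. cont f \<Longrightarrow> (\<integral>x. f x \<partial>\<mu>) = \<phi> f"
proof
  show "regular_borel (riesz_measure \<phi>)" by (rule regular_riesz_measure[OF assms])
  show "(\<integral>x. f x \<partial>riesz_measure \<phi>) = \<phi> f" if "cont f" for f
    by (rule integral_riesz_measure[OF assms that])
qed

end

section \<open>Invariant states and their extreme points\<close>

text \<open>Tychonoff's theorem, stated for the function type with its product topology.\<close>

lemma compact_function_box:
  fixes K :: "'i \<Rightarrow> 'b::topological_space set"
  assumes "\<And>i. compact (K i)"
  shows "compact {f. \<forall>i. f i \<in> K i}"
proof -
  have "compactin (product_topology (\<lambda>_. euclidean) UNIV) (PiE UNIV K)"
    using assms by (simp add: compactin_PiE)
  then show ?thesis by (simp add: euclidean_product_topology PiE_def Pi_def)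
qed

lemma closed_eval_conditions:
  shows closed_eval_eq: "closed {\<phi> :: 'i \<Rightarrow> real. \<phi> f = c}"
    and closed_eval_ge: "closed {\<phi> :: 'i \<Rightarrow> real. c \<le> \<phi> f}"
    and closed_eval_eq_eval: "closed {\<phi> :: 'i \<Rightarrow> real. \<phi> f = c * \<phi> g}"
    and closed_eval_add: "closed {\<phi> :: 'i \<Rightarrow> real. \<phi> f = \<phi> g + \<phi> h}"
    and closed_eval_dist: "closed {\<phi> :: 'i \<Rightarrow> real. \<bar>\<phi> f - \<phi> g\<bar> \<le> c}"
  by (intro closed_Collect_eq closed_Collect_le continuous_intros continuous_on_product_coordinates)+

lemma closed_Collect_impI: "(P \<Longrightarrow> closed {x. Q x}) \<Longrightarrow> closed {x. P \<longrightarrow> Q x}"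
  by (cases P) simp_all

text \<open>For a singleton G this says that its element is an extreme point of M.\<close>

definition face :: "('i \<Rightarrow> real) set \<Rightarrow> ('i \<Rightarrow> real) set \<Rightarrow> bool" where
  "face M G \<longleftrightarrow> G \<subseteq> M \<and> (\<forall>a\<in>M. \<forall>b\<in>M. \<forall>t. 0 < t \<longrightarrow> t < 1 \<longrightarrow>
     (\<lambda>f. t * a f + (1 - t) * b f) \<in> G \<longrightarrow> a \<in> G \<and> b \<in> G)"

lemma face_maximum:
  assumes G: "face M G" and max: "\<And>\<phi>. \<phi> \<in> G \<Longrightarrow> \<phi> f \<le> c"
  shows "face M {\<phi>\<in>G. \<phi> f = c}"
  unfolding face_def
proof (intro conjI ballI allI impI)
  show "{\<phi>\<in>G. \<phi> f = c} \<subseteq> M" using G by (auto simp: face_def)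
  fix a b and t :: real
  assume ab: "a \<in> M" "b \<in> M" and t: "0 < t" "t < 1"
    and conv: "(\<lambda>f. t * a f + (1 - t) * b f) \<in> {\<phi>\<in>G. \<phi> f = c}"
  then have "a \<in> G" "b \<in> G" using G unfolding face_def by blast+
  moreover from this have "a f \<le> c" "b f \<le> c" using max by auto
  \<comment> \<open>Two nonnegative deficits with positive weights and sum 0 both vanish.\<close>
  moreover have "t * (c - a f) + (1 - t) * (c - b f) = 0" using conv by (simp add: algebra_simps)
  ultimately have "t * (c - a f) = 0" "(1 - t) * (c - b f) = 0"
    using t by (smt (verit) mult_nonneg_nonneg)+
  then show "a \<in> {\<phi>\<in>G. \<phi> f = c}" "b \<in> {\<phi>\<in>G. \<phi> f = c}"
    using t \<open>a \<in> G\<close> \<open>b \<in> G\<close> by auto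
qed

text \<open>Krein--Milman: a minimal closed face is a point, since otherwise some coordinate is not
  constant on it and cuts out a smaller face.\<close>

lemma extreme_point_in_face:
  assumes F: "compact F" "F \<noteq> {}" "face M F" and Fcl: "closed F"
  obtains \<phi> where "\<phi> \<in> F" "face M {\<phi>}"
proof -
  define \<A> where "\<A> = {G. closed G \<and> G \<noteq> {} \<and> face M G \<and> G \<subseteq> F}"
  have FA: "F \<in> \<A>" using F Fcl by (simp add: \<A>_def)
  have "\<exists>m\<in>\<A>. \<forall>a\<in>\<A>. a \<subseteq> m \<longrightarrow> a = m"
  proof (rule predicate_Zorn)
    show "partial_order_on \<A> (relation_of (\<lambda>G H. H \<subseteq> G) \<A>)"
      by (rule partial_order_on_relation_ofI) auto
    fix C assume C: "C \<in> Chains (relation_of (\<lambda>G H. H \<subseteq> G) \<A>)"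
    then have CA: "C \<subseteq> \<A>" and lin: "\<And>G H. G \<in> C \<Longrightarrow> H \<in> C \<Longrightarrow> G \<subseteq> H \<or> H \<subseteq> G"
      by (auto simp: Chains_def relation_of_def)
    show "\<exists>u\<in>\<A>. \<forall>a\<in>C. u \<subseteq> a"
    proof (cases "C = {}")
      case True then show ?thesis using FA by auto
    next
      case False
      \<comment> \<open>A finite part of a chain has a least member, which gives the finite
        intersection property.\<close>
      have fin: "\<exists>G\<in>C. G \<subseteq> \<Inter>D" if "finite D" "D \<subseteq> C" "D \<noteq> {}" for D
        using that(1,3,2)
      proof (induction D rule: finite_ne_induct)
        case (insert x D)
        then obtain G where G: "G \<in> C" "G \<subseteq> \<Inter>D" by blast
        have x: "x \<in> C" using insert.prems by blast
        show ?case
        proof (cases "x \<subseteq> G")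
          case True
          then have "x \<subseteq> \<Inter>(insert x D)" using G(2) by blast
          then show ?thesis using x by blast
        next
          case False
          then have "G \<subseteq> \<Inter>(insert x D)" using lin[OF x G(1)] G(2) by blast
          then show ?thesis using G(1) by blast
        qed
      qed blast
      have "F \<inter> \<Inter>C \<noteq> {}"
      proof (rule compact_imp_fip[OF F(1)])
        show "closed T" if "T \<in> C" for T using that CA unfolding \<A>_def by blast
        fix D assume D: "finite D" "D \<subseteq> C"
        show "F \<inter> \<Inter>D \<noteq> {}"
        proof (cases "D = {}")
          case False
          then obtain G where G: "G \<in> C" "G \<subseteq> \<Inter>D" using fin[OF D] by blast
          then have "G \<noteq> {}" "G \<subseteq> F" using CA unfolding \<A>_def by blast+
          then show ?thesis using G(2) by blast
        qed (use F in simp)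
      qed
      moreover have "face M (\<Inter>C)"
        using CA False unfolding \<A>_def face_def by blast
      ultimately have "\<Inter>C \<in> \<A>" using CA False by (auto simp: \<A>_def)
      then show ?thesis by blast
    qed
  qed
  then obtain m where m: "m \<in> \<A>" and min: "\<And>a. a \<in> \<A> \<Longrightarrow> a \<subseteq> m \<Longrightarrow> a = m" by blast
  have mF: "m \<subseteq> F" and mcl: "closed m" and "m \<noteq> {}" and face: "face M m" using m by (auto simp: \<A>_def)
  have cm: "compact m" using compact_Int_closed[OF F(1) mcl] mF by (simp add: Int_absorb1)
  obtain \<phi> where \<phi>: "\<phi> \<in> m" using \<open>m \<noteq> {}\<close> by blast
  have eq: "\<psi> f = \<phi> f" if \<psi>: "\<psi> \<in> m" for \<psi> f
  proof -
    have c: "continuous_on m (\<lambda>x. x f)"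
      by (rule continuous_on_subset[OF continuous_on_product_coordinates subset_UNIV])
    obtain \<rho> where \<rho>: "\<rho> \<in> m" "\<And>x. x \<in> m \<Longrightarrow> x f \<le> \<rho> f"
      using continuous_attains_sup[OF cm \<open>m \<noteq> {}\<close> c] by blast
    let ?G = "{x\<in>m. x f = \<rho> f}"
    have "closed (m \<inter> {x. x f = \<rho> f})" using mcl closed_eval_eq by (rule closed_Int)
    then have "closed ?G" by (simp add: Int_def)
    moreover have "face M ?G" by (rule face_maximum[OF face \<rho>(2)])
    ultimately have "?G \<in> \<A>" using \<rho>(1) mF by (auto simp: \<A>_def)
    then have G: "?G = m" by (rule min) auto
    have "\<psi> \<in> ?G" "\<phi> \<in> ?G" unfolding G by (rule \<psi>, rule \<phi>)
    then show ?thesis by simp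
  qed
  have "m = {\<phi>}" using eq \<phi> by (auto simp: fun_eq_iff)
  then show thesis using that \<phi> mF face by auto
qed

section \<open>Compactness of the set of states\<close>

context compact_t2
begin

text \<open>The value 0 at discontinuous functions makes a state determined by its continuous test
  functions, so that equality of states means equality of functionals, and keeps these coordinates
  bounded as well.\<close>

definition states :: "(('a \<Rightarrow> real) \<Rightarrow> real) set" where
  "states = {\<phi>. pos_functional \<phi> \<and> \<phi> (\<lambda>_. 1) = 1 \<and> (\<forall>f. \<not> cont f \<longrightarrow> \<phi> f = 0)}"

definition invariant_states :: "('a \<Rightarrow> 'a) \<Rightarrow> (('a \<Rightarrow> real) \<Rightarrow> real) set" where
  "invariant_states \<alpha> = {\<phi>\<in>states. \<forall>f. cont f \<longrightarrow> \<phi> (\<lambda>x. f (\<alpha> x)) = \<phi> f}"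

lemma state_bounds:
  assumes "\<phi> \<in> states" "cont f" "\<And>x. \<bar>f x\<bar> \<le> B"
  shows "\<bar>\<phi> f\<bar> \<le> B"
proof -
  have pos: "pos_functional \<phi>" and one: "\<phi> (\<lambda>_. 1) = 1" using assms by (auto simp: states_def)
  have le: "- B \<le> f x" "f x \<le> B" for x using assms(3)[of x] by auto
  have "\<phi> f \<le> \<phi> (\<lambda>_. B)" "\<phi> (\<lambda>_. - B) \<le> \<phi> f"
    using le by (auto intro!: pos_functional_mono[OF pos] assms(2))
  then show ?thesis
    using pos_functional_const[OF pos, of B] pos_functional_const[OF pos, of "- B"] one by simp
qed

lemma closed_states: "closed states"
  unfolding states_def pos_functional_def
  by (intro closed_Collect_conj closed_Collect_all closed_Collect_impI
      closed_eval_conditions closed_Collect_const)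

text \<open>Banach-Alaoglu: every coordinate of a state lies in an interval depending only on the
  function, and being a state is a closed condition on coordinates.\<close>

lemma compact_states: "compact states"
proof -
  \<comment> \<open>The choice picks some bound of f, which exists since f is continuous on a
    compact space.\<close>
  define K where "K f = (if cont f then {- (SOME B. \<forall>x. \<bar>f x\<bar> \<le> B)..(SOME B. \<forall>x. \<bar>f x\<bar> \<le> B)} else {0})"
    for f :: "'a \<Rightarrow> real"
  have "compact {\<phi>. \<forall>f. \<phi> f \<in> K f}" by (rule compact_function_box) (auto simp: K_def)
  moreover have "states \<subseteq> {\<phi>. \<forall>f. \<phi> f \<in> K f}"
  proof safe
    fix \<phi> f assume \<phi>: "\<phi> \<in> states"
    show "\<phi> f \<in> K f"
    proof (cases "cont f")
      case True
      then obtain B where "\<And>x. norm (f x) \<le> B" using cont_bounded[OF True] by blast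
      then have "\<forall>x. \<bar>f x\<bar> \<le> (SOME B. \<forall>x. \<bar>f x\<bar> \<le> B)" by (intro someI) auto
      then have "\<bar>\<phi> f\<bar> \<le> (SOME B. \<forall>x. \<bar>f x\<bar> \<le> B)" by (intro state_bounds[OF \<phi> True]) auto
      then show ?thesis using True by (simp add: K_def abs_le_iff)
    qed (use \<phi> in \<open>auto simp: K_def states_def\<close>)
  qed
  ultimately show ?thesis
    using compact_Int_closed[OF _ closed_states] by (metis Int_absorb1)
qed

lemma closed_invariant_states: "closed (invariant_states \<alpha>)"
proof -
  have "closed (states \<inter> {\<phi>. \<forall>f. cont f \<longrightarrow> \<phi> (\<lambda>x. f (\<alpha> x)) = 1 * \<phi> f})"
    by (intro closed_Int closed_states closed_Collect_all closed_Collect_impI closed_eval_conditions)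
  then show ?thesis by (simp add: invariant_states_def Int_def)
qed

lemma compact_invariant_states: "compact (invariant_states \<alpha>)"
proof -
  have "states \<inter> invariant_states \<alpha> = invariant_states \<alpha>" by (auto simp: invariant_states_def)
  then show ?thesis using compact_Int_closed[OF compact_states closed_invariant_states, of \<alpha>] by simp
qed

section \<open>Empirical states and uniform bounds for Birkhoff sums\<close>

definition birkhoff_sum :: "('a \<Rightarrow> 'a) \<Rightarrow> ('a \<Rightarrow> real) \<Rightarrow> nat \<Rightarrow> 'a \<Rightarrow> real" where
  "birkhoff_sum \<alpha> q n y = (\<Sum>k<n. q ((\<alpha> ^^ k) y))"

definition empirical_state :: "('a \<Rightarrow> 'a) \<Rightarrow> nat \<Rightarrow> 'a \<Rightarrow> ('a \<Rightarrow> real) \<Rightarrow> real" where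
  "empirical_state \<alpha> n y f = (if cont f then birkhoff_sum \<alpha> f n y / n else 0)"

lemma empirical_state_in_states:
  assumes "n > 0"
  shows "empirical_state \<alpha> n y \<in> states"
proof -
  have "pos_functional (empirical_state \<alpha> n y)"
    unfolding pos_functional_def
  proof (intro conjI allI impI)
    fix f g :: "'a \<Rightarrow> real" assume "cont f" "cont g"
    then show "empirical_state \<alpha> n y (\<lambda>x. f x + g x) = empirical_state \<alpha> n y f + empirical_state \<alpha> n y g"
      using continuous_on_add[of UNIV f g]
      by (simp add: empirical_state_def birkhoff_sum_def sum.distrib add_divide_distrib)
  next
    fix c and f :: "'a \<Rightarrow> real" assume "cont f"
    then show "empirical_state \<alpha> n y (\<lambda>x. c * f x) = c * empirical_state \<alpha> n y f"
      using continuous_on_mult_const[of UNIV c] continuous_on_mult[of UNIV "\<lambda>_. c" f]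
      by (simp add: empirical_state_def birkhoff_sum_def sum_distrib_left[symmetric])
  qed (auto simp: empirical_state_def birkhoff_sum_def intro!: divide_nonneg_nonneg sum_nonneg)
  then show ?thesis using assms by (auto simp: states_def empirical_state_def birkhoff_sum_def)
qed

text \<open>Composing with \<alpha> shifts the orbit by one step, so all but the two end terms
  cancel.\<close>

lemma empirical_state_almost_invariant:
  assumes "n > 0" "cont f" "cont \<alpha>" "\<And>x. \<bar>f x\<bar> \<le> B"
  shows "\<bar>empirical_state \<alpha> n y (\<lambda>x. f (\<alpha> x)) - empirical_state \<alpha> n y f\<bar> \<le> 2 * B / n"
proof -
  have c: "cont (\<lambda>x. f (\<alpha> x))" using continuous_on_compose2[OF assms(2,3)] by auto
  have "birkhoff_sum \<alpha> (\<lambda>x. f (\<alpha> x)) n y - birkhoff_sum \<alpha> f n y = f ((\<alpha> ^^ n) y) - f y"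
    using sum_lessThan_telescope[of "\<lambda>k. f ((\<alpha> ^^ k) y)" n]
    by (simp add: birkhoff_sum_def sum_subtractf)
  then have "\<bar>birkhoff_sum \<alpha> (\<lambda>x. f (\<alpha> x)) n y - birkhoff_sum \<alpha> f n y\<bar> \<le> 2 * B"
    using assms(4)[of y] assms(4)[of "(\<alpha> ^^ n) y"] by linarith
  then show ?thesis
    using assms(1,2) c
    by (simp add: empirical_state_def diff_divide_distrib[symmetric] abs_divide divide_right_mono)
qed

text \<open>If the bound failed for arbitrarily large n, the empirical states of the offending orbit
  segments would accumulate, by compactness, at an invariant state \<phi> with \<phi> q at least
  b.\<close>

lemma birkhoff_sum_bound:
  assumes \<alpha>: "cont \<alpha>" and q: "cont q" and less: "\<And>\<phi>. \<phi> \<in> invariant_states \<alpha> \<Longrightarrow> \<phi> q < b"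
  obtains k where "\<And>n y. k \<le> n \<Longrightarrow> birkhoff_sum \<alpha> q n y \<le> real n * b"
proof (rule ccontr)
  assume "\<not> thesis"
  then have bad: "\<exists>n\<ge>k. \<exists>y. real n * b < birkhoff_sum \<alpha> q n y" for k
    using that by (meson not_le)
  define G where "G k = {\<phi>. b \<le> \<phi> q} \<inter>
    {\<phi>. \<forall>f B. cont f \<and> (\<forall>x. \<bar>f x\<bar> \<le> B) \<longrightarrow> \<bar>\<phi> (\<lambda>x. f (\<alpha> x)) - \<phi> f\<bar> \<le> 2 * B / real (Suc k)}" for k
  have "states \<inter> (\<Inter>k\<in>UNIV. G k) \<noteq> {}"
  proof (rule compact_imp_fip_image[OF compact_states])
    show "closed (G k)" for k unfolding G_def
      by (intro closed_Int closed_Collect_all closed_Collect_impI closed_eval_conditions)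
    fix I :: "nat set" assume I: "finite I"
    then obtain m where m: "\<And>k. k \<in> I \<Longrightarrow> k \<le> m" using finite_nat_set_iff_bounded_le by auto
    \<comment> \<open>The defect of invariance shrinks with n, so a single long orbit segment
      satisfies all conditions indexed by the finite set I.\<close>
    obtain n y where n: "n \<ge> Suc m" and y: "real n * b < birkhoff_sum \<alpha> q n y" using bad by blast
    have "n > 0" using n by simp
    let ?\<phi> = "empirical_state \<alpha> n y"
    have "?\<phi> \<in> G k" if "k \<in> I" for k
      unfolding G_def
    proof (intro IntI CollectI allI impI, goal_cases)
      case 1
      show ?case using y q \<open>n > 0\<close> by (simp add: empirical_state_def field_simps)
    next
      case (2 f B)
      then have "\<bar>?\<phi> (\<lambda>x. f (\<alpha> x)) - ?\<phi> f\<bar> \<le> 2 * B / n"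
        by (intro empirical_state_almost_invariant[OF \<open>n > 0\<close> _ \<alpha>]) auto
      also have "\<dots> \<le> 2 * B / real (Suc k)"
      proof -
        have "B \<ge> 0" using 2 abs_ge_zero order_trans by blast
        then show ?thesis using n m[OF that] by (intro divide_left_mono) auto
      qed
      finally show ?case .
    qed
    moreover have "?\<phi> \<in> states" by (rule empirical_state_in_states[OF \<open>n > 0\<close>])
    ultimately show "states \<inter> (\<Inter>k\<in>I. G k) \<noteq> {}" by blast
  qed
  then obtain \<phi> where \<phi>: "\<phi> \<in> states" "\<And>k. \<phi> \<in> G k" by blast
  have "\<phi> (\<lambda>x. f (\<alpha> x)) = \<phi> f" if f: "cont f" for f
  proof -
    obtain B where B: "\<And>x. norm (f x) \<le> B" using cont_bounded[OF f] by blast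
    have le: "\<bar>\<phi> (\<lambda>x. f (\<alpha> x)) - \<phi> f\<bar> \<le> (2 * B) * inverse (real (Suc k))" for k
      using \<phi>(2)[of k] f B unfolding G_def by (auto simp: divide_inverse)
    have "(\<lambda>k. (2 * B) * inverse (real (Suc k))) \<longlonglongrightarrow> (2 * B) * 0"
      by (intro tendsto_mult_left LIMSEQ_inverse_real_of_nat)
    then have "\<bar>\<phi> (\<lambda>x. f (\<alpha> x)) - \<phi> f\<bar> \<le> (2 * B) * 0"
      using le by (intro LIMSEQ_le_const) auto
    then show ?thesis by simp
  qed
  then have "\<phi> \<in> invariant_states \<alpha>" using \<phi>(1) by (simp add: invariant_states_def)
  then show False using less[of \<phi>] \<phi>(2)[of 0] by (simp add: G_def)
qed

text \<open>The Krylov-Bogoliubov theorem. Without invariant states the hypothesis of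
  \<open>birkhoff_sum_bound\<close> would hold vacuously for q = 1 and b = 0, although the n-th
  Birkhoff sum of 1 is n.\<close>

lemma invariant_states_nonempty:
  assumes "cont \<alpha>"
  shows "invariant_states \<alpha> \<noteq> {}"
proof
  assume e: "invariant_states \<alpha> = {}"
  obtain k where "\<And>n y. k \<le> n \<Longrightarrow> birkhoff_sum \<alpha> (\<lambda>_. 1) n y \<le> real n * 0"
    by (rule birkhoff_sum_bound[OF assms, of "\<lambda>_. 1" 0]) (use e in auto)
  from this[of "Suc k"] show False by (simp add: birkhoff_sum_def)
qed

section \<open>Invariant states as measures, extreme states as ergodic measures\<close>

lemma invariant_state_measure:
  assumes \<alpha>: "cont \<alpha>" and \<phi>: "\<phi> \<in> invariant_states \<alpha>"
  obtains \<mu> where "\<mu> \<in> invariant_measures \<alpha>" "\<And>f. cont f \<Longrightarrow> (\<integral>x. f x \<partial>\<mu>) = \<phi> f"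
proof -
  have pos: "pos_functional \<phi>" using \<phi> by (auto simp: invariant_states_def states_def)
  obtain \<mu> where reg: "regular_borel \<mu>" and int: "\<And>f. cont f \<Longrightarrow> (\<integral>x. f x \<partial>\<mu>) = \<phi> f"
    using riesz_representation[OF pos] by blast
  interpret finite_measure \<mu> by (rule regular_finite[OF reg])
  have "measure \<mu> (space \<mu>) = 1"
    using int[of "\<lambda>_. 1"] \<phi> by (auto simp: invariant_states_def states_def)
  then have prob: "prob_space \<mu>" by (intro prob_spaceI) (simp add: emeasure_eq_measure)
  have am: "\<alpha> \<in> measurable \<mu> borel" by (intro cont_measurable regular_sets reg \<alpha>)
  \<comment> \<open>Invariance under continuous test functions passes to Borel sets because both
    measures are regular and represent the same functional.\<close>
  have "distr \<mu> borel \<alpha> = \<mu>"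
  proof (rule regular_unique[OF regular_distr[OF reg \<alpha>] reg])
    fix f :: "'a \<Rightarrow> real" assume f: "cont f"
    have "cont (\<lambda>x. f (\<alpha> x))" using continuous_on_compose2[OF f \<alpha>] by auto
    then show "(\<integral>x. f x \<partial>distr \<mu> borel \<alpha>) = (\<integral>x. f x \<partial>\<mu>)"
      using integral_distr[OF am borel_measurable_continuous_onI[OF f]] int f \<phi>
      by (simp add: invariant_states_def)
  qed
  then have "emeasure \<mu> (\<alpha> -` B) = emeasure \<mu> B" if "B \<in> sets borel" for B
    using emeasure_distr[OF am that] regular_space[OF reg] by simp
  then have "\<mu> \<in> invariant_measures \<alpha>" using prob reg by (simp add: invariant_measures_def)
  then show thesis using that int by blast
qed

lemma invariant_measures_regular: "\<mu> \<in> invariant_measures \<alpha> \<Longrightarrow> regular_borel \<mu>"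
  and invariant_measures_prob: "\<mu> \<in> invariant_measures \<alpha> \<Longrightarrow> prob_space \<mu>"
  by (auto simp: invariant_measures_def)

lemma invariant_measures_distr:
  assumes "\<mu> \<in> invariant_measures \<alpha>" "cont \<alpha>"
  shows "distr \<mu> borel \<alpha> = \<mu>"
proof (rule measure_eqI)
  have reg: "regular_borel \<mu>" using assms by (simp add: invariant_measures_def)
  show "sets (distr \<mu> borel \<alpha>) = sets \<mu>" using regular_sets[OF reg] by simp
  fix B assume "B \<in> sets (distr \<mu> borel \<alpha>)"
  then show "emeasure (distr \<mu> borel \<alpha>) B = emeasure \<mu> B"
    using assms regular_space[OF reg] cont_measurable[OF regular_sets[OF reg] assms(2)]
    by (simp add: emeasure_distr invariant_measures_def)
qed

text \<open>This is \<mu> conditioned on B. Invariance of B lets its indicator pass through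
  \<alpha>.\<close>

lemma conditional_state:
  assumes \<alpha>: "cont \<alpha>" and \<mu>: "\<mu> \<in> invariant_measures \<alpha>"
    and B: "B \<in> sets borel" "\<alpha> -` B = B" "measure \<mu> B > 0"
  shows "(\<lambda>f. if cont f then (\<integral>x. indicator B x * f x \<partial>\<mu>) / measure \<mu> B else 0) \<in> invariant_states \<alpha>"
    (is "?\<phi> \<in> _")
proof -
  have reg: "regular_borel \<mu>" using \<mu> by (rule invariant_measures_regular)
  interpret finite_measure \<mu> by (rule regular_finite[OF reg])
  have Bm: "B \<in> sets \<mu>" using B regular_sets[OF reg] by simp
  have int: "integrable \<mu> (\<lambda>x. indicator B x * f x)" if "cont f" for f :: "'a \<Rightarrow> real"
    using integrable_mult_indicator[OF Bm regular_integrable[OF reg that]] by simp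
  have am: "\<alpha> \<in> measurable \<mu> borel" by (intro cont_measurable regular_sets reg \<alpha>)
  have "pos_functional ?\<phi>"
    unfolding pos_functional_def
  proof (intro conjI allI impI)
    fix f g :: "'a \<Rightarrow> real" assume fg: "cont f" "cont g"
    then show "?\<phi> (\<lambda>x. f x + g x) = ?\<phi> f + ?\<phi> g"
      using continuous_on_add[OF fg] int[OF fg(1)] int[OF fg(2)]
      by (simp add: distrib_left add_divide_distrib)
  next
    fix c and f :: "'a \<Rightarrow> real" assume f: "cont f"
    then show "?\<phi> (\<lambda>x. c * f x) = c * ?\<phi> f"
      using continuous_on_mult[of UNIV "\<lambda>_. c" f] by (simp add: mult.left_commute[of _ c])
  qed (auto intro!: divide_nonneg_nonneg Bochner_Integration.integral_nonneg)
  moreover have "?\<phi> (\<lambda>_. 1) = 1" using B Bm regular_space[OF reg] by simp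
  moreover have "?\<phi> (\<lambda>x. f (\<alpha> x)) = ?\<phi> f" if f: "cont f" for f
  proof -
    have c: "cont (\<lambda>x. f (\<alpha> x))" using continuous_on_compose2[OF f \<alpha>] by auto
    have ind: "indicator B (\<alpha> x) = (indicator B x :: real)" for x
      using B(2) by (auto simp: indicator_def)
    have m: "(\<lambda>x. indicator B x * f x) \<in> borel_measurable borel"
      using B f by (intro borel_measurable_times borel_measurable_indicator borel_measurable_continuous_onI)
    have "(\<integral>x. indicator B x * f x \<partial>\<mu>) = (\<integral>x. indicator B x * f x \<partial>distr \<mu> borel \<alpha>)"
      using invariant_measures_distr[OF \<mu> \<alpha>] by simp
    also have "\<dots> = (\<integral>x. indicator B x * f (\<alpha> x) \<partial>\<mu>)"
      using integral_distr[OF am m] ind by simp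
    finally show ?thesis using f c by simp
  qed
  ultimately show ?thesis by (simp add: invariant_states_def states_def)
qed

text \<open>If an invariant B had measure c strictly between 0 and 1, then \<phi> would be a convex
  combination of the states conditioned on B and on - B. Extremality makes the first of them equal
  to \<phi>, so B would be independent of every continuous f; letting f approximate the indicator of
  B gives c = c * c.\<close>

lemma extreme_state_ergodic:
  assumes \<alpha>: "cont \<alpha>" and ext: "face (invariant_states \<alpha>) {\<phi>}"
    and \<mu>: "\<mu> \<in> invariant_measures \<alpha>" and int: "\<And>f. cont f \<Longrightarrow> (\<integral>x. f x \<partial>\<mu>) = \<phi> f"
  shows "\<mu> \<in> ergodic_measures \<alpha>"
proof -
  have reg: "regular_borel \<mu>" using \<mu> by (rule invariant_measures_regular)
  interpret prob_space \<mu> using \<mu> by (rule invariant_measures_prob)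
  have \<phi>: "\<phi> \<in> states" using ext by (auto simp: face_def invariant_states_def)
  have "measure \<mu> B = 0 \<or> measure \<mu> B = 1" if B: "B \<in> sets borel" "\<alpha> -` B = B" for B
  proof (rule ccontr)
    assume neg: "\<not> ?thesis"
    define c where "c = measure \<mu> B"
    have c: "0 < c" "c < 1" using neg prob_le_1[of B] by (auto simp: c_def zero_less_measure_iff less_le)
    have Bm: "B \<in> sets \<mu>" using B regular_sets[OF reg] by simp
    have mc: "measure \<mu> (- B) = 1 - c"
      using prob_compl[OF Bm] regular_space[OF reg] by (simp add: c_def Compl_eq_Diff_UNIV)
    have B': "- B \<in> sets borel" "\<alpha> -` (- B) = - B" using B by auto
    have intB: "integrable \<mu> (\<lambda>x. indicator C x * f x)" if "C \<in> sets borel" "cont f" for f :: "'a \<Rightarrow> real" and C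
      using integrable_mult_indicator[OF _ regular_integrable[OF reg that(2)], of C] that regular_sets[OF reg] by simp
    define \<phi>\<^sub>1 \<phi>\<^sub>2 where
      "\<phi>\<^sub>1 = (\<lambda>f. if cont f then (\<integral>x. indicator B x * f x \<partial>\<mu>) / measure \<mu> B else 0)" and
      "\<phi>\<^sub>2 = (\<lambda>f. if cont f then (\<integral>x. indicator (- B) x * f x \<partial>\<mu>) / measure \<mu> (- B) else 0)"
    have "\<phi>\<^sub>1 \<in> invariant_states \<alpha>" "\<phi>\<^sub>2 \<in> invariant_states \<alpha>"
      unfolding \<phi>\<^sub>1_def \<phi>\<^sub>2_def
      using B B' c mc by (auto intro!: conditional_state[OF \<alpha> \<mu>] simp: c_def)
    moreover have "(\<lambda>f. c * \<phi>\<^sub>1 f + (1 - c) * \<phi>\<^sub>2 f) = \<phi>"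
    proof
      fix f
      show "c * \<phi>\<^sub>1 f + (1 - c) * \<phi>\<^sub>2 f = \<phi> f"
      proof (cases "cont f")
        case True
        have "c * \<phi>\<^sub>1 f + (1 - c) * \<phi>\<^sub>2 f =
            (\<integral>x. indicator B x * f x \<partial>\<mu>) + (\<integral>x. indicator (- B) x * f x \<partial>\<mu>)"
          using True c mc by (simp add: \<phi>\<^sub>1_def \<phi>\<^sub>2_def c_def[symmetric])
        also have "\<dots> = (\<integral>x. indicator B x * f x + indicator (- B) x * f x \<partial>\<mu>)"
          using intB[OF B(1) True] intB[OF B'(1) True] by simp
        also have "\<dots> = (\<integral>x. f x \<partial>\<mu>)"
          by (intro Bochner_Integration.integral_cong) (auto simp: indicator_def)
        finally show ?thesis using int[OF True] by simp
      qed (use \<phi> in \<open>auto simp: states_def \<phi>\<^sub>1_def \<phi>\<^sub>2_def\<close>)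
    qed
    ultimately have "\<phi>\<^sub>1 \<in> {\<phi>}"
      using ext c unfolding face_def by blast
    then have \<phi>\<^sub>1: "\<phi>\<^sub>1 = \<phi>" by (rule singletonD)
    have eq: "(\<integral>x. indicator B x * f x \<partial>\<mu>) = c * (\<integral>x. f x \<partial>\<mu>)" if "cont f" for f
    proof -
      have "(\<integral>x. indicator B x * f x \<partial>\<mu>) / c = \<phi>\<^sub>1 f"
        using that by (simp add: \<phi>\<^sub>1_def c_def)
      also have "\<dots> = (\<integral>x. f x \<partial>\<mu>)" unfolding \<phi>\<^sub>1 by (rule int[OF that, symmetric])
      finally show ?thesis using c by (simp add: field_simps)
    qed
    \<comment> \<open>The approximations by K and by U cost at most e each, and 2 * e is still less
      than c - c * c.\<close>
    define e where "e = (c - c * c) / 4"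
    have e: "e > 0" using c by (simp add: e_def)
    obtain K where K: "closed K" "K \<subseteq> B" "measure \<mu> B < measure \<mu> K + e"
      by (rule regular_inner[OF reg B(1) e])
    obtain U where U: "open U" "B \<subseteq> U" "measure \<mu> U < measure \<mu> B + e"
      by (rule regular_outer[OF reg B(1) e])
    have "K \<subseteq> U" using K U by blast
    then obtain f :: "'a \<Rightarrow> real" where f: "cont f" "\<And>x. 0 \<le> f x" "\<And>x. f x \<le> 1"
      "\<And>x. x \<in> K \<Longrightarrow> f x = 1" "\<And>x. x \<notin> U \<Longrightarrow> f x = 0" using urysohn[OF K(1) U(1)] by blast
    have "measure \<mu> K \<le> (\<integral>x. indicator B x * f x \<partial>\<mu>)"
      using f K by (intro measure_le_integral[OF reg] intB B) auto
    also have "\<dots> = c * (\<integral>x. f x \<partial>\<mu>)" by (rule eq[OF f(1)])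
    also have "\<dots> \<le> c * measure \<mu> U"
      using f U c by (intro mult_left_mono integral_le_measure[OF reg] regular_integrable[OF reg]) auto
    also have "\<dots> \<le> c * (c + e)" using U c by (intro mult_left_mono) (auto simp: c_def)
    also have "\<dots> \<le> c * c + e" using c e by (simp add: distrib_left mult_le_cancel_right1)
    finally have "c - e \<le> c * c + e" using K by (simp add: c_def)
    then show False using e unfolding e_def by (simp add: field_simps)
  qed
  then show ?thesis using \<mu> by (auto simp: ergodic_measures_def emeasure_eq_measure)
qed

end

section \<open>The spectral radius of a positive operator\<close>

lemma summable_bcontfun:
  fixes u :: "nat \<Rightarrow> ('a::topological_space \<Rightarrow>\<^sub>C 'b::banach)"
  assumes "summable (\<lambda>n. norm (u n))"
  shows "summable u"
proof -
  have "uniform_limit UNIV (\<lambda>n x. \<Sum>i<n. u i x) (\<lambda>x. \<Sum>i. u i x) sequentially"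
    by (rule Weierstrass_m_test[OF _ assms]) (rule norm_bounded)
  moreover have "(\<lambda>n x. \<Sum>i<n. u i x) = (\<lambda>n. apply_bcontfun (\<Sum>i<n. u i))"
  proof (intro ext)
    fix n x show "(\<Sum>i<n. u i x) = apply_bcontfun (\<Sum>i<n. u i) x" by (induction n) auto
  qed
  ultimately obtain l where "(\<lambda>n. \<Sum>i<n. u i) \<longlonglongrightarrow> l"
    using uniform_limit_bcontfunE[of "\<lambda>n. \<Sum>i<n. u i"] by (metis (no_types) sequentially_bot)
  then show ?thesis by (auto simp: summable_def sums_def)
qed

lemma bounded_linear_eval: "bounded_linear (\<lambda>f :: 'a::topological_space \<Rightarrow>\<^sub>C 'b::real_normed_vector. f x)"
  by (rule bounded_linear_intro[where K=1]) (auto simp: norm_bounded)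

lemma apply_bc_scale: "bc_scale c f x = c * f x"
  by (simp add: bc_scale_def apply_bc_mult)

lemma norm_bc_scale: "norm (bc_scale c f) \<le> norm f * cmod c"
  by (rule norm_bound) (simp add: apply_bc_scale norm_mult mult.commute[of "norm f"] mult_left_mono norm_bounded)

lemma bounded_linear_bc_scale: "bounded_linear (bc_scale c)"
  by (rule bounded_linear_intro[where K="cmod c"])
     (auto intro!: bcontfun_eqI order_trans[OF norm_bc_scale] simp: apply_bc_scale algebra_simps)

lemma bc_scale_bc_scale: "bc_scale c (bc_scale d f) = bc_scale (c * d) f"
  by (rule bcontfun_eqI) (simp add: apply_bc_scale)

lemma scaleR_bc_scale: "r *\<^sub>R f = bc_scale (of_real r) f"
  by (rule bcontfun_eqI) (simp add: apply_bc_scale scaleR_conv_of_real)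

definition bc_real :: "('a::topological_space \<Rightarrow> real) \<Rightarrow> ('a \<Rightarrow>\<^sub>C complex)" where
  "bc_real f = Bcontfun (\<lambda>x. of_real (f x))"

text \<open>A positive operator maps real functions to real ones (\<open>T_bc_real\<close>), so for
  such \<open>T\<close> this is its restriction to them; order estimates are made here.\<close>

definition real_part_op ::
  "(('a::topological_space \<Rightarrow>\<^sub>C complex) \<Rightarrow> ('a \<Rightarrow>\<^sub>C complex)) \<Rightarrow> ('a \<Rightarrow> real) \<Rightarrow> 'a \<Rightarrow> real" where
  "real_part_op T f x = Re (T (bc_real f) x)"

definition positive_op :: "(('a::topological_space \<Rightarrow>\<^sub>C complex) \<Rightarrow> ('a \<Rightarrow>\<^sub>C complex)) \<Rightarrow> bool" where
  "positive_op T \<longleftrightarrow> (\<forall>f g. T (f + g) = T f + T g) \<and> (\<forall>c f. T (bc_scale c f) = bc_scale c (T f)) \<and>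
     (\<forall>f. bc_nonneg f \<longrightarrow> bc_nonneg (T f))"

text \<open>Testing on the constant 1 is enough: under a positive operator every function is
  dominated by its norm times 1.\<close>

definition growth_rates :: "(('a \<Rightarrow> real) \<Rightarrow> 'a \<Rightarrow> real) \<Rightarrow> real set" where
  "growth_rates L = {l. 0 < l \<and> (\<exists>C. \<forall>n x. (L ^^ n) (\<lambda>_. 1) x \<le> C * l ^ n)}"

context compact_t2
begin

lemma apply_bc_real: "cont f \<Longrightarrow> bc_real f x = of_real (f x)"
proof -
  assume f: "cont f"
  obtain B where "\<And>x. norm (f x) \<le> B" using cont_bounded[OF f] by blast
  then have "(\<lambda>x. complex_of_real (f x)) \<in> bcontfun"
    by (intro bcontfun_normI[where b=B] continuous_on_of_real f) auto
  then show ?thesis by (simp add: bc_real_def Bcontfun_inverse)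
qed

lemma bc_nonneg_bc_real: "cont f \<Longrightarrow> bc_nonneg (bc_real f) \<longleftrightarrow> (\<forall>x. 0 \<le> f x)"
  by (simp add: bc_nonneg_def apply_bc_real nonneg_Reals_def)

lemma bc_real_Re:
  fixes f :: "'a \<Rightarrow>\<^sub>C complex"
  assumes "\<And>x. f x \<in> \<real>"
  shows "bc_real (\<lambda>x. Re (f x)) = f"
proof (rule bcontfun_eqI)
  fix x
  have "cont (\<lambda>x. Re (f x))" by (intro continuous_intros) auto
  then show "bc_real (\<lambda>x. Re (f x)) x = f x" using assms[of x] by (simp add: apply_bc_real)
qed

lemma bc_real_add: "cont f \<Longrightarrow> cont g \<Longrightarrow> bc_real (\<lambda>x. f x + g x) = bc_real f + bc_real g"
  by (rule bcontfun_eqI) (simp add: apply_bc_real continuous_on_add)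

lemma bc_real_cmult: "cont f \<Longrightarrow> bc_real (\<lambda>x. c * f x) = bc_scale (of_real c) (bc_real f)"
  by (rule bcontfun_eqI) (simp add: apply_bc_real apply_bc_scale continuous_on_mult_left)

context
  fixes T :: "('a \<Rightarrow>\<^sub>C complex) \<Rightarrow> ('a \<Rightarrow>\<^sub>C complex)"
  assumes T: "positive_op T"
begin

abbreviation L :: "('a \<Rightarrow> real) \<Rightarrow> 'a \<Rightarrow> real" where "L \<equiv> real_part_op T"

lemma T_add: "T (f + g) = T f + T g"
  and T_scale: "T (bc_scale c f) = bc_scale c (T f)"
  and T_nonneg: "bc_nonneg f \<Longrightarrow> bc_nonneg (T f)"
  using T by (auto simp: positive_op_def)

lemma cont_L: "cont (L f)"
  unfolding real_part_op_def by (intro continuous_intros) auto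

lemma cont_L_pow: "cont f \<Longrightarrow> cont ((L ^^ n) f)"
  by (induction n) (auto intro: cont_L)

lemma L_add: "cont f \<Longrightarrow> cont g \<Longrightarrow> L (\<lambda>x. f x + g x) = (\<lambda>x. L f x + L g x)"
  by (simp add: real_part_op_def bc_real_add T_add fun_eq_iff)

lemma L_cmult: "cont f \<Longrightarrow> L (\<lambda>x. c * f x) = (\<lambda>x. c * L f x)"
  by (simp add: real_part_op_def bc_real_cmult T_scale apply_bc_scale fun_eq_iff)

lemma L_nonneg: "cont f \<Longrightarrow> (\<And>x. 0 \<le> f x) \<Longrightarrow> 0 \<le> L f x"
  using T_nonneg[of "bc_real f"] unfolding real_part_op_def
  by (simp add: bc_nonneg_bc_real) (simp add: bc_nonneg_def complex_nonneg_Reals_iff)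

lemma L_mono: "L f x \<le> L g x" if "cont f" "cont g" "\<And>x. f x \<le> g x"
proof -
  have c: "cont (\<lambda>x. -1 * f x)" and c': "cont (\<lambda>x. g x + -1 * f x)"
    using that by (auto intro!: continuous_intros)
  have "0 \<le> L (\<lambda>x. g x + -1 * f x) x" using that(3) by (intro L_nonneg c') (simp add: algebra_simps)
  then show ?thesis
    by (subst (asm) L_add[OF that(2) c], subst (asm) L_cmult[OF that(1)]) simp
qed

lemma L_pow_mono:
  assumes "cont f" "cont g" "\<And>x. f x \<le> g x"
  shows "(L ^^ n) f x \<le> (L ^^ n) g x"
  using assms(3)
proof (induction n arbitrary: x)
  case (Suc n)
  show ?case by (simp, intro L_mono cont_L_pow assms Suc)
qed simp

lemma L_pow_cmult: "cont f \<Longrightarrow> (L ^^ n) (\<lambda>x. c * f x) = (\<lambda>x. c * (L ^^ n) f x)"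
  by (induction n) (simp_all add: L_cmult cont_L_pow)

lemma L_pow_nonneg: "cont f \<Longrightarrow> (\<And>x. 0 \<le> f x) \<Longrightarrow> 0 \<le> (L ^^ n) f x"
  by (induction n arbitrary: x) (auto intro!: L_nonneg cont_L_pow)

text \<open>f is the difference of the nonnegative functions f + B and B, whose images are
  nonnegative and in particular real.\<close>

lemma T_bc_real: "cont f \<Longrightarrow> T (bc_real f) = bc_real (L f)"
proof -
  assume f: "cont f"
  obtain B where B: "\<And>x. norm (f x) \<le> B" using cont_bounded[OF f] by blast
  have pos: "T (bc_real h) x \<in> \<real>" if h: "cont h" "\<And>x. 0 \<le> h x" for h x
  proof -
    have "bc_nonneg (T (bc_real h))" using h by (intro T_nonneg) (simp add: bc_nonneg_bc_real)
    then have "T (bc_real h) x \<in> {of_real r |r. 0 \<le> r}" unfolding bc_nonneg_def nonneg_Reals_def ..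
    then obtain r where "T (bc_real h) x = of_real r" by blast
    then show ?thesis by simp
  qed
  have c: "cont (\<lambda>x. f x + B)" by (intro continuous_intros f)
  have c1: "cont (\<lambda>x. - 1 * B)" by (intro continuous_intros)
  have B0: "0 \<le> B" using B norm_ge_zero order_trans by blast
  have "bc_real (\<lambda>x. (f x + B) + - 1 * B) = bc_real (\<lambda>x. f x + B) + bc_real (\<lambda>x. - 1 * B)"
    by (rule bc_real_add[OF c c1])
  moreover have "bc_real (\<lambda>x::'a. - 1 * B) = bc_scale (of_real (- 1)) (bc_real (\<lambda>_. B))"
    by (rule bc_real_cmult[OF continuous_on_const])
  ultimately have "bc_real f = bc_real (\<lambda>x. f x + B) + bc_scale (of_real (- 1)) (bc_real (\<lambda>_. B))"
    by simp
  then have "T (bc_real f) = T (bc_real (\<lambda>x. f x + B)) + bc_scale (of_real (-1)) (T (bc_real (\<lambda>_. B)))"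
    by (simp only: T_add T_scale)
  moreover have "T (bc_real (\<lambda>x. f x + B)) x \<in> \<real>" "T (bc_real (\<lambda>_. B)) x \<in> \<real>" for x
  proof -
    have "0 \<le> f x + B" for x using B[of x] by (simp add: abs_le_iff)
    then show "T (bc_real (\<lambda>x. f x + B)) x \<in> \<real>" by (intro pos c)
    show "T (bc_real (\<lambda>_. B)) x \<in> \<real>" using B0 by (intro pos) auto
  qed
  ultimately have "T (bc_real f) x \<in> \<real>" for x by (simp add: apply_bc_scale)
  then show ?thesis using bc_real_Re[of "T (bc_real f)"] by (simp add: real_part_op_def[abs_def])
qed

lemma T_pow_bc_real: "cont f \<Longrightarrow> (T ^^ n) (bc_real f) = bc_real ((L ^^ n) f)"
  by (induction n) (auto simp: T_bc_real cont_L_pow)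

lemma T_pow_add: "(T ^^ n) (f + g) = (T ^^ n) f + (T ^^ n) g"
  by (induction n) (auto simp: T_add)

lemma T_pow_scale: "(T ^^ n) (bc_scale c f) = bc_scale c ((T ^^ n) f)"
  by (induction n) (auto simp: T_scale)

lemma T_pow_nonneg: "bc_nonneg f \<Longrightarrow> bc_nonneg ((T ^^ n) f)"
  by (induction n) (auto simp: T_nonneg)

lemma abs_L_pow_le:
  assumes "cont f" "\<And>x. \<bar>f x\<bar> \<le> B"
  shows "\<bar>(L ^^ n) f x\<bar> \<le> B * (L ^^ n) (\<lambda>_. 1) x"
proof -
  have "f x \<le> B * 1" "(-B) * 1 \<le> f x" for x using assms(2)[of x] by auto
  then have "(L ^^ n) f x \<le> (L ^^ n) (\<lambda>x. B * 1) x" "(L ^^ n) (\<lambda>x. (-B) * 1) x \<le> (L ^^ n) f x"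
    by (auto intro!: L_pow_mono assms)
  then show ?thesis
    unfolding L_pow_cmult[OF continuous_on_const] by (simp add: abs_le_iff)
qed

text \<open>The factor 2 comes from estimating real and imaginary part separately; it does not
  affect growth rates.\<close>

lemma norm_T_pow_le:
  assumes "\<And>x. (L ^^ n) (\<lambda>_. 1) x \<le> B"
  shows "norm ((T ^^ n) f) \<le> 2 * B * norm f"
proof (rule norm_bound)
  fix x
  let ?u = "\<lambda>x. Re (f x)" and ?v = "\<lambda>x. Im (f x)"
  have c: "cont ?u" "cont ?v" by (auto intro!: continuous_intros)
  have fe: "f = bc_real ?u + bc_scale \<i> (bc_real ?v)"
    by (rule bcontfun_eqI) (simp add: apply_bc_real c apply_bc_scale complex_eq)
  have "(T ^^ n) f x = of_real ((L ^^ n) ?u x) + \<i> * of_real ((L ^^ n) ?v x)"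
    by (subst fe) (simp add: T_pow_add T_pow_scale T_pow_bc_real c apply_bc_scale apply_bc_real cont_L_pow)
  then have "cmod ((T ^^ n) f x) \<le> cmod (of_real ((L ^^ n) ?u x)) + cmod (\<i> * of_real ((L ^^ n) ?v x))"
    using norm_triangle_ineq by metis
  also have "\<dots> = \<bar>(L ^^ n) ?u x\<bar> + \<bar>(L ^^ n) ?v x\<bar>" by (simp add: norm_mult)
  also have "\<dots> \<le> norm f * (L ^^ n) (\<lambda>_. 1) x + norm f * (L ^^ n) (\<lambda>_. 1) x"
    by (intro add_mono abs_L_pow_le c order_trans[OF abs_Re_le_cmod] order_trans[OF abs_Im_le_cmod] norm_bounded)
  also have "\<dots> \<le> norm f * B + norm f * B" using assms by (intro add_mono mult_left_mono) auto
  finally show "cmod ((T ^^ n) f x) \<le> 2 * B * norm f" by (simp add: algebra_simps)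
qed

lemma bounded_linear_T: "bounded_linear T"
proof -
  obtain B where "\<And>x. norm (L (\<lambda>_. 1) x) \<le> B" using cont_bounded[OF cont_L] by blast
  then have "L (\<lambda>_. 1) x \<le> B" for x by (smt (verit) real_norm_def)
  then have "norm (T f) \<le> norm f * (2 * B)" for f
    using norm_T_pow_le[of 1 B f] by (simp add: mult.commute)
  then show ?thesis
    by (intro bounded_linear_intro) (auto simp: T_add scaleR_bc_scale T_scale)
qed

text \<open>The resolvent at a point beyond a growth rate. Its positivity for nonnegative c is
  recorded because positivity at the infimum of the growth rates, which this series need not reach,
  will be derived from it by a limit.\<close>

lemma neumann_series:
  assumes l: "l \<in> growth_rates L" and c: "l < cmod c"
  obtains S where "bounded_linear S" "\<And>f. S (bc_scale c f - T f) = f" "\<And>f. bc_scale c (S f) - T (S f) = f"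
    "\<And>f. c \<in> \<real>\<^sub>\<ge>\<^sub>0 \<Longrightarrow> bc_nonneg f \<Longrightarrow> bc_nonneg (S f)"
proof -
  obtain C where l0: "0 < l" and C: "\<And>n x. (L ^^ n) (\<lambda>_. 1) x \<le> C * l ^ n"
    using l by (auto simp: growth_rates_def)
  have c0: "c \<noteq> 0" "0 < cmod c" using c l0 by auto
  define v where "v n f = bc_scale (inverse c ^ n) ((T ^^ n) f)" for n f
  have nv: "norm (v n f) \<le> (2 * C * norm f) * (l / cmod c) ^ n" for n f
  proof -
    have "norm (v n f) \<le> norm ((T ^^ n) f) * cmod (inverse c ^ n)" unfolding v_def by (rule norm_bc_scale)
    also have "\<dots> \<le> (2 * (C * l ^ n) * norm f) * cmod (inverse c ^ n)"
      by (intro mult_right_mono norm_T_pow_le C) auto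
    also have "\<dots> = (2 * C * norm f) * (l / cmod c) ^ n"
      by (simp add: norm_power norm_inverse power_divide divide_inverse power_inverse power_mult_distrib)
    finally show ?thesis .
  qed
  have q: "0 \<le> l / cmod c" "l / cmod c < 1" using l0 c c0 by auto
  have geo: "summable (\<lambda>n. (2 * C * norm f) * (l / cmod c) ^ n)" for f :: "'a \<Rightarrow>\<^sub>C complex"
    using q by (intro summable_mult summable_geometric) auto
  have sn: "summable (\<lambda>n. norm (v n f))" for f
    by (rule summable_comparison_test'[OF geo[of f]]) (use nv in auto)
  have sv: "summable (\<lambda>n. v n f)" for f by (rule summable_bcontfun[OF sn])
  have v0: "(\<lambda>n. v n f) \<longlonglongrightarrow> 0" for f by (rule summable_LIMSEQ_zero[OF sv])
  define S where "S f = bc_scale (inverse c) (\<Sum>n. v n f)" for f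
  have v_add: "v n (f + g) = v n f + v n g" for n f g
    unfolding v_def T_pow_add by (rule linear_add[OF bounded_linear.linear[OF bounded_linear_bc_scale]])
  have v_scale: "v n (bc_scale d f) = bc_scale d (v n f)" for n d f
    unfolding v_def T_pow_scale bc_scale_bc_scale by (simp add: mult.commute)
  have cancel: "c * inverse c ^ Suc n = inverse c ^ n" for n
    by (simp only: power_Suc mult.assoc[symmetric] right_inverse[OF c0(1)] mult_1_left)
  have v_T: "v n (T f) = bc_scale c (v (Suc n) f)" for n f
    by (simp only: v_def bc_scale_bc_scale cancel funpow_Suc_right o_apply)
  have T_v: "T (v n f) = bc_scale c (v (Suc n) f)" for n f
    by (simp only: v_def T_scale bc_scale_bc_scale cancel funpow.simps o_apply)
  note lin_scale = bounded_linear.linear[OF bounded_linear_bc_scale]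
  have v_diff: "v n (f - g) = v n f - v n g" for n f g
    using v_add[of n "f - g" g] by (simp add: algebra_simps)
  \<comment> \<open>The partial sums telescope from v 0 f = f to a term tending to 0; both inverse
    identities reduce to this.\<close>
  have tele: "(\<lambda>n. v n f - v (Suc n) f) sums f" for f
    using telescope_sums'[OF v0[of f]] by (simp add: v_def bc_scale_bc_scale scaleR_bc_scale[of 1, simplified, symmetric])
  have bls: "bounded_linear S"
  proof (rule bounded_linear_intro[where K="cmod (inverse c) * (\<Sum>n. 2 * C * (l / cmod c) ^ n)"])
    fix f g
    show "S (f + g) = S f + S g"
      unfolding S_def v_add suminf_add[OF sv sv, symmetric] by (rule linear_add[OF lin_scale])
    show "S (r *\<^sub>R f) = r *\<^sub>R S f" for r
      unfolding S_def scaleR_bc_scale v_scale bounded_linear.suminf[OF bounded_linear_bc_scale sv, symmetric]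
      by (simp add: bc_scale_bc_scale mult.commute)
    have "norm (\<Sum>n. v n f) \<le> (\<Sum>n. norm (v n f))"
    proof -
      have "(\<lambda>n. norm (\<Sum>i<n. v i f)) \<longlonglongrightarrow> norm (\<Sum>n. v n f)"
        by (intro tendsto_norm summable_LIMSEQ sv)
      then show ?thesis
        by (rule LIMSEQ_le_const2)
           (auto intro!: exI[of _ 0] order_trans[OF norm_sum] sum_le_suminf sn)
    qed
    also have "\<dots> \<le> (\<Sum>n. (2 * C * norm f) * (l / cmod c) ^ n)" by (intro suminf_le nv sn geo)
    also have "\<dots> = norm f * (\<Sum>n. 2 * C * (l / cmod c) ^ n)"
    proof -
      have "summable (\<lambda>n. 2 * C * (l / cmod c) ^ n)" using q by (intro summable_mult summable_geometric) auto
      then show ?thesis by (subst suminf_mult[symmetric]) (auto simp: mult_ac)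
    qed
    finally have "norm (\<Sum>n. v n f) * cmod (inverse c) \<le> norm f * (\<Sum>n. 2 * C * (l / cmod c) ^ n) * cmod (inverse c)"
      by (intro mult_right_mono) auto
    then show "norm (S f) \<le> norm f * (cmod (inverse c) * (\<Sum>n. 2 * C * (l / cmod c) ^ n))"
      unfolding S_def by (intro order_trans[OF norm_bc_scale]) (simp add: mult_ac)
  qed
  have 1: "S (bc_scale c f - T f) = f" for f
  proof -
    have "v n (bc_scale c f - T f) = bc_scale c (v n f - v (Suc n) f)" for n
      unfolding v_diff v_scale v_T by (rule linear_diff[OF lin_scale, symmetric])
    then have "(\<Sum>n. v n (bc_scale c f - T f)) = bc_scale c (\<Sum>n. v n f - v (Suc n) f)"
      using bounded_linear.suminf[OF bounded_linear_bc_scale sums_summable[OF tele]] by simp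
    also have "(\<Sum>n. v n f - v (Suc n) f) = f" using tele sums_unique by metis
    finally show ?thesis using c0 by (simp add: S_def bc_scale_bc_scale scaleR_bc_scale[of 1, simplified, symmetric])
  qed
  have 2: "bc_scale c (S f) - T (S f) = f" for f
  proof -
    have ssv: "summable (\<lambda>n. v (Suc n) f)" using summable_Suc_iff[of "\<lambda>n. v n f"] sv[of f] by simp
    have "bc_scale c (S f) = (\<Sum>n. v n f)"
      using c0 by (simp add: S_def bc_scale_bc_scale scaleR_bc_scale[of 1, simplified, symmetric])
    moreover have "T (S f) = (\<Sum>n. v (Suc n) f)"
    proof -
      have "T (S f) = bc_scale (inverse c) (\<Sum>n. T (v n f))"
        unfolding S_def T_scale bounded_linear.suminf[OF bounded_linear_T sv] ..
      also have "\<dots> = bc_scale (inverse c) (bc_scale c (\<Sum>n. v (Suc n) f))"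
        unfolding T_v using bounded_linear.suminf[OF bounded_linear_bc_scale ssv, of c] by simp
      finally show ?thesis using c0 by (simp add: bc_scale_bc_scale scaleR_bc_scale[of 1, simplified, symmetric])
    qed
    ultimately show ?thesis
      using suminf_diff[OF sv ssv] sums_unique[OF tele[of f]] by simp
  qed
  have 3: "bc_nonneg (S f)" if "c \<in> \<real>\<^sub>\<ge>\<^sub>0" "bc_nonneg f" for f
    unfolding bc_nonneg_def
  proof
    fix x
    have ic: "inverse c \<in> \<real>\<^sub>\<ge>\<^sub>0" using that(1) by (auto simp: nonneg_Reals_def) (metis of_real_inverse inverse_nonnegative_iff_nonnegative)
    have "v n f x \<in> \<real>\<^sub>\<ge>\<^sub>0" for n
      using T_pow_nonneg[OF that(2), of n] ic by (auto simp: v_def apply_bc_scale bc_nonneg_def)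
    then have *: "(\<Sum>i<n. v i f x) \<in> \<real>\<^sub>\<ge>\<^sub>0" for n by (induction n) auto
    have "(\<lambda>n. v n f x) sums (\<Sum>n. v n f) x"
      using bounded_linear.sums[OF bounded_linear_eval summable_sums[OF sv]] .
    then have "(\<Sum>n. v n f) x \<in> \<real>\<^sub>\<ge>\<^sub>0"
      unfolding sums_def by (rule closed_sequentially[OF closed_nonneg_Reals_complex *])
    then show "S f x \<in> \<real>\<^sub>\<ge>\<^sub>0" using ic by (simp add: S_def apply_bc_scale)
  qed
  show thesis by (rule that[OF bls 1 2 3])
qed

lemma spectral_radius_le:
  assumes "l \<in> growth_rates L"
  shows "spectral_radius T \<le> ennreal l"
  unfolding spectral_radius_def
proof (rule SUP_least)
  fix c assume c: "c \<in> op_spectrum T"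
  have "\<not> l < cmod c"
  proof
    assume "l < cmod c"
    from neumann_series[OF assms this] obtain S where S: "bounded_linear S"
      "\<And>f. S (bc_scale c f - T f) = f" "\<And>f. bc_scale c (S f) - T (S f) = f" by metis
    have "c \<notin> op_spectrum T"
      unfolding op_spectrum_def mem_Collect_eq not_not by (intro exI[of _ S] conjI allI S)
    then show False using c by blast
  qed
  then show "ennreal (cmod c) \<le> ennreal l" by (simp add: ennreal_leI)
qed

section \<open>Criteria for growth rates\<close>

lemma growth_rates_upward:
  assumes "l \<in> growth_rates L" "l \<le> m"
  shows "m \<in> growth_rates L"
proof -
  obtain C where l: "0 < l" and C: "\<And>n x. (L ^^ n) (\<lambda>_. 1) x \<le> C * l ^ n"
    using assms by (auto simp: growth_rates_def)
  have C0: "0 \<le> C" using C[of 0 undefined] by simp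
  have "(L ^^ n) (\<lambda>_. 1) x \<le> C * m ^ n" for n x
    using C[of n x] mult_left_mono[OF power_mono[OF assms(2), of n] C0] l by simp
  then show ?thesis using l assms(2) by (auto simp: growth_rates_def)
qed

text \<open>The inequality L u \<le> l u iterates, and u lies between the positive constant d and a
  finite bound, so it may replace 1.\<close>

lemma growth_ratesI:
  assumes u: "cont u" "\<And>x. d \<le> u x" "0 < d" "\<And>x. L u x \<le> l * u x" and l: "0 < l"
  shows "l \<in> growth_rates L"
proof -
  obtain B where B: "\<And>x. norm (u x) \<le> B" using cont_bounded[OF u(1)] by blast
  have pw: "(L ^^ n) u x \<le> l ^ n * u x" for n x
  proof (induction n arbitrary: x)
    case (Suc n)
    have c: "cont (\<lambda>x. l ^ n * u x)" by (intro continuous_intros u)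
    have "(L ^^ Suc n) u x \<le> L (\<lambda>x. l ^ n * u x) x"
      by (simp, intro L_mono cont_L_pow u c Suc)
    also have "\<dots> = l ^ n * L u x" by (simp add: L_cmult u)
    also have "\<dots> \<le> l ^ n * (l * u x)" using u l by (intro mult_left_mono) auto
    finally show ?case by (simp add: mult_ac)
  qed simp
  have "(L ^^ n) (\<lambda>_. 1) x \<le> (B / d) * l ^ n" for n x
  proof -
    have "d * (L ^^ n) (\<lambda>_. 1) x = (L ^^ n) (\<lambda>x. d * 1) x"
      by (subst L_pow_cmult) auto
    also have "\<dots> \<le> (L ^^ n) u x" using u by (intro L_pow_mono) auto
    also have "\<dots> \<le> l ^ n * u x" by (rule pw)
    also have "\<dots> \<le> l ^ n * B" using B[of x] l by (intro mult_left_mono) auto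
    finally show ?thesis using u(3) by (simp add: field_simps)
  qed
  then show ?thesis using l unfolding growth_rates_def by blast
qed

lemma growth_rates_nonempty: "\<exists>l. l \<in> growth_rates L"
proof -
  obtain B where B: "B > 0" "\<And>x. norm (L (\<lambda>_. 1) x) \<le> B" using cont_bounded[OF cont_L] by blast
  have "L (\<lambda>_. 1) x \<le> B * 1" for x using B(2)[of x] by simp
  then have "B \<in> growth_rates L" using B(1) by (intro growth_ratesI[where u="\<lambda>_. 1" and d=1]) auto
  then show ?thesis by blast
qed

lemma L_pow_le_power:
  assumes "\<And>x. (L ^^ n) (\<lambda>_. 1) x \<le> c" "0 \<le> c"
  shows "(L ^^ (n * m)) (\<lambda>_. 1) x \<le> c ^ m"
proof (induction m arbitrary: x)
  case (Suc m)
  have "(L ^^ (n * Suc m)) (\<lambda>_. 1) x = (L ^^ (n * m)) ((L ^^ n) (\<lambda>_. 1)) x"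
    by (simp add: funpow_add add.commute[of n])
  also have "\<dots> \<le> (L ^^ (n * m)) (\<lambda>_. c * 1) x"
    using assms(1) by (intro L_pow_mono cont_L_pow) auto
  also have "\<dots> = c * (L ^^ (n * m)) (\<lambda>_. 1) x" by (subst L_pow_cmult) auto
  also have "\<dots> \<le> c * c ^ m" by (intro mult_left_mono Suc assms(2))
  finally show ?case by simp
qed simp

lemma growth_ratesI_power:
  assumes n: "0 < n" and l: "0 < l" and le: "\<And>x. (L ^^ n) (\<lambda>_. 1) x \<le> l ^ n"
  shows "l \<in> growth_rates L"
proof -
  obtain B where B: "B > 0" "\<And>x. norm (L (\<lambda>_. 1) x) \<le> B" using cont_bounded[OF cont_L] by blast
  have "(L ^^ 1) (\<lambda>_. 1) x \<le> B" for x using B(2)[of x] by simp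
  then have Br: "(L ^^ r) (\<lambda>_. 1) x \<le> B ^ r" for r x
    using L_pow_le_power[of 1 B r x] B(1) by simp
  \<comment> \<open>Division of the exponent by n leaves a remainder r < n; C dominates the
    contribution of each of these remainders.\<close>
  define C where "C = (\<Sum>r<n. B ^ r / l ^ r)"
  have "(L ^^ k) (\<lambda>_. 1) x \<le> C * l ^ k" for k x
  proof -
    define m r where "m = k div n" and "r = k mod n"
    have k: "k = r + n * m" and r: "r < n" using n by (simp_all add: m_def r_def)
    have lp: "(L ^^ (n * m)) (\<lambda>_. 1) y \<le> (l ^ n) ^ m * 1" for y
      using L_pow_le_power[of n "l ^ n" m y] le l by simp
    have "(L ^^ k) (\<lambda>_. 1) x = (L ^^ r) ((L ^^ (n * m)) (\<lambda>_. 1)) x" by (simp add: k funpow_add)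
    also have "\<dots> \<le> (L ^^ r) (\<lambda>_. (l ^ n) ^ m * 1) x" using lp by (intro L_pow_mono cont_L_pow) auto
    also have "\<dots> = (l ^ n) ^ m * (L ^^ r) (\<lambda>_. 1) x" by (subst L_pow_cmult) auto
    also have "\<dots> \<le> (l ^ n) ^ m * B ^ r" using l by (intro mult_left_mono Br) auto
    also have "\<dots> = (B ^ r / l ^ r) * l ^ k" using l by (simp add: k power_add power_mult)
    also have "\<dots> \<le> C * l ^ k"
      unfolding C_def using r B(1) l by (intro mult_right_mono member_le_sum) auto
    finally show ?thesis .
  qed
  then show ?thesis using l unfolding growth_rates_def by blast
qed

lemma positive_op_mult:
  assumes h: "bc_nonneg h"
  shows "positive_op (\<lambda>f. T (bc_mult h f))"
  unfolding positive_op_def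
proof (intro conjI allI impI)
  fix f k :: "'a \<Rightarrow>\<^sub>C complex" and c
  have "bc_mult h (f + k) = bc_mult h f + bc_mult h k"
    by (rule bcontfun_eqI) (simp add: apply_bc_mult distrib_left)
  then show "T (bc_mult h (f + k)) = T (bc_mult h f) + T (bc_mult h k)" by (simp add: T_add)
  have "bc_mult h (bc_scale c f) = bc_scale c (bc_mult h f)"
    by (rule bcontfun_eqI) (simp add: apply_bc_mult apply_bc_scale)
  then show "T (bc_mult h (bc_scale c f)) = bc_scale c (T (bc_mult h f))" by (simp add: T_scale)
  assume "bc_nonneg f"
  then have "bc_nonneg (bc_mult h f)" using h by (auto simp: bc_nonneg_def apply_bc_mult)
  then show "bc_nonneg (T (bc_mult h f))" by (rule T_nonneg)
qed

lemma real_part_op_mult: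
  assumes "cont h" "cont f"
  shows "real_part_op (\<lambda>f. T (bc_mult (bc_real h) f)) f = L (\<lambda>y. h y * f y)"
proof -
  have "bc_mult (bc_real h) (bc_real f) = bc_real (\<lambda>y. h y * f y)"
    by (rule bcontfun_eqI) (simp add: apply_bc_mult apply_bc_real assms continuous_on_mult)
  then show ?thesis by (simp add: real_part_op_def[abs_def])
qed

text \<open>The infimum \<open>r\<close> of the growth rates is itself in the spectrum: an inverse \<open>S\<close> of \<open>r - T\<close> would be
  a limit of Neumann series, hence positive, and \<open>u = S 1\<close> would satisfy
  \<open>T u = r u - 1 \<le> (r - 1 / norm u) u\<close>, a growth rate smaller than \<open>r\<close>.\<close>

lemma growth_rate_of_spectral_radius_less:
  assumes m: "0 < m" and less: "spectral_radius T < ennreal m"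
  shows "m \<in> growth_rates L"
proof (rule ccontr)
  assume notin: "m \<notin> growth_rates L"
  define r where "r = Inf (growth_rates L)"
  have bdd: "bdd_below (growth_rates L)" by (auto simp: growth_rates_def intro!: bdd_belowI[of _ 0])
  have lower: "m \<le> l" if "l \<in> growth_rates L" for l
    using growth_rates_upward[OF that, of m] notin by linarith
  have mr: "m \<le> r" unfolding r_def using growth_rates_nonempty lower by (intro cInf_greatest) auto
  then have r0: "0 < r" using m by simp
  have above: "l \<in> growth_rates L" if "r < l" for l
  proof -
    have ne: "growth_rates L \<noteq> {}" using growth_rates_nonempty by blast
    have "Inf (growth_rates L) < l" using that by (simp add: r_def)
    from cInf_lessD[OF ne this] obtain k where "k \<in> growth_rates L" "k < l" by blast
    then show ?thesis using growth_rates_upward by simp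
  qed
  have "of_real r \<notin> op_spectrum T"
  proof
    assume "complex_of_real r \<in> op_spectrum T"
    then have "ennreal (cmod (complex_of_real r)) \<le> spectral_radius T"
      unfolding spectral_radius_def by (rule SUP_upper[of _ _ "\<lambda>c. ennreal (cmod c)"])
    also note less
    finally have "ennreal r < ennreal m" using r0 by simp
    then show False using mr m by (simp add: ennreal_less_iff r0 less_imp_le)
  qed
  then obtain S where S: "bounded_linear S" "\<And>f. S (bc_scale (of_real r) f - T f) = f"
    "\<And>f. bc_scale (of_real r) (S f) - T (S f) = f" unfolding op_spectrum_def by blast
  interpret S: bounded_linear S by (rule S(1))
  obtain K where K: "K > 0" "\<And>f. norm (S f) \<le> norm f * K" using S.pos_bounded by blast
  have S_pos: "bc_nonneg (S f)" if f: "bc_nonneg f" for f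
    unfolding bc_nonneg_def
  proof
    fix x
    have "S f x \<in> closure (\<real>\<^sub>\<ge>\<^sub>0)"
      unfolding closure_approachable
    proof (intro allI impI)
      fix e :: real assume e: "e > 0"
      define N where "N = 2 * norm (S f) * K + 1"
      have N: "N > 0" using K by (simp add: N_def add_nonneg_pos)
      \<comment> \<open>\<open>d * K \<le> 1/2\<close> absorbs the term d S h into h and bounds norm
        h by 2 norm (S f); \<open>d * N \<le> e\<close> then puts h within e of S f.\<close>
      define d where "d = min (1 / (2 * K)) (e / N)"
      have d: "0 < d" "d * K \<le> 1/2" "d * N \<le> e"
        using K e N by (auto simp: d_def min_def field_simps)
      obtain k where k: "k \<in> growth_rates L" "k < r + d"
        using above[of "r + d/2"] d by (intro that[of "r + d/2"]) auto
      obtain R where R: "\<And>f. bc_scale (of_real (r + d)) (R f) - T (R f) = f"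
        "\<And>f. complex_of_real (r + d) \<in> \<real>\<^sub>\<ge>\<^sub>0 \<Longrightarrow> bc_nonneg f \<Longrightarrow> bc_nonneg (R f)"
        using neumann_series[OF k(1), of "of_real (r + d)"] k(2) r0 d
        by (metis abs_of_pos add_pos_pos norm_of_real)
      define h where "h = R f"
      have "bc_nonneg h" unfolding h_def using f r0 d by (intro R(2)) auto
      \<comment> \<open>h solves the equation at r + d; moving d h to the right makes it an equation
        at r, where S applies.\<close>
      have "bc_scale (of_real r) h - T h = f - d *\<^sub>R h"
        unfolding R(1)[of f, folded h_def, symmetric]
        by (rule bcontfun_eqI) (simp add: apply_bc_scale scaleR_conv_of_real algebra_simps)
      then have h: "h = S f - d *\<^sub>R S h" using S(2)[of h] by (simp add: S.diff S.scaleR)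
      have "norm h \<le> norm (S f) + norm (d *\<^sub>R S h)" using norm_triangle_ineq4[of "S f" "d *\<^sub>R S h"] h by simp
      moreover have "norm (d *\<^sub>R S h) \<le> d * K * norm h" using d K(2)[of h] by (simp add: mult_ac)
      moreover have "d * K * norm h \<le> 1/2 * norm h" using d by (intro mult_right_mono) auto
      ultimately have nh: "norm h \<le> 2 * norm (S f)" and nd: "norm (d *\<^sub>R S h) \<le> d * K * norm h" by auto
      have eq: "S f - h = d *\<^sub>R S h" using h by (simp add: algebra_simps)
      have "dist (h x) (S f x) = norm ((S f - h) x)" by (simp add: dist_norm norm_minus_commute)
      also have "\<dots> \<le> norm (d *\<^sub>R S h)" unfolding eq by (rule norm_bounded)
      also have "\<dots> \<le> d * K * (2 * norm (S f))" using nd nh d K by (meson mult_left_mono mult_nonneg_nonneg less_imp_le order_trans)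
      also have "\<dots> < d * N" using d by (simp add: N_def mult_ac)
      also have "\<dots> \<le> e" by (rule d)
      finally show "\<exists>y\<in>\<real>\<^sub>\<ge>\<^sub>0. dist y (S f x) < e" using \<open>bc_nonneg h\<close> unfolding bc_nonneg_def by blast
    qed
    then show "S f x \<in> \<real>\<^sub>\<ge>\<^sub>0" using closed_nonneg_Reals_complex by simp
  qed
  define u where "u x = Re (S (bc_real (\<lambda>_. 1)) x)" for x
  have cu: "cont u" unfolding u_def by (intro continuous_intros) auto
  have "bc_nonneg (S (bc_real (\<lambda>_. 1)))" by (intro S_pos) (simp add: bc_nonneg_bc_real)
  then have nn: "\<exists>t. S (bc_real (\<lambda>_. 1)) x = of_real t \<and> 0 \<le> t" for x
    unfolding bc_nonneg_def nonneg_Reals_def by blast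
  have "S (bc_real (\<lambda>_. 1)) x \<in> \<real>" for x
    using nn[of x] by (elim exE conjE) simp
  then have ur: "bc_real u = S (bc_real (\<lambda>_. 1))" unfolding u_def[abs_def] by (rule bc_real_Re)
  have u0: "0 \<le> u x" for x using nn[of x] unfolding u_def by (elim exE conjE) simp
  have eq: "L u x = r * u x - 1" for x
  proof -
    have "bc_scale (of_real r) (bc_real u) x - T (bc_real u) x = bc_real (\<lambda>_. 1) x"
      using arg_cong[OF S(3)[of "bc_real (\<lambda>_. 1)"], of "\<lambda>f. apply_bcontfun f x"] by (simp add: ur)
    then have "of_real (r * u x) - T (bc_real u) x = 1" by (simp add: apply_bc_scale apply_bc_real cu)
    then have "Re (of_real (r * u x) - T (bc_real u) x) = 1" by simp
    then show ?thesis by (simp add: real_part_op_def)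
  qed
  have lower_u: "1 / r \<le> u x" for x
    using L_nonneg[OF cu u0, of x] r0 by (simp add: eq field_simps)
  obtain B where B: "B > 0" "\<And>x. norm (u x) \<le> B" using cont_bounded[OF cu] by blast
  \<comment> \<open>The summand -1 in L u is at most - u / B, which lowers the rate by 1 / B; the
    maximum with r / 2 keeps it positive.\<close>
  define l where "l = max (r - 1 / B) (r / 2)"
  have "L u x \<le> l * u x" for x
  proof -
    have "L u x \<le> (r - 1 / B) * u x" using B(1) B(2)[of x] by (simp add: eq field_simps)
    also have "\<dots> \<le> l * u x" using u0 by (intro mult_right_mono) (auto simp: l_def)
    finally show ?thesis .
  qed
  then have "l \<in> growth_rates L" using lower_u r0 cu
    by (intro growth_ratesI[where u=u and d="1 / r"]) (auto simp: l_def)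
  then have "r \<le> l" unfolding r_def using bdd by (rule cInf_lower)
  then show False using r0 B(1) by (simp add: l_def max_def split: if_splits)
qed

end
end

section \<open>Essential points\<close>

lemma elog_eq_0D: "elog t = 0 \<Longrightarrow> t = 1"
  by (cases t) (auto simp: elog_def zero_ereal_def split: if_splits)

lemma elog_leI:
  assumes "t \<le> ennreal (exp b)"
  shows "elog t \<le> ereal b"
proof (cases "t = 0")
  case False
  obtain s where s: "t = ennreal s" "0 \<le> s" using assms by (cases t) (auto simp: top_unique)
  then have "0 < s" "s \<le> exp b" using False assms by (auto simp: ennreal_le_iff less_le)
  then have "ln s \<le> b" by (metis ln_exp ln_mono exp_gt_zero)
  then show ?thesis using s False by (simp add: elog_def)
qed (simp add: elog_def)

lemma elog_lessD:
  assumes "elog t < ereal b"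
  shows "t < ennreal (exp b)"
proof (cases "t = 0")
  case False
  then obtain s where s: "t = ennreal s" "0 \<le> s" using assms by (cases t) (auto simp: elog_def)
  then have "0 < s" "ln s < b" using False assms by (auto simp: elog_def less_le)
  then have "s < exp b" by (metis exp_less_mono exp_ln)
  then show ?thesis using s by (simp add: ennreal_less_iff)
qed simp

lemma (in compact_t2) closed_essential_points: "closed (essential_points (\<alpha> :: 'a \<Rightarrow> 'a))"
proof -
  have "\<exists>V. open V \<and> x \<in> V \<and> V \<subseteq> - essential_points \<alpha>" if "x \<notin> essential_points \<alpha>" for x
    using that unfolding essential_points_def by blast
  then have "open (- essential_points \<alpha>)"
    by (subst open_subopen) (metis ComplD)
  then show ?thesis by (simp add: closed_def)
qed

context compact_t2
begin

context
  fixes \<alpha> :: "'a \<Rightarrow> 'a"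
  assumes \<alpha>: "cont \<alpha>"
begin

lemma cont_funpow: "cont (\<alpha> ^^ n)"
  by (induction n) (auto simp: id_def intro: continuous_on_compose2[OF \<alpha>])

lemma essential_points_forward: "y \<in> essential_points \<alpha> \<Longrightarrow> \<alpha> y \<in> essential_points \<alpha>"
proof -
  assume y: "y \<in> essential_points \<alpha>"
  show ?thesis
    unfolding essential_points_def
  proof (intro CollectI allI impI)
    fix V assume V: "open V \<and> \<alpha> y \<in> V"
    have "open (\<alpha> -` V)" using open_vimage[OF _ \<alpha>] V by blast
    then obtain \<mu> where \<mu>: "\<mu> \<in> invariant_measures \<alpha>" "emeasure \<mu> (\<alpha> -` V) > 0"
      using y V unfolding essential_points_def by auto
    then have "emeasure \<mu> V > 0" using V by (simp add: invariant_measures_def)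
    then show "\<exists>\<mu>\<in>invariant_measures \<alpha>. emeasure \<mu> V > 0" using \<mu> by blast
  qed
qed

lemma essential_points_funpow: "y \<in> essential_points \<alpha> \<Longrightarrow> (\<alpha> ^^ n) y \<in> essential_points \<alpha>"
  by (induction n) (auto intro: essential_points_forward)

text \<open>The complement is a union of null open sets, possibly uncountably many. Inner regularity
  reduces to a closed part, which finitely many of them cover.\<close>

lemma measure_nonessential:
  assumes \<mu>: "\<mu> \<in> invariant_measures \<alpha>"
  shows "emeasure \<mu> (- essential_points \<alpha>) = 0"
proof -
  have reg: "regular_borel \<mu>" by (rule invariant_measures_regular[OF \<mu>])
  interpret prob_space \<mu> by (rule invariant_measures_prob[OF \<mu>])
  have "measure \<mu> (- essential_points \<alpha>) \<le> 0 + e" if e: "e > 0" for e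
  proof -
    have B: "- essential_points \<alpha> \<in> sets borel" using closed_essential_points by auto
    obtain K where K: "closed K" "K \<subseteq> - essential_points \<alpha>"
      "measure \<mu> (- essential_points \<alpha>) < measure \<mu> K + e" by (rule regular_inner[OF reg B e])
    let ?N = "{V. open V \<and> emeasure \<mu> V = 0}"
    have KN: "K \<subseteq> \<Union>?N"
    proof
      fix x assume "x \<in> K"
      then have "x \<notin> essential_points \<alpha>" using K by blast
      then obtain V where "open V" "x \<in> V" "\<not> emeasure \<mu> V > 0"
        using \<mu> unfolding essential_points_def by blast
      then have "V \<in> ?N" by (simp add: zero_less_iff_neq_zero)
      then show "x \<in> \<Union>?N" using \<open>x \<in> V\<close> by blast
    qed
    have opN: "open V" if "V \<in> ?N" for V using that by blast
    obtain \<D> where D: "\<D> \<subseteq> ?N" "finite \<D>" "K \<subseteq> \<Union>\<D>"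
      by (rule compactE[OF closed_imp_compact[OF K(1)] KN opN])
    have op: "V \<in> sets \<mu>" if "V \<in> \<D>" for V using that D(1) regular_sets[OF reg] by auto
    have "emeasure \<mu> (\<Union>\<D>) \<le> (\<Sum>V\<in>\<D>. emeasure \<mu> V)"
      using emeasure_subadditive_finite[OF D(2), of "\<lambda>V. V"] op by auto
    also have "\<dots> = 0" using D(1) by (intro sum.neutral) auto
    finally have "emeasure \<mu> (\<Union>\<D>) = 0" by simp
    moreover have "emeasure \<mu> K \<le> emeasure \<mu> (\<Union>\<D>)" using D op by (intro emeasure_mono sets.finite_Union) auto
    ultimately have "measure \<mu> K = 0" by (simp add: emeasure_eq_measure)
    then show ?thesis using K by simp
  qed
  then have "measure \<mu> (- essential_points \<alpha>) \<le> 0" by (rule field_le_epsilon)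
  then show ?thesis by (simp add: emeasure_eq_measure measure_le_0_iff)
qed

lemma AE_essential_points:
  assumes \<mu>: "\<mu> \<in> invariant_measures \<alpha>"
  shows "AE x in \<mu>. x \<in> essential_points \<alpha>"
proof (rule AE_I)
  show "{x \<in> space \<mu>. x \<notin> essential_points \<alpha>} \<subseteq> - essential_points \<alpha>" by auto
  show "emeasure \<mu> (- essential_points \<alpha>) = 0" by (rule measure_nonessential[OF \<mu>])
  show "- essential_points \<alpha> \<in> sets \<mu>"
    using closed_essential_points regular_sets[OF invariant_measures_regular[OF \<mu>]] by auto
qed

lemma essential_points_nonempty: "essential_points \<alpha> \<noteq> {}"
proof
  assume e: "essential_points \<alpha> = {}"
  obtain \<phi> where "\<phi> \<in> invariant_states \<alpha>" using invariant_states_nonempty[OF \<alpha>] by blast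
  then obtain \<mu> where \<mu>: "\<mu> \<in> invariant_measures \<alpha>" using invariant_state_measure[OF \<alpha>] by metis
  interpret prob_space \<mu> by (rule invariant_measures_prob[OF \<mu>])
  show False
    using measure_nonessential[OF \<mu>] e emeasure_space_1 regular_space[OF invariant_measures_regular[OF \<mu>]]
    by simp
qed

lemma invariant_state_vanishing:
  assumes \<phi>: "\<phi> \<in> invariant_states \<alpha>" and p: "cont p" "\<And>x. x \<in> essential_points \<alpha> \<Longrightarrow> p x = 0"
  shows "\<phi> p = 0"
proof -
  obtain \<mu> where \<mu>: "\<mu> \<in> invariant_measures \<alpha>" "\<And>f. cont f \<Longrightarrow> (\<integral>x. f x \<partial>\<mu>) = \<phi> f"
    using invariant_state_measure[OF \<alpha> \<phi>] by metis
  have "(\<integral>x. p x \<partial>\<mu>) = (\<integral>x. 0 \<partial>\<mu>)"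
    using AE_essential_points[OF \<mu>(1)] p(2) regular_sets[OF invariant_measures_regular[OF \<mu>(1)]]
    by (intro integral_cong_AE cont_measurable p(1)) auto
  then show ?thesis using \<mu>(2)[OF p(1)] by simp
qed

text \<open>The functions \<open>p\<close> of the upper bound. They are closed under finite sums, so
  corrections found at different points can be merged into a larger one.\<close>

definition corrections :: "('a \<Rightarrow> real) set" where
  "corrections = {p. cont p \<and> (\<forall>x. 0 \<le> p x) \<and> (\<forall>x\<in>essential_points \<alpha>. p x = 0)}"

lemma corrections_sum: "finite I \<Longrightarrow> (\<And>i. i \<in> I \<Longrightarrow> p i \<in> corrections) \<Longrightarrow> (\<lambda>x. \<Sum>i\<in>I. p i x) \<in> corrections"
  unfolding corrections_def by (auto intro!: continuous_on_sum sum_nonneg)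

lemma ess_preimage_outside: "x \<notin> essential_points \<alpha> \<Longrightarrow> ess_preimage \<alpha> n x = {}"
  using essential_points_funpow by (auto simp: ess_preimage_def)

section \<open>Counting essential preimages\<close>

lemma ess_preimage_Suc: "ess_preimage \<alpha> (Suc n) x = (\<Union>y\<in>ess_preimage \<alpha> 1 x. ess_preimage \<alpha> n y)"
  using essential_points_funpow by (auto simp: ess_preimage_def)

context
  assumes fin_essential: "\<And>x. x \<in> essential_points \<alpha> \<Longrightarrow> finite (ess_preimage \<alpha> 1 x)"
begin

lemma finite_fibre: "finite (ess_preimage \<alpha> 1 x)"
  using fin_essential ess_preimage_outside by (cases "x \<in> essential_points \<alpha>") auto

lemma finite_ess_preimage: "finite (ess_preimage \<alpha> n x)"
proof (induction n arbitrary: x)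
  case 0
  have "ess_preimage \<alpha> 0 x \<subseteq> {x}" by (auto simp: ess_preimage_def)
  then show ?case by (rule finite_subset) simp
next
  case (Suc n)
  then show ?case unfolding ess_preimage_Suc using finite_fibre by blast
qed

lemma card_ess_preimage_Suc:
  "card (ess_preimage \<alpha> (Suc n) x) = (\<Sum>y\<in>ess_preimage \<alpha> 1 x. card (ess_preimage \<alpha> n y))"
  unfolding ess_preimage_Suc using finite_fibre finite_ess_preimage
  by (intro card_UN_disjoint) (auto simp: ess_preimage_def)

lemma card_ess_preimage_subexponential:
  assumes rami: "inverse_rami_rate \<alpha> = 0" and e: "0 < e"
  obtains N where "\<And>n x. N \<le> n \<Longrightarrow> real (card (ess_preimage \<alpha> n x)) \<le> exp (real n * e)"
proof -
  let ?a = "\<lambda>n. SUP x\<in>essential_points \<alpha>.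
     if finite (ess_preimage \<alpha> n x) then ennreal (root n (real (card (ess_preimage \<alpha> n x)))) else \<infinity>"
  have "elog (limsup ?a) = 0" using rami unfolding inverse_rami_rate_def .
  then have "limsup ?a = 1" by (rule elog_eq_0D)
  moreover have "(1 :: ennreal) < ennreal (exp e)"
    using e by (simp only: ennreal_1[symmetric] ennreal_less_iff zero_le_one one_less_exp_iff)
  ultimately have "limsup ?a < ennreal (exp e)" by (simp only:)
  from Limsup_lessD[OF this] obtain N where N: "\<And>n. N \<le> n \<Longrightarrow> ?a n < ennreal (exp e)"
    unfolding eventually_sequentially by metis
  \<comment> \<open>\<open>root 0\<close> is constantly 0, so the count can be recovered from its
    root only for n \<ge> 1.\<close>
  have "real (card (ess_preimage \<alpha> n x)) \<le> exp (real n * e)" if n: "max N 1 \<le> n" for n x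
  proof (cases "x \<in> essential_points \<alpha>")
    case True
    have "ennreal (root n (real (card (ess_preimage \<alpha> n x)))) \<le> ?a n"
      using finite_ess_preimage by (intro SUP_upper2[OF True]) auto
    also have "\<dots> < ennreal (exp e)" using n by (intro N) simp
    finally have lt: "root n (real (card (ess_preimage \<alpha> n x))) < exp e"
      by (simp add: ennreal_less_iff real_root_ge_zero)
    have "real (card (ess_preimage \<alpha> n x)) = root n (real (card (ess_preimage \<alpha> n x))) ^ n"
      using n by (intro real_root_pow_pos2[symmetric]) auto
    also have "\<dots> \<le> exp e ^ n" using lt by (intro power_mono) (auto simp: real_root_ge_zero)
    finally show ?thesis by (simp add: exp_of_nat_mult)
  qed (simp add: ess_preimage_outside)
  then show thesis using that by blast
qed

end

text \<open>One extreme point serves all thresholds: with \<open>s\<close> the largest threshold attained in the limit,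
  the states satisfying it form a face, because along a convex combination of a state below \<open>s\<close> the
  other state would exceed \<open>s\<close> by a fixed amount.\<close>

lemma extremal_maximizer:
  fixes q :: "nat \<Rightarrow> 'a \<Rightarrow> real"
  assumes q: "\<And>j. cont (q j)" and dec: "\<And>i j x. i \<le> j \<Longrightarrow> q j x \<le> q i x"
  obtains \<phi> where "face (invariant_states \<alpha>) {\<phi>}"
    "\<And>k j. (\<And>i. \<exists>\<psi>\<in>invariant_states \<alpha>. k \<le> \<psi> (q i)) \<Longrightarrow> k \<le> \<phi> (q j)"
proof -
  let ?M = "invariant_states \<alpha>"
  have mono: "\<psi> (q j) \<le> \<psi> (q i)" if "\<psi> \<in> ?M" "i \<le> j" for \<psi> i j
  proof -
    have "pos_functional \<psi>" using that(1) by (simp add: invariant_states_def states_def)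
    then show ?thesis by (rule pos_functional_mono[OF _ q q dec[OF that(2)]])
  qed
  define S where "S = {k. \<forall>i. \<exists>\<psi>\<in>?M. k \<le> \<psi> (q i)}"
  show thesis
  proof (cases "S = {}")
    \<comment> \<open>Here the maxima over the invariant states tend to -\<infinity>. No real
      threshold constrains \<phi>, and any extreme point will do.\<close>
    case True
    have "face ?M ?M" by (simp add: face_def)
    then obtain \<phi> where "face ?M {\<phi>}"
      using extreme_point_in_face[OF compact_invariant_states invariant_states_nonempty[OF \<alpha>] _ closed_invariant_states]
      by metis
    then show thesis
    proof (rule that)
      fix k j assume "\<And>i. \<exists>\<psi>\<in>?M. k \<le> \<psi> (q i)"
      then have "k \<in> S" by (simp add: S_def)
      then show "k \<le> \<phi> (q j)" using True by simp
    qed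
  next
    case False
    obtain B where B: "\<And>x. norm (q 0 x) \<le> B" using cont_bounded[OF q] by blast
    have bdd: "bdd_above S"
    proof (rule bdd_aboveI[of _ B])
      fix k assume "k \<in> S"
      then obtain \<psi> where \<psi>: "\<psi> \<in> ?M" "k \<le> \<psi> (q 0)" unfolding S_def by blast
      then have "\<psi> \<in> states" by (simp add: invariant_states_def)
      then have "\<bar>\<psi> (q 0)\<bar> \<le> B" by (rule state_bounds[OF _ q[of 0]]) (use B in simp)
      then show "k \<le> B" using \<psi> by simp
    qed
    define s where "s = Sup S"
    have attained: "\<exists>\<psi>\<in>?M. s \<le> \<psi> (q j)" for j
    proof -
      have c: "continuous_on ?M (\<lambda>\<psi>. \<psi> (q j))"
        by (rule continuous_on_subset[OF continuous_on_product_coordinates subset_UNIV])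
      obtain \<psi> where \<psi>: "\<psi> \<in> ?M" "\<And>x. x \<in> ?M \<Longrightarrow> x (q j) \<le> \<psi> (q j)"
        using continuous_attains_sup[OF compact_invariant_states invariant_states_nonempty[OF \<alpha>] c] by blast
      have "k \<le> \<psi> (q j)" if "k \<in> S" for k
      proof -
        have "\<exists>\<theta>\<in>?M. k \<le> \<theta> (q j)" using that by (simp add: S_def)
        then obtain \<theta> where "\<theta> \<in> ?M" "k \<le> \<theta> (q j)" by (elim bexE)
        then show ?thesis using \<psi>(2)[of \<theta>] by simp
      qed
      then have "s \<le> \<psi> (q j)" unfolding s_def using False by (intro cSup_least) auto
      then show ?thesis using \<psi>(1) by blast
    qed
    define F where "F = ?M \<inter> (\<Inter>j\<in>UNIV. {\<phi>. s \<le> \<phi> (q j)})"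
    have Fcl: "closed F"
      unfolding F_def by (intro closed_Int closed_INT closed_invariant_states ballI closed_eval_ge)
    have "?M \<inter> F = F" by (auto simp: F_def)
    then have Fc: "compact F" using compact_Int_closed[OF compact_invariant_states Fcl, of \<alpha>] by simp
    have Fne: "F \<noteq> {}"
      unfolding F_def
    proof (rule compact_imp_fip_image[OF compact_invariant_states])
      show "closed {\<phi>. s \<le> \<phi> (q j)}" for j by (rule closed_eval_ge)
      fix I :: "nat set" assume "finite I"
      then obtain m where m: "\<And>i. i \<in> I \<Longrightarrow> i \<le> m" using finite_nat_set_iff_bounded_le by auto
      obtain \<psi> where \<psi>: "\<psi> \<in> ?M" "s \<le> \<psi> (q m)" using attained[of m] by (elim bexE)
      have "s \<le> \<psi> (q i)" if "i \<in> I" for i using mono[OF \<psi>(1) m[OF that]] \<psi>(2) by simp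
      then show "?M \<inter> (\<Inter>i\<in>I. {\<phi>. s \<le> \<phi> (q i)}) \<noteq> {}" using \<psi>(1) by blast
    qed
    have key: "s \<le> a (q j)"
      if ab: "a \<in> ?M" "b \<in> ?M" and t: "0 < t" "t < 1" and conv: "\<And>i. s \<le> t * a (q i) + (1 - t) * b (q i)"
      for a b :: "('a \<Rightarrow> real) \<Rightarrow> real" and t j
    proof (rule ccontr)
      assume "\<not> s \<le> a (q j)"
      then have d: "0 < s - a (q j)" by simp
      have "s + t * (s - a (q j)) \<notin> S"
      proof
        assume "s + t * (s - a (q j)) \<in> S"
        then have "s + t * (s - a (q j)) \<le> s" unfolding s_def by (rule cSup_upper[OF _ bdd])
        then show False using mult_pos_pos[OF t(1) d] by simp
      qed
      then obtain i where i: "\<And>\<psi>. \<psi> \<in> ?M \<Longrightarrow> \<psi> (q i) < s + t * (s - a (q j))"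
        unfolding S_def by (auto simp: not_le)
      \<comment> \<open>The bounds for a and b hold at different indices; as values decrease along
        the sequence, both hold at the larger one, and together they force t * t * (s - a (q j))
        \<le> 0.\<close>
      let ?m = "max i j"
      have "t * a (q ?m) \<le> t * a (q j)" using mono[OF ab(1), of j ?m] t by (intro mult_left_mono) auto
      moreover have "(1 - t) * b (q ?m) \<le> (1 - t) * (s + t * (s - a (q j)))"
        using mono[OF ab(2), of i ?m] i[OF ab(2)] t by (intro mult_left_mono) auto
      ultimately have "s \<le> t * a (q j) + (1 - t) * (s + t * (s - a (q j)))" using conv[of ?m] by linarith
      then have "t * t * (s - a (q j)) \<le> 0" by (simp add: algebra_simps)
      then show False using mult_pos_pos[OF mult_pos_pos[OF t(1) t(1)] d] by simp
    qed
    have "face ?M F"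
      unfolding face_def
    proof (intro conjI ballI allI impI)
      show "F \<subseteq> ?M" by (auto simp: F_def)
      fix a b and t :: real
      assume ab: "a \<in> ?M" "b \<in> ?M" and t: "0 < t" "t < 1" and conv: "(\<lambda>f. t * a f + (1 - t) * b f) \<in> F"
      have c: "s \<le> t * a (q i) + (1 - t) * b (q i)" for i using conv by (simp add: F_def)
      have c': "s \<le> (1 - t) * b (q i) + (1 - (1 - t)) * a (q i)" for i using c[of i] by simp
      show "a \<in> F" using key[OF ab t c] ab by (simp add: F_def)
      have t': "0 < 1 - t" "1 - t < 1" using t by auto
      show "b \<in> F" using key[OF ab(2,1) t' c'] ab by (simp add: F_def)
    qed
    then obtain \<phi> where \<phi>: "\<phi> \<in> F" "face ?M {\<phi>}" using extreme_point_in_face[OF Fc Fne _ Fcl] by metis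
    show thesis
    proof (rule that[OF \<phi>(2)])
      fix k j assume "\<And>i. \<exists>\<psi>\<in>?M. k \<le> \<psi> (q i)"
      then have "k \<in> S" by (simp add: S_def)
      then have "k \<le> s" unfolding s_def by (rule cSup_upper[OF _ bdd])
      also have "s \<le> \<phi> (q j)" using \<phi>(1) by (simp add: F_def)
      finally show "k \<le> \<phi> (q j)" .
    qed
  qed
qed

section \<open>Homeomorphisms of the essential set\<close>

lemma ess_preimage_homeomorphism:
  assumes hom: "homeomorphism (essential_points \<alpha>) (essential_points \<alpha>) \<alpha> \<beta>"
    and x: "x \<in> essential_points \<alpha>"
  shows "ess_preimage \<alpha> n x = {(\<beta> ^^ n) x}"
proof -
  have \<beta>: "\<beta> y \<in> essential_points \<alpha>" "\<alpha> (\<beta> y) = y" "\<beta> (\<alpha> y) = y" if "y \<in> essential_points \<alpha>" for y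
    using hom that unfolding homeomorphism_def by blast+
  have \<beta>n: "(\<beta> ^^ n) y \<in> essential_points \<alpha>" if "y \<in> essential_points \<alpha>" for n y
    using that by (induction n) (auto intro: \<beta>)
  have right: "(\<alpha> ^^ n) ((\<beta> ^^ n) y) = y" if "y \<in> essential_points \<alpha>" for n y
  proof (induction n)
    case (Suc n)
    have "(\<alpha> ^^ Suc n) ((\<beta> ^^ Suc n) y) = (\<alpha> ^^ n) (\<alpha> (\<beta> ((\<beta> ^^ n) y)))"
      by (simp add: funpow_swap1)
    then show ?case using \<beta>(2)[OF \<beta>n[OF that]] Suc by simp
  qed simp
  have left: "(\<beta> ^^ n) ((\<alpha> ^^ n) y) = y" if "y \<in> essential_points \<alpha>" for n y
  proof (induction n)
    case (Suc n)
    have "(\<beta> ^^ Suc n) ((\<alpha> ^^ Suc n) y) = (\<beta> ^^ n) (\<beta> (\<alpha> ((\<alpha> ^^ n) y)))"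
      by (simp add: funpow_swap1)
    then show ?case using \<beta>(3)[OF essential_points_funpow[OF that]] Suc by simp
  qed simp
  show ?thesis
    using \<beta>n[OF x, of n] right[OF x, of n] left[of _ n] by (auto simp: ess_preimage_def)
qed

lemma inverse_rami_rate_homeomorphism:
  assumes hom: "homeomorphism (essential_points \<alpha>) (essential_points \<alpha>) \<alpha> \<beta>"
  shows "inverse_rami_rate \<alpha> = 0"
proof -
  let ?a = "\<lambda>n. SUP x\<in>essential_points \<alpha>.
     if finite (ess_preimage \<alpha> n x) then ennreal (root n (real (card (ess_preimage \<alpha> n x)))) else \<infinity>"
  \<comment> \<open>Every fibre is a singleton; n = 0 is excluded because \<open>root 0 1\<close> is
    0.\<close>
  have "?a n = 1" if n: "1 \<le> n" for n
  proof -
    have "?a n = (SUP x\<in>essential_points \<alpha>. 1)"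
      using n by (intro SUP_cong refl) (simp add: ess_preimage_homeomorphism[OF hom])
    then show ?thesis using essential_points_nonempty by simp
  qed
  then have "limsup ?a = limsup (\<lambda>_. 1)"
    by (intro Limsup_eq) (auto simp: eventually_sequentially)
  also have "\<dots> = 1" by (intro Limsup_const) simp
  finally show ?thesis by (simp add: inverse_rami_rate_def elog_def zero_ereal_def)
qed

section \<open>Transfer measures and the weighted operator\<close>

context
  fixes A :: "('a \<Rightarrow>\<^sub>C complex) \<Rightarrow> ('a \<Rightarrow>\<^sub>C complex)"
  assumes tr: "transfer_operator \<alpha> A"
begin

lemma positive_op_transfer: "positive_op A"
  using tr by (auto simp: transfer_operator_def positive_op_def)

lemma pos_functional_transfer: "pos_functional (\<lambda>f. real_part_op A f x)"
  unfolding pos_functional_def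
  using L_add[OF positive_op_transfer] L_cmult[OF positive_op_transfer] L_nonneg[OF positive_op_transfer]
  by (simp add: fun_eq_iff)

lemma integral_complex_transfer:
  fixes f :: "'a \<Rightarrow>\<^sub>C complex"
  assumes \<nu>: "regular_borel \<nu>" "\<And>f :: 'a \<Rightarrow> real. cont f \<Longrightarrow> (\<integral>y. f y \<partial>\<nu>) = real_part_op A f x"
  shows "(\<integral>y. apply_bcontfun f y \<partial>\<nu>) = A f x"
proof -
  have c: "cont (\<lambda>y. Re (f y))" "cont (\<lambda>y. Im (f y))" by (auto intro!: continuous_intros)
  have val: "A (bc_real h) x = of_real (\<integral>y. h y \<partial>\<nu>)" if "cont h" for h
    using that T_bc_real[OF positive_op_transfer that] apply_bc_real[OF cont_L[OF positive_op_transfer]] \<nu>(2) by simp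
  have i: "integrable \<nu> (\<lambda>y. complex_of_real (Re (f y)))" "integrable \<nu> (\<lambda>y. \<i> * complex_of_real (Im (f y)))"
    by (auto intro!: regular_integrable[OF \<nu>(1)] continuous_intros)
  have fe: "f = bc_real (\<lambda>y. Re (f y)) + bc_scale \<i> (bc_real (\<lambda>y. Im (f y)))"
    by (rule bcontfun_eqI) (simp add: apply_bc_real c apply_bc_scale complex_eq)
  have "(\<integral>y. f y \<partial>\<nu>) = (\<integral>y. complex_of_real (Re (f y)) + \<i> * complex_of_real (Im (f y)) \<partial>\<nu>)"
    by (intro Bochner_Integration.integral_cong refl) (simp add: complex_eq_iff)
  also have "\<dots> = of_real (\<integral>y. Re (f y) \<partial>\<nu>) + \<i> * of_real (\<integral>y. Im (f y) \<partial>\<nu>)"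
    using i by simp
  also have "\<dots> = A (bc_real (\<lambda>y. Re (f y)) + bc_scale \<i> (bc_real (\<lambda>y. Im (f y)))) x"
    by (simp add: T_add[OF positive_op_transfer] T_scale[OF positive_op_transfer] apply_bc_scale val c)
  finally show ?thesis using fe by simp
qed

text \<open>The definite description is justified by Riesz for existence and by regularity for
  uniqueness.\<close>

lemma transfer_measure_properties:
  "regular_borel (transfer_measure A x) \<and>
   (\<forall>f. (\<integral>y. apply_bcontfun f y \<partial>transfer_measure A x) = apply_bcontfun (A f) x)"
  unfolding transfer_measure_def
proof (rule theI')
  show "\<exists>!\<nu>. regular_borel \<nu> \<and> (\<forall>f. (\<integral>y. apply_bcontfun f y \<partial>\<nu>) = apply_bcontfun (A f) x)"
  proof (rule ex_ex1I)
    obtain \<nu> where "regular_borel \<nu>" "\<And>f. cont f \<Longrightarrow> (\<integral>y. f y \<partial>\<nu>) = real_part_op A f x"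
      using riesz_representation[OF pos_functional_transfer] by metis
    then show "\<exists>\<nu>. regular_borel \<nu> \<and> (\<forall>f. (\<integral>y. apply_bcontfun f y \<partial>\<nu>) = apply_bcontfun (A f) x)"
      using integral_complex_transfer by blast
    fix \<mu> \<nu>
    assume \<mu>: "regular_borel \<mu> \<and> (\<forall>f. (\<integral>y. apply_bcontfun f y \<partial>\<mu>) = apply_bcontfun (A f) x)"
      and \<nu>: "regular_borel \<nu> \<and> (\<forall>f. (\<integral>y. apply_bcontfun f y \<partial>\<nu>) = apply_bcontfun (A f) x)"
    show "\<mu> = \<nu>"
    proof (rule regular_unique)
      fix f :: "'a \<Rightarrow> real" assume f: "cont f"
      have "(\<integral>y. bc_real f y \<partial>\<mu>) = (\<integral>y. bc_real f y \<partial>\<nu>)" using \<mu> \<nu> by simp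
      then show "(\<integral>y. f y \<partial>\<mu>) = (\<integral>y. f y \<partial>\<nu>)" by (simp add: apply_bc_real[OF f])
    qed (use \<mu> \<nu> in auto)
  qed
qed

lemma regular_transfer_measure: "regular_borel (transfer_measure A x)"
  using transfer_measure_properties by blast

lemma integral_transfer_measure:
  fixes f :: "'a \<Rightarrow> real"
  assumes "cont f"
  shows "(\<integral>y. f y \<partial>transfer_measure A x) = real_part_op A f x"
proof -
  have "(\<integral>y. bc_real f y \<partial>transfer_measure A x) = A (bc_real f) x"
    using transfer_measure_properties by blast
  then have "of_real (\<integral>y. f y \<partial>transfer_measure A x) = A (bc_real f) x"
    by (simp add: apply_bc_real[OF assms])
  then show ?thesis unfolding real_part_op_def by (metis Re_complex_of_real)
qed

lemma transfer_homogeneous: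
  assumes f: "cont f" and h: "cont h"
  shows "real_part_op A (\<lambda>y. f (\<alpha> y) * h y) x = f x * real_part_op A h x"
proof -
  have c: "cont (\<lambda>y. f (\<alpha> y))" using continuous_on_compose2[OF f \<alpha>] by auto
  have ac: "apply_bcontfun (bc_comp (bc_real f) \<alpha>) y = bc_real f (\<alpha> y)" for y
  proof -
    obtain B where "\<And>x. norm (f x) \<le> B" using cont_bounded[OF f] by blast
    then have "(\<lambda>x. bc_real f (\<alpha> x)) \<in> bcontfun"
      unfolding apply_bc_real[OF f] by (intro bcontfun_normI[where b=B] continuous_on_of_real c) auto
    then show ?thesis by (simp add: bc_comp_def Bcontfun_inverse)
  qed
  have "bc_real (\<lambda>y. f (\<alpha> y) * h y) = bc_mult (bc_comp (bc_real f) \<alpha>) (bc_real h)"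
    by (rule bcontfun_eqI) (simp add: apply_bc_real apply_bc_mult ac f h continuous_on_mult[OF c h])
  moreover have "A (bc_mult (bc_comp (bc_real f) \<alpha>) (bc_real h)) = bc_mult (bc_real f) (A (bc_real h))"
    using tr unfolding transfer_operator_def by blast
  ultimately have "A (bc_real (\<lambda>y. f (\<alpha> y) * h y)) x = of_real (f x) * A (bc_real h) x"
    by (simp add: apply_bc_mult apply_bc_real f)
  then show ?thesis by (simp add: real_part_op_def)
qed

lemma transfer_measure_fibre: "emeasure (transfer_measure A x) (- (\<alpha> -` {x})) = 0"
proof -
  note reg = regular_transfer_measure[of x]
  interpret finite_measure "transfer_measure A x" by (rule regular_finite[OF reg])
  have cl: "closed (\<alpha> -` {x})" using closed_vimage[OF _ \<alpha>] by simp
  have "measure (transfer_measure A x) (- (\<alpha> -` {x})) \<le> 0 + e" if e: "e > 0" for e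
  proof -
    have B: "- (\<alpha> -` {x}) \<in> sets borel" using cl by auto
    obtain K where K: "closed K" "K \<subseteq> - (\<alpha> -` {x})"
      "measure (transfer_measure A x) (- (\<alpha> -` {x})) < measure (transfer_measure A x) K + e"
      by (rule regular_inner[OF reg B e])
    have "compact (\<alpha> ` K)"
      by (rule compact_continuous_image[OF continuous_on_subset[OF \<alpha>] closed_imp_compact[OF K(1)]]) simp
    then have cK: "closed (\<alpha> ` K)" by (rule compact_imp_closed)
    have "open (- {x})" "\<alpha> ` K \<subseteq> - {x}" using K(2) by auto
    then obtain f :: "'a \<Rightarrow> real" where f: "cont f" "\<And>y. 0 \<le> f y" "\<And>y. f y \<le> 1"
      "\<And>y. y \<in> \<alpha> ` K \<Longrightarrow> f y = 1" "\<And>y. y \<notin> - {x} \<Longrightarrow> f y = 0" using urysohn[OF cK] by blast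
    have c: "cont (\<lambda>y. f (\<alpha> y))" using continuous_on_compose2[OF f(1) \<alpha>] by auto
    have "measure (transfer_measure A x) K \<le> (\<integral>y. f (\<alpha> y) \<partial>transfer_measure A x)"
      using f K by (intro measure_le_integral[OF reg] regular_integrable[OF reg c]) auto
    also have "\<dots> = real_part_op A (\<lambda>y. f (\<alpha> y) * 1) x" using integral_transfer_measure[OF c] by simp
    also have "\<dots> = 0" unfolding transfer_homogeneous[OF f(1) continuous_on_const] using f(5)[of x] by simp
    finally show ?thesis using K by simp
  qed
  then have "measure (transfer_measure A x) (- (\<alpha> -` {x})) \<le> 0" by (rule field_le_epsilon)
  then show ?thesis by (simp add: emeasure_eq_measure measure_le_0_iff)
qed

lemma AE_transfer_measure: "AE y in transfer_measure A x. \<alpha> y = x"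
proof (rule AE_I)
  show "{y \<in> space (transfer_measure A x). \<alpha> y \<noteq> x} \<subseteq> - (\<alpha> -` {x})" by auto
  show "emeasure (transfer_measure A x) (- (\<alpha> -` {x})) = 0" by (rule transfer_measure_fibre)
  have "closed (\<alpha> -` {x})" using closed_vimage[OF _ \<alpha>] by simp
  then show "- (\<alpha> -` {x}) \<in> sets (transfer_measure A x)"
    using regular_sets[OF regular_transfer_measure] by auto
qed

text \<open>Concentrated on the fibre and restricted to the essential set, the transfer measure is a
  finite sum of atoms; their masses are values of the cocycle because \<alpha> y = x on the
  fibre.\<close>

lemma integral_essential:
  fixes h :: "'a \<Rightarrow> 'b::{banach,second_countable_topology}"
  assumes h: "cont h" and fin: "finite (ess_preimage \<alpha> 1 x)"
  shows "(\<integral>y. indicator (essential_points \<alpha>) y *\<^sub>R h y \<partial>transfer_measure A x) =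
    (\<Sum>y\<in>ess_preimage \<alpha> 1 x. cocycle \<alpha> A y *\<^sub>R h y)"
proof -
  let ?\<nu> = "transfer_measure A x" and ?P = "ess_preimage \<alpha> 1 x"
  note reg = regular_transfer_measure[of x]
  interpret finite_measure ?\<nu> by (rule regular_finite[OF reg])
  have P: "y \<in> ?P \<longleftrightarrow> \<alpha> y = x \<and> y \<in> essential_points \<alpha>" for y by (auto simp: ess_preimage_def)
  have X: "essential_points \<alpha> \<in> sets ?\<nu>" and sg: "{y} \<in> sets ?\<nu>" for y
    using closed_essential_points regular_sets[OF reg] by auto
  have hm: "h \<in> borel_measurable ?\<nu>" by (intro cont_measurable regular_sets[OF reg] h)
  have "(\<integral>y. indicator (essential_points \<alpha>) y *\<^sub>R h y \<partial>?\<nu>) = (\<integral>y. (\<Sum>z\<in>?P. indicator {z} y *\<^sub>R h z) \<partial>?\<nu>)"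
  proof (rule integral_cong_AE)
    show "AE y in ?\<nu>. indicator (essential_points \<alpha>) y *\<^sub>R h y = (\<Sum>z\<in>?P. indicator {z} y *\<^sub>R h z)"
      using AE_transfer_measure[of x]
    proof eventually_elim
      case (elim y)
      have "(\<Sum>z\<in>?P. indicator {z} y *\<^sub>R h z) = (\<Sum>z\<in>?P. if z = y then h z else 0)"
        by (intro sum.cong) (auto simp: indicator_def)
      also have "\<dots> = (if y \<in> ?P then h y else 0)" using fin by (simp add: sum.delta)
      also have "\<dots> = indicator (essential_points \<alpha>) y *\<^sub>R h y"
        using elim unfolding P by (simp add: indicator_def)
      finally show ?case by (rule sym)
    qed
  qed (use X sg hm in \<open>auto intro!: borel_measurable_sum borel_measurable_scaleR borel_measurable_indicator\<close>)
  also have "\<dots> = (\<Sum>z\<in>?P. (\<integral>y. indicator {z} y *\<^sub>R h z \<partial>?\<nu>))"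
    using sg by (intro Bochner_Integration.integral_sum integrable_scaleR_left)
      (auto simp: integrable_real_indicator less_top[symmetric])
  also have "\<dots> = (\<Sum>y\<in>?P. cocycle \<alpha> A y *\<^sub>R h y)"
  proof (intro sum.cong refl)
    fix z assume "z \<in> ?P"
    then have z: "\<alpha> z = x" unfolding P by blast
    have "integrable ?\<nu> (\<lambda>y. indicator {z} y :: real)"
      using sg by (intro integrable_real_indicator) (auto simp: less_top[symmetric])
    then show "(\<integral>y. indicator {z} y *\<^sub>R h z \<partial>?\<nu>) = cocycle \<alpha> A z *\<^sub>R h z"
      using sg[of z] z by (subst integral_scaleR_left) (auto simp: cocycle_def)
  qed
  finally show ?thesis .
qed

section \<open>The operator weighted by g\<close>

context
  fixes g :: "'a \<Rightarrow>\<^sub>C complex"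
  assumes g: "bc_nonneg g"
begin

definition weighted :: "('a \<Rightarrow>\<^sub>C complex) \<Rightarrow> ('a \<Rightarrow>\<^sub>C complex)" where
  "weighted f = A (bc_mult g f)"

lemma g_of_real: "g x = of_real (Re (g x))" and Re_g_nonneg: "0 \<le> Re (g x)"
proof -
  obtain t where "g x = of_real t \<and> 0 \<le> t" using g unfolding bc_nonneg_def nonneg_Reals_def by blast
  then show "g x = of_real (Re (g x))" "0 \<le> Re (g x)" by auto
qed

lemma cont_Re_g: "cont (\<lambda>x. Re (g x))"
  by (intro continuous_intros) auto

lemma positive_op_weighted: "positive_op weighted"
  unfolding weighted_def[abs_def] by (rule positive_op_mult[OF positive_op_transfer g])

abbreviation W :: "('a \<Rightarrow> real) \<Rightarrow> 'a \<Rightarrow> real" where "W \<equiv> real_part_op weighted"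

lemma weighted_real:
  assumes "cont f"
  shows "W f = real_part_op A (\<lambda>y. Re (g y) * f y)"
proof -
  have "bc_real (\<lambda>y. Re (g y)) = g" by (rule bc_real_Re) (metis g_of_real Reals_of_real)
  then show ?thesis
    using real_part_op_mult[OF positive_op_transfer cont_Re_g assms] by (simp add: weighted_def[abs_def])
qed

lemma weighted_integral:
  assumes "cont f"
  shows "W f x = (\<integral>y. Re (g y) * f y \<partial>transfer_measure A x)"
  unfolding weighted_real[OF assms]
  by (rule integral_transfer_measure[symmetric]) (intro continuous_on_mult cont_Re_g assms)

lemma weighted_homogeneous:
  assumes f: "cont f" and h: "cont h"
  shows "W (\<lambda>y. f (\<alpha> y) * h y) = (\<lambda>x. f x * W h x)"
proof -
  have c: "cont (\<lambda>y. f (\<alpha> y))" using continuous_on_compose2[OF f \<alpha>] by auto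
  show ?thesis
    unfolding weighted_real[OF continuous_on_mult[OF c h]] weighted_real[OF h]
    using transfer_homogeneous[OF f continuous_on_mult[OF cont_Re_g h]]
    by (simp add: fun_eq_iff mult.left_commute)
qed

text \<open>The n-th power obeys the transfer identity for \<open>\<alpha> ^^ n\<close>.\<close>

lemma weighted_pow_homogeneous:
  assumes f: "cont f" and h: "cont h"
  shows "(W ^^ n) (\<lambda>y. f ((\<alpha> ^^ n) y) * h y) = (\<lambda>x. f x * (W ^^ n) h x)"
  using f
proof (induction n arbitrary: f)
  case (Suc n)
  have c: "cont (\<lambda>y. f (\<alpha> y))" using continuous_on_compose2[OF Suc.prems \<alpha>] by auto
  have "(W ^^ Suc n) (\<lambda>y. f ((\<alpha> ^^ Suc n) y) * h y) = W (\<lambda>x. f (\<alpha> x) * (W ^^ n) h x)"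
    using Suc.IH[OF c] by simp
  also have "\<dots> = (\<lambda>x. f x * (W ^^ Suc n) h x)"
    using weighted_homogeneous[OF Suc.prems cont_L_pow[OF positive_op_weighted h]] by simp
  finally show ?case .
qed simp

text \<open>Only the atom of the transfer measure at y is kept.\<close>

lemma weighted_lower:
  assumes f: "cont f" "\<And>x. 0 \<le> f x"
  shows "Re (g y) * cocycle \<alpha> A y * f y \<le> W f (\<alpha> y)"
proof -
  let ?\<nu> = "transfer_measure A (\<alpha> y)"
  note reg = regular_transfer_measure[of "\<alpha> y"]
  interpret finite_measure ?\<nu> by (rule regular_finite[OF reg])
  have c: "cont (\<lambda>z. Re (g z) * f z)" by (intro continuous_on_mult cont_Re_g f)
  have s: "{y} \<in> sets ?\<nu>" using regular_sets[OF reg] by simp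
  have "Re (g y) * cocycle \<alpha> A y * f y = (\<integral>z. indicator {y} z * (Re (g y) * f y) \<partial>?\<nu>)"
    using s by (simp add: cocycle_def)
  also have "\<dots> \<le> (\<integral>z. Re (g z) * f z \<partial>?\<nu>)"
  proof (rule integral_mono)
    show "integrable ?\<nu> (\<lambda>z. indicator {y} z * (Re (g y) * f y))"
      using s by (intro integrable_mult_left integrable_real_indicator) (auto simp: less_top[symmetric])
    show "indicator {y} z * (Re (g y) * f y) \<le> Re (g z) * f z" for z
      using Re_g_nonneg f(2) by (auto simp: indicator_def)
  qed (rule regular_integrable[OF reg c])
  finally show ?thesis unfolding weighted_integral[OF f(1)] .
qed

lemma weighted_pow_lower:
  "(\<Prod>k<n. Re (g ((\<alpha> ^^ k) y)) * cocycle \<alpha> A ((\<alpha> ^^ k) y)) \<le> (W ^^ n) (\<lambda>_. 1) ((\<alpha> ^^ n) y)"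
proof (induction n)
  case (Suc n)
  let ?w = "\<lambda>y. Re (g y) * cocycle \<alpha> A y"
  have w: "0 \<le> ?w y" for y using Re_g_nonneg by (simp add: cocycle_def)
  have "(\<Prod>k<Suc n. ?w ((\<alpha> ^^ k) y)) = ?w ((\<alpha> ^^ n) y) * (\<Prod>k<n. ?w ((\<alpha> ^^ k) y))"
    by (simp add: mult.commute)
  also have "\<dots> \<le> ?w ((\<alpha> ^^ n) y) * (W ^^ n) (\<lambda>_. 1) ((\<alpha> ^^ n) y)"
    by (intro mult_left_mono Suc w)
  also have "\<dots> \<le> W ((W ^^ n) (\<lambda>_. 1)) (\<alpha> ((\<alpha> ^^ n) y))"
    by (intro weighted_lower cont_L_pow[OF positive_op_weighted] L_pow_nonneg[OF positive_op_weighted]) auto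
  finally show ?case by simp
qed simp


section \<open>Integrals of logarithms\<close>

context
  fixes w :: "'a \<Rightarrow> real"
  assumes w: "cont w" "\<And>x. 0 \<le> w x"
    and w_eq: "\<And>x. x \<in> essential_points \<alpha> \<Longrightarrow> w x = Re (g x) * cocycle \<alpha> A x"
begin

text \<open>The negative part of ln w. The zeros of w need a separate case, since the real
  \<open>ln 0\<close> is a default value and not -\<infinity>.\<close>

definition log_neg :: "'a \<Rightarrow> ennreal" where
  "log_neg x = (if w x = 0 then \<infinity> else ennreal (- ln (w x)))"

lemma measurable_log_parts:
  assumes "sets \<mu> = sets borel"
  shows "(\<lambda>x. ln (w x)) \<in> borel_measurable \<mu>" "log_neg \<in> borel_measurable \<mu>"
proof -
  have wm[measurable]: "w \<in> borel_measurable \<mu>" by (rule cont_measurable[OF assms w(1)])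
  show "(\<lambda>x. ln (w x)) \<in> borel_measurable \<mu>" by measurable
  show "log_neg \<in> borel_measurable \<mu>" unfolding log_neg_def[abs_def] by measurable
qed

lemma log_integral_eq:
  assumes \<mu>: "\<mu> \<in> invariant_measures \<alpha>"
  shows "log_integral \<alpha> A g \<mu> = enn2ereal (\<integral>\<^sup>+x. ennreal (ln (w x)) \<partial>\<mu>) - enn2ereal (\<integral>\<^sup>+x. log_neg x \<partial>\<mu>)"
proof -
  have pos: "e2ennreal (elog (ennreal t)) = ennreal (ln t)" if "0 \<le> t" for t
    using that by (auto simp: elog_def e2ennreal_neg simp flip: ennreal.rep_eq)
  have neg: "e2ennreal (- elog (ennreal t)) = (if t = 0 then \<infinity> else ennreal (- ln t))" if "0 \<le> t" for t
    using that by (auto simp: elog_def)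
  have "(\<integral>\<^sup>+x\<in>essential_points \<alpha>. e2ennreal (elog (ennreal (Re (g x) * cocycle \<alpha> A x))) \<partial>\<mu>) =
      (\<integral>\<^sup>+x. ennreal (ln (w x)) \<partial>\<mu>)"
    by (rule nn_integral_cong_AE, use AE_essential_points[OF \<mu>] in eventually_elim)
      (simp add: w_eq[symmetric] pos w(2))
  moreover have "(\<integral>\<^sup>+x\<in>essential_points \<alpha>. e2ennreal (- elog (ennreal (Re (g x) * cocycle \<alpha> A x))) \<partial>\<mu>) =
      (\<integral>\<^sup>+x. log_neg x \<partial>\<mu>)"
    by (rule nn_integral_cong_AE, use AE_essential_points[OF \<mu>] in eventually_elim)
      (simp add: w_eq[symmetric] neg w(2) log_neg_def)
  ultimately show ?thesis by (simp add: log_integral_def ereal_set_integral_def)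
qed

lemma log_pos_finite:
  assumes \<mu>: "\<mu> \<in> invariant_measures \<alpha>"
  shows "(\<integral>\<^sup>+x. ennreal (ln (w x)) \<partial>\<mu>) < \<infinity>"
proof -
  interpret prob_space \<mu> by (rule invariant_measures_prob[OF \<mu>])
  obtain B where B: "B > 0" "\<And>x. norm (w x) \<le> B" using cont_bounded[OF w(1)] by blast
  have "ln (w x) \<le> B" for x
  proof (cases "w x = 0")
    case False
    then have "ln (w x) \<le> w x" using w(2)[of x] by (intro order_trans[OF ln_le_minus_one]) auto
    then show ?thesis using B(2)[of x] by simp
  qed (use B in simp)
  then have "(\<integral>\<^sup>+x. ennreal (ln (w x)) \<partial>\<mu>) \<le> (\<integral>\<^sup>+x. ennreal B \<partial>\<mu>)"
    by (intro nn_integral_mono ennreal_leI)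
  also have "\<dots> < \<infinity>" by (simp add: emeasure_space_1)
  finally show ?thesis .
qed

text \<open>The integrated orbit product gives n times the integral at most ln C + n ln l for every
  n, so the constant C disappears for large n.\<close>

lemma log_integral_le_growth_rate:
  assumes \<mu>: "\<mu> \<in> invariant_measures \<alpha>" and l: "l \<in> growth_rates W"
  shows "log_integral \<alpha> A g \<mu> \<le> ereal (ln l)"
proof (cases "(\<integral>\<^sup>+x. log_neg x \<partial>\<mu>) = \<infinity>")
  \<comment> \<open>The positive part is always finite, so the integral is -\<infinity> here; from
    now on ln w may be treated as integrable.\<close>
  case True
  then show ?thesis
    using log_pos_finite[OF \<mu>] unfolding log_integral_eq[OF \<mu>]
    by (cases "\<integral>\<^sup>+x. ennreal (ln (w x)) \<partial>\<mu>") auto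
next
  case False
  interpret prob_space \<mu> by (rule invariant_measures_prob[OF \<mu>])
  note s = regular_sets[OF invariant_measures_regular[OF \<mu>]]
  note m = measurable_log_parts[OF s]
  have pos: "AE x in \<mu>. w x \<noteq> 0"
  proof -
    have "AE x in \<mu>. log_neg x \<noteq> \<infinity>" by (rule nn_integral_PInf_AE[OF m(2) False])
    then show ?thesis by eventually_elim (auto simp: log_neg_def)
  qed
  have neg_eq: "(\<integral>\<^sup>+x. log_neg x \<partial>\<mu>) = (\<integral>\<^sup>+x. ennreal (- ln (w x)) \<partial>\<mu>)"
    by (rule nn_integral_cong_AE, use pos in eventually_elim) (simp add: log_neg_def)
  have int: "integrable \<mu> (\<lambda>x. ln (w x))"
    using m(1) log_pos_finite[OF \<mu>] False by (simp add: real_integrable_def neg_eq)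
  have I: "log_integral \<alpha> A g \<mu> = ereal (\<integral>x. ln (w x) \<partial>\<mu>)"
    unfolding log_integral_eq[OF \<mu>] real_lebesgue_integral_def[OF int] neg_eq[symmetric]
    using log_pos_finite[OF \<mu>] False
    by (cases "\<integral>\<^sup>+x. ennreal (ln (w x)) \<partial>\<mu>"; cases "\<integral>\<^sup>+x. log_neg x \<partial>\<mu>") (auto simp: neg_eq[symmetric])
  obtain C where l0: "0 < l" and C: "\<And>n x. (W ^^ n) (\<lambda>_. 1) x \<le> C * l ^ n"
    using l by (auto simp: growth_rates_def)
  have C0: "0 < C" using C[of 0 undefined] by simp
  have iter: "distr \<mu> borel (\<alpha> ^^ k) = \<mu>" for k
  proof (induction k)
    case 0
    have "distr \<mu> borel id = distr \<mu> \<mu> id" by (rule distr_cong) (auto simp: s)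
    then show ?case using distr_id[of \<mu>] by (simp add: id_def)
  next
    case (Suc k)
    have "distr \<mu> borel (\<alpha> ^^ Suc k) = distr (distr \<mu> borel (\<alpha> ^^ k)) borel \<alpha>"
      using \<alpha> cont_funpow s by (subst distr_distr) (auto intro!: cont_measurable borel_measurable_continuous_onI)
    then show ?case using Suc invariant_measures_distr[OF \<mu> \<alpha>] by (simp add: o_def)
  qed
  have fm: "\<alpha> ^^ k \<in> measurable \<mu> borel" for k by (intro cont_measurable s cont_funpow)
  have lm: "(\<lambda>x. ln (w x)) \<in> borel_measurable borel"
    using m(1) s measurable_cong_sets by blast
  have int_k: "integrable \<mu> (\<lambda>x. ln (w ((\<alpha> ^^ k) x)))"
    and eq_k: "(\<integral>x. ln (w ((\<alpha> ^^ k) x)) \<partial>\<mu>) = (\<integral>x. ln (w x) \<partial>\<mu>)" for k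
    using integrable_distr_eq[OF fm lm, of k] integral_distr[OF fm lm, of k] int iter[of k] by simp_all
  \<comment> \<open>Almost every orbit avoids the zeros of w and stays where w is g \<rho>, so the
    logarithm of the orbit product splits into a sum.\<close>
  have AE_k: "AE x in \<mu>. w ((\<alpha> ^^ k) x) \<noteq> 0 \<and> (\<alpha> ^^ k) x \<in> essential_points \<alpha>" for k
  proof -
    have "AE x in distr \<mu> borel (\<alpha> ^^ k). w x \<noteq> 0 \<and> x \<in> essential_points \<alpha>"
      unfolding iter using pos AE_essential_points[OF \<mu>] by eventually_elim simp
    then show ?thesis by (rule AE_distrD[OF fm])
  qed
  have bound: "real n * (\<integral>x. ln (w x) \<partial>\<mu>) \<le> ln C + real n * ln l" for n
  proof -
    have "real n * (\<integral>x. ln (w x) \<partial>\<mu>) = (\<integral>x. (\<Sum>k<n. ln (w ((\<alpha> ^^ k) x))) \<partial>\<mu>)"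
      by (simp add: Bochner_Integration.integral_sum[OF int_k] eq_k)
    also have "\<dots> \<le> (\<integral>x. ln C + real n * ln l \<partial>\<mu>)"
    proof (rule integral_mono_AE)
      show "integrable \<mu> (\<lambda>x. \<Sum>k<n. ln (w ((\<alpha> ^^ k) x)))"
        by (intro Bochner_Integration.integrable_sum int_k)
      have "AE x in \<mu>. \<forall>k<n. w ((\<alpha> ^^ k) x) \<noteq> 0 \<and> (\<alpha> ^^ k) x \<in> essential_points \<alpha>"
        using AE_k by (simp add: AE_all_countable)
      then show "AE x in \<mu>. (\<Sum>k<n. ln (w ((\<alpha> ^^ k) x))) \<le> ln C + real n * ln l"
      proof eventually_elim
        case (elim x)
        have p: "0 < w ((\<alpha> ^^ k) x)" if "k < n" for k
          using elim that w(2)[of "(\<alpha> ^^ k) x"] by (simp add: less_le)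
        have "(\<Prod>k<n. w ((\<alpha> ^^ k) x)) =
            (\<Prod>k<n. Re (g ((\<alpha> ^^ k) x)) * cocycle \<alpha> A ((\<alpha> ^^ k) x))"
          using elim by (intro prod.cong refl w_eq) auto
        also have "\<dots> \<le> C * l ^ n" using weighted_pow_lower C order_trans by blast
        finally have "ln (\<Prod>k<n. w ((\<alpha> ^^ k) x)) \<le> ln (C * l ^ n)"
          using p C0 l0 by (subst ln_le_cancel_iff) (auto intro!: prod_pos)
        moreover have "ln (\<Prod>k<n. w ((\<alpha> ^^ k) x)) = (\<Sum>k<n. ln (w ((\<alpha> ^^ k) x)))"
          by (intro ln_prod) (auto, metis p order_less_irrefl)
        moreover have "ln (C * l ^ n) = ln C + real n * ln l"
          using C0 l0 by (simp add: ln_mult ln_realpow)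
        ultimately show ?case by simp
      qed
    qed simp
    finally show ?thesis by (simp add: prob_space)
  qed
  have "(\<integral>x. ln (w x) \<partial>\<mu>) \<le> ln l"
  proof (rule ccontr)
    assume "\<not> ?thesis"
    then have d: "0 < (\<integral>x. ln (w x) \<partial>\<mu>) - ln l" by simp
    obtain n where "ln C < real n * ((\<integral>x. ln (w x) \<partial>\<mu>) - ln l)" using reals_Archimedean3[OF d] by blast
    then show False using bound[of n] by (simp add: right_diff_distrib)
  qed
  then show ?thesis unfolding I by simp
qed

definition truncated_log :: "nat \<Rightarrow> 'a \<Rightarrow> real" where
  "truncated_log j x = ln (max (w x) (exp (- real j)))"

lemma cont_truncated_log: "cont (truncated_log j)"
  unfolding truncated_log_def[abs_def]
  by (intro continuous_on_ln continuous_on_max w continuous_on_const) (metis exp_gt_zero less_max_iff_disj order_less_irrefl)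

lemma truncated_log_decreasing: "i \<le> j \<Longrightarrow> truncated_log j x \<le> truncated_log i x"
  unfolding truncated_log_def by (intro ln_mono max.mono) (auto simp: less_max_iff_disj)

lemma w_le_exp_truncated_log: "w x \<le> exp (truncated_log j x)"
proof -
  have "0 < max (w x) (exp (- real j))" by (simp add: less_max_iff_disj)
  then show ?thesis unfolding truncated_log_def by simp
qed

text \<open>At a zero of w the truncation is - j, which is unbounded below; elsewhere it eventually
  equals ln w.\<close>

lemma SUP_truncated_log: "(SUP j. ennreal (- truncated_log j x)) = log_neg x"
proof (cases "w x = 0")
  case True
  have "(SUP j. ennreal (- truncated_log j x)) = (SUP j. of_nat j)"
    using True by (simp add: truncated_log_def ennreal_of_nat_eq_real_of_nat)
  then show ?thesis using True by (simp add: log_neg_def ennreal_SUP_of_nat_eq_top)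
next
  case False
  then have w0: "0 < w x" using w(2)[of x] by simp
  obtain j :: nat where j: "- ln (w x) \<le> real j" using real_arch_simple by blast
  have "exp (- real j) \<le> exp (ln (w x))" using j by simp
  then have eq: "truncated_log j x = ln (w x)" using w0 by (simp add: truncated_log_def max_def)
  have le: "- truncated_log i x \<le> - ln (w x)" for i
    unfolding truncated_log_def using w0 by simp
  show ?thesis
  proof (rule antisym)
    show "(SUP j. ennreal (- truncated_log j x)) \<le> log_neg x"
      using False le by (intro SUP_least) (simp add: log_neg_def ennreal_leI)
    show "log_neg x \<le> (SUP j. ennreal (- truncated_log j x))"
      using False eq by (intro SUP_upper2[of j]) (auto simp: log_neg_def)
  qed
qed

text \<open>The truncation levels - j are at most 0, so positive parts are unchanged.\<close>

lemma truncated_log_pos: "ennreal (truncated_log j x) = ennreal (ln (w x))"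
proof (cases "exp (- real j) \<le> w x")
  case False
  then have "truncated_log j x = - real j" by (simp add: truncated_log_def max_def)
  moreover have "ln (w x) \<le> 0"
  proof (cases "w x = 0")
    case False
    have "exp (- real j) \<le> 1" by simp
    then have "w x \<le> 1" using \<open>\<not> exp (- real j) \<le> w x\<close> by linarith
    then show ?thesis using False w(2)[of x] by (simp add: less_le)
  qed simp
  ultimately show ?thesis by (simp add: ennreal_neg)
qed (simp add: truncated_log_def max_def)

text \<open>The positive part P is common to all truncations, so the negative parts have integrals
  at most P - b, and monotone convergence passes this to the limit.\<close>

lemma log_integral_ge:
  assumes \<mu>: "\<mu> \<in> invariant_measures \<alpha>" and b: "\<And>j. b \<le> (\<integral>x. truncated_log j x \<partial>\<mu>)"
  shows "ereal b \<le> log_integral \<alpha> A g \<mu>"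
proof -
  note reg = invariant_measures_regular[OF \<mu>]
  define P where "P = enn2real (\<integral>\<^sup>+x. ennreal (ln (w x)) \<partial>\<mu>)"
  have P: "(\<integral>\<^sup>+x. ennreal (ln (w x)) \<partial>\<mu>) = ennreal P" "0 \<le> P"
    using log_pos_finite[OF \<mu>] by (auto simp: P_def less_top)
  have "(\<integral>\<^sup>+x. ennreal (- truncated_log j x) \<partial>\<mu>) \<le> ennreal (P - b)" for j
  proof -
    have int: "integrable \<mu> (truncated_log j)" by (rule regular_integrable[OF reg cont_truncated_log])
    have fin: "(\<integral>\<^sup>+x. ennreal (- truncated_log j x) \<partial>\<mu>) < \<infinity>"
      using int by (simp add: real_integrable_def less_top)
    have "b \<le> P - enn2real (\<integral>\<^sup>+x. ennreal (- truncated_log j x) \<partial>\<mu>)"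
      using b[of j] real_lebesgue_integral_def[OF int] by (simp add: truncated_log_pos P_def)
    then have "enn2real (\<integral>\<^sup>+x. ennreal (- truncated_log j x) \<partial>\<mu>) \<le> P - b" by simp
    then have "ennreal (enn2real (\<integral>\<^sup>+x. ennreal (- truncated_log j x) \<partial>\<mu>)) \<le> ennreal (P - b)"
      by (rule ennreal_leI)
    then show ?thesis using fin by (simp add: less_top)
  qed note le = this
  have "(\<integral>\<^sup>+x. log_neg x \<partial>\<mu>) = (\<integral>\<^sup>+x. (SUP j. ennreal (- truncated_log j x)) \<partial>\<mu>)"
    by (simp add: SUP_truncated_log)
  also have "\<dots> = (SUP j. \<integral>\<^sup>+x. ennreal (- truncated_log j x) \<partial>\<mu>)"
  proof (rule nn_integral_monotone_convergence_SUP)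
    show "incseq (\<lambda>j x. ennreal (- truncated_log j x))"
      by (auto simp: incseq_def le_fun_def intro!: ennreal_leI truncated_log_decreasing)
    show "(\<lambda>x. ennreal (- truncated_log j x)) \<in> borel_measurable \<mu>" for j
      using cont_measurable[OF regular_sets[OF reg] cont_truncated_log, of j] by measurable
  qed
  also have "\<dots> \<le> ennreal (P - b)" by (intro SUP_least le)
  finally have N: "(\<integral>\<^sup>+x. log_neg x \<partial>\<mu>) \<le> ennreal (P - b)" .
  \<comment> \<open>\<open>ennreal\<close> would clip a negative P - b to 0, so its sign must be
    known before returning to extended reals.\<close>
  have Pb: "0 \<le> P - b"
  proof -
    interpret prob_space \<mu> by (rule invariant_measures_prob[OF \<mu>])
    have int: "integrable \<mu> (truncated_log 0)" by (rule regular_integrable[OF reg cont_truncated_log])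
    show ?thesis
      using b[of 0] real_lebesgue_integral_def[OF int] by (simp add: truncated_log_pos P_def)
        (smt (verit) enn2real_nonneg)
  qed
  show ?thesis
    unfolding log_integral_eq[OF \<mu>] P(1)
    using N Pb P(2) by (cases "\<integral>\<^sup>+x. log_neg x \<partial>\<mu>") (auto simp: ennreal_le_iff top_unique)
qed

section \<open>The upper bound for the growth rate\<close>

context
  fixes q :: "'a \<Rightarrow> real"
  assumes q: "cont q" "\<And>x. w x \<le> exp (q x)"
    and fin_essential: "\<And>x. x \<in> essential_points \<alpha> \<Longrightarrow> finite (ess_preimage \<alpha> 1 x)"
begin

text \<open>The operator V of the overview, with p left as a parameter because it is chosen in terms
  of the iterate.\<close>

definition damped_op :: "('a \<Rightarrow> real) \<Rightarrow> ('a \<Rightarrow>\<^sub>C complex) \<Rightarrow> ('a \<Rightarrow>\<^sub>C complex)" where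
  "damped_op p f = weighted (bc_mult (bc_real (\<lambda>y. exp (- (q y + p y)))) f)"

abbreviation damped :: "('a \<Rightarrow> real) \<Rightarrow> ('a \<Rightarrow> real) \<Rightarrow> 'a \<Rightarrow> real" where
  "damped p \<equiv> real_part_op (damped_op p)"

lemma cont_damping: "cont p \<Longrightarrow> cont (\<lambda>y. exp (- (q y + p y)))"
  by (intro continuous_intros q)

lemma positive_op_damped:
  assumes "cont p"
  shows "positive_op (damped_op p)"
  unfolding damped_op_def[abs_def]
  by (rule positive_op_mult[OF positive_op_weighted iffD2[OF bc_nonneg_bc_real[OF cont_damping[OF assms]]]]) simp

lemma damped_apply:
  assumes "cont p" "cont f"
  shows "damped p f = W (\<lambda>y. exp (- (q y + p y)) * f y)"
  unfolding damped_op_def[abs_def]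
  by (rule real_part_op_mult[OF positive_op_weighted cont_damping[OF assms(1)] assms(2)])

lemma cont_damped_pow: "cont p \<Longrightarrow> cont ((damped p ^^ n) (\<lambda>_. 1))"
  by (rule cont_L_pow[OF positive_op_damped]) auto

lemma damped_pow_nonneg: "cont p \<Longrightarrow> 0 \<le> (damped p ^^ n) (\<lambda>_. 1) x"
  by (rule L_pow_nonneg[OF positive_op_damped]) auto

lemma damped_mono:
  assumes c: "cont p" "cont p'" "cont f" "cont f'" and p: "\<And>x. p x \<le> p' x"
    and f: "\<And>x. 0 \<le> f' x" "\<And>x. f' x \<le> f x"
  shows "damped p' f' x \<le> damped p f x"
  unfolding damped_apply[OF c(1,3)] damped_apply[OF c(2,4)]
  using p f by (intro L_mono[OF positive_op_weighted] continuous_on_mult cont_damping c mult_mono) auto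

lemma damped_pow_mono:
  assumes c: "cont p" "cont p'" and p: "\<And>x. p x \<le> p' x"
  shows "(damped p' ^^ n) (\<lambda>_. 1) x \<le> (damped p ^^ n) (\<lambda>_. 1) x"
proof (induction n arbitrary: x)
  case (Suc n)
  show ?case
    by (simp, intro damped_mono c cont_damped_pow p damped_pow_nonneg Suc)
qed simp

text \<open>By the transfer identity for n-th iterates, the weight of each new step moves inside W^n
  as a weight at the n-th point of the orbit; the weights then add up to a Birkhoff sum.\<close>

lemma damped_pow_eq:
  assumes p: "cont p"
  shows "(damped p ^^ n) (\<lambda>_. 1) = (W ^^ n) (\<lambda>y. exp (- birkhoff_sum \<alpha> (\<lambda>z. q z + p z) n y))"
proof (induction n)
  case 0
  show ?case by (simp add: birkhoff_sum_def)
next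
  case (Suc n)
  let ?E = "\<lambda>n y. exp (- birkhoff_sum \<alpha> (\<lambda>z. q z + p z) n y)"
  have cE: "cont (?E n)" for n
    unfolding birkhoff_sum_def using p q(1)
    by (intro continuous_intros continuous_on_compose2[OF _ cont_funpow]) auto
  have split: "?E (Suc n) = (\<lambda>y. exp (- (q ((\<alpha> ^^ n) y) + p ((\<alpha> ^^ n) y))) * ?E n y)"
    by (simp add: birkhoff_sum_def exp_add[symmetric] fun_eq_iff)
  have "(damped p ^^ Suc n) (\<lambda>_. 1) = W (\<lambda>x. exp (- (q x + p x)) * (W ^^ n) (?E n) x)"
    using damped_apply[OF p cont_L_pow[OF positive_op_weighted cE]] Suc by simp
  also have "(\<lambda>x. exp (- (q x + p x)) * (W ^^ n) (?E n) x) = (W ^^ n) (?E (Suc n))"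
    unfolding split by (rule weighted_pow_homogeneous[OF cont_damping[OF p] cE, symmetric])
  finally show ?case by simp
qed

text \<open>One application of the operator integrates the previous iterate over the transfer
  measure at x. Its essential part is the sum over essential preimages with weights at most 1, and
  the rest is made small by enlarging p. The hypothesis concerns essential points only, while x is
  arbitrary.\<close>

lemma damped_step:
  assumes IH: "\<And>y e. y \<in> essential_points \<alpha> \<Longrightarrow> 0 < e \<Longrightarrow>
      \<exists>p\<in>corrections. (damped p ^^ n) (\<lambda>_. 1) y \<le> real (card (ess_preimage \<alpha> n y)) + e"
    and e: "0 < e"
  shows "\<exists>p\<in>corrections. (damped p ^^ Suc n) (\<lambda>_. 1) x \<le> real (card (ess_preimage \<alpha> (Suc n) x)) + e"
proof -
  let ?P = "ess_preimage \<alpha> 1 x" and ?\<nu> = "transfer_measure A x" and ?X = "essential_points \<alpha>"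
  have finP: "finite ?P" by (rule finite_fibre[OF fin_essential])
  note reg = regular_transfer_measure[of x]
  interpret finite_measure ?\<nu> by (rule regular_finite[OF reg])
  \<comment> \<open>The error budget e is shared by the preimages, d each, and by two further errors
    d: one near the essential set, one away from it.\<close>
  define d where "d = e / (real (card ?P) + 2)"
  have k: "0 < real (card ?P) + 2" by (simp add: add_nonneg_pos)
  then have kd: "(real (card ?P) + 2) * d = e" by (simp only: d_def) simp
  have d: "0 < d" "real (card ?P) * d + 2 * d = e"
    using divide_pos_pos[OF e k] kd by (simp_all only: d_def distrib_right)
  have "\<exists>p. p \<in> corrections \<and> (damped p ^^ n) (\<lambda>_. 1) y \<le> real (card (ess_preimage \<alpha> n y)) + d"
    if "y \<in> ?P" for y
  proof -
    have "y \<in> ?X" using that by (simp add: ess_preimage_def)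
    then show ?thesis using IH[OF _ d(1)] by blast
  qed
  then obtain p\<^sub>y where py: "\<And>y. y \<in> ?P \<Longrightarrow> p\<^sub>y y \<in> corrections"
    "\<And>y. y \<in> ?P \<Longrightarrow> (damped (p\<^sub>y y) ^^ n) (\<lambda>_. 1) y \<le> real (card (ess_preimage \<alpha> n y)) + d"
    by metis
  define p\<^sub>0 where "p\<^sub>0 = (\<lambda>z. \<Sum>y\<in>?P. p\<^sub>y y z)"
  have p0: "p\<^sub>0 \<in> corrections" unfolding p\<^sub>0_def by (rule corrections_sum[OF finP py(1)])
  have cp0: "cont p\<^sub>0" and p0_nonneg: "\<And>z. 0 \<le> p\<^sub>0 z" and p0_X: "\<And>z. z \<in> ?X \<Longrightarrow> p\<^sub>0 z = 0"
    using p0 by (auto simp: corrections_def)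
  define F where "F = (damped p\<^sub>0 ^^ n) (\<lambda>_. 1)"
  have cF: "cont F" unfolding F_def by (rule cont_damped_pow[OF cp0])
  have F0: "0 \<le> F z" for z unfolding F_def by (rule damped_pow_nonneg[OF cp0])
  \<comment> \<open>The iterates decrease when the correction grows, so the sum of the finitely many
    corrections serves all preimages at once.\<close>
  have F_le: "F y \<le> real (card (ess_preimage \<alpha> n y)) + d" if y: "y \<in> ?P" for y
  proof -
    have "p\<^sub>y y z \<le> p\<^sub>0 z" for z
      unfolding p\<^sub>0_def using y finP py(1)
      by (intro member_le_sum[of y ?P "\<lambda>y. p\<^sub>y y z"]) (auto simp: corrections_def)
    then have "F y \<le> (damped (p\<^sub>y y) ^^ n) (\<lambda>_. 1) y"
      unfolding F_def using py(1)[OF y] cp0 by (intro damped_pow_mono) (auto simp: corrections_def)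
    then show ?thesis using py(2)[OF y] by simp
  qed
  define G where "G z = Re (g z) * (exp (- q z) * F z)" for z
  have cG: "cont G" unfolding G_def[abs_def] by (intro continuous_intros q cF) auto
  have G0: "0 \<le> G z" for z unfolding G_def using Re_g_nonneg F0 by simp
  obtain B where B: "B > 0" "\<And>z. norm (G z) \<le> B" using cont_bounded[OF cG] by blast
  have GB: "G z \<le> B" for z using B(2)[of z] by simp
  have X: "?X \<in> sets borel" using closed_essential_points by simp
  have dB: "0 < d / B" using d B by simp
  obtain U where U: "open U" "?X \<subseteq> U" "measure ?\<nu> U < measure ?\<nu> ?X + d / B"
    by (rule regular_outer[OF reg X dB])
  have "closed (- U)" "open (- ?X)" "- U \<subseteq> - ?X" using U closed_essential_points by auto
  then obtain u :: "'a \<Rightarrow> real" where u: "cont u" "\<And>z. 0 \<le> u z" "\<And>z. u z \<le> 1"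
    "\<And>z. z \<in> - U \<Longrightarrow> u z = 1" "\<And>z. z \<notin> - ?X \<Longrightarrow> u z = 0"
    using urysohn[of "- U" "- ?X"] by blast
  define M where "M = measure ?\<nu> UNIV"
  have M: "0 \<le> M" by (simp add: M_def)
  \<comment> \<open>Large enough for B exp (- t) M \<le> d. \<open>M + 1\<close> keeps the logarithm
    meaningful when the transfer measure is 0, and the maximum with 0 keeps the correction
    nonnegative.\<close>
  define t where "t = max 0 (ln (B * (M + 1) / d))"
  have t0: "0 \<le> t" by (simp add: t_def)
  have "B * exp (- t) * M \<le> d"
  proof -
    have pos: "0 < B * (M + 1) / d" using B M d by simp
    have "B * (M + 1) / d \<le> exp t"
      using exp_le_cancel_iff[of "ln (B * (M + 1) / d)" t] pos by (simp add: t_def)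
    then have "B * (M + 1) * exp (- t) \<le> d" using d by (simp add: exp_minus field_simps)
    moreover have "B * exp (- t) * M \<le> B * exp (- t) * (M + 1)" using B by (intro mult_left_mono) auto
    ultimately show ?thesis by (simp add: mult_ac)
  qed note tail = this
  define p where "p = (\<lambda>z. p\<^sub>0 z + t * u z)"
  have cp: "cont p" unfolding p_def by (intro continuous_intros cp0 u)
  have p: "p \<in> corrections"
    using cp p0_nonneg p0_X u t0 unfolding corrections_def p_def by auto
  have p0p: "p\<^sub>0 z \<le> p z" for z using u(2)[of z] t0 by (simp add: p_def)
  have sets: "?X \<in> sets ?\<nu>" "U \<in> sets ?\<nu>" using X U regular_sets[OF reg] by auto
  have intG: "integrable ?\<nu> (\<lambda>z. indicator ?X z * G z)"
    using integrable_mult_indicator[OF sets(1) regular_integrable[OF reg cG]] by simp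
  have intU: "integrable ?\<nu> (\<lambda>z. B * indicator (U - ?X) z)"
    using sets by (intro integrable_mult_right integrable_real_indicator) (auto simp: less_top[symmetric])
  have cd: "cont (\<lambda>y. exp (- (q y + p y)) * F y)" by (intro continuous_intros q cp cF)
  have "(damped p ^^ Suc n) (\<lambda>_. 1) x \<le> damped p F x"
    unfolding F_def
    by (simp, intro L_mono[OF positive_op_damped[OF cp]] cont_damped_pow cp cp0 damped_pow_mono p0p)
  also have "\<dots> = (\<integral>z. Re (g z) * (exp (- (q z + p z)) * F z) \<partial>?\<nu>)"
    unfolding damped_apply[OF cp cF] by (rule weighted_integral[OF cd])
  \<comment> \<open>Three regions: the essential set, where G is kept; U minus the essential set,
    where G is at most B but the measure is below d / B; and the outside of U, where u = 1 and hence
    p \<ge> t.\<close>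
  also have "\<dots> \<le> (\<integral>z. indicator ?X z * G z + B * indicator (U - ?X) z + B * exp (- t) \<partial>?\<nu>)"
  proof (rule integral_mono)
    show "integrable ?\<nu> (\<lambda>z. Re (g z) * (exp (- (q z + p z)) * F z))"
      by (intro regular_integrable[OF reg] continuous_on_mult cont_Re_g continuous_intros q cp cF)
    show "integrable ?\<nu> (\<lambda>z. indicator ?X z * G z + B * indicator (U - ?X) z + B * exp (- t))"
      using intG intU by auto
    fix z
    have eq: "Re (g z) * (exp (- (q z + p z)) * F z) = exp (- p z) * G z"
    proof -
      have "exp (- (q z + p z)) = exp (- p z) * exp (- q z)"
        unfolding exp_add[symmetric] by simp
      then show ?thesis by (simp add: G_def)
    qed
    have Gz: "exp (- p z) * G z \<le> 1 * G z"
      using p0_nonneg[of z] p0p[of z] G0 by (intro mult_right_mono) auto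
    have Bt: "0 \<le> B * exp (- t)" using B by simp
    show "Re (g z) * (exp (- (q z + p z)) * F z) \<le>
        indicator ?X z * G z + B * indicator (U - ?X) z + B * exp (- t)"
    proof (cases "z \<in> U")
      case True
      then show ?thesis unfolding eq using Gz GB[of z] Bt U(2) by (auto simp: indicator_def)
    next
      case False
      then have "p z \<ge> t" using u(4)[of z] p0_nonneg[of z] by (simp add: p_def)
      then have "exp (- p z) * G z \<le> exp (- t) * B" using GB G0 by (intro mult_mono) auto
      then show ?thesis unfolding eq using False U(2) by (auto simp: indicator_def mult.commute)
    qed
  qed
  also have "\<dots> = (\<integral>z. indicator ?X z * G z \<partial>?\<nu>) + B * measure ?\<nu> (U - ?X) + B * exp (- t) * M"
  proof -
    have "(\<integral>z. indicator (U - ?X) z \<partial>?\<nu>) = measure ?\<nu> (U - ?X)" using sets by simp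
    then show ?thesis using intG intU regular_space[OF reg] by (simp add: M_def)
  qed
  also have "\<dots> \<le> (\<integral>z. indicator ?X z * G z \<partial>?\<nu>) + d + d"
  proof -
    have "measure ?\<nu> (U - ?X) = measure ?\<nu> U - measure ?\<nu> ?X"
      using sets U(2) by (intro finite_measure_Diff)
    then have "B * measure ?\<nu> (U - ?X) \<le> B * (d / B)" using U(3) B by (intro mult_left_mono) auto
    then show ?thesis using B tail by simp
  qed
  also have "(\<integral>z. indicator ?X z * G z \<partial>?\<nu>) = (\<Sum>y\<in>?P. cocycle \<alpha> A y * G y)"
    using integral_essential[OF cG finP] by simp
  also have "(\<Sum>y\<in>?P. cocycle \<alpha> A y * G y) \<le> (\<Sum>y\<in>?P. real (card (ess_preimage \<alpha> n y)) + d)"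
  proof (rule sum_mono)
    fix y assume y: "y \<in> ?P"
    then have "w y = Re (g y) * cocycle \<alpha> A y" by (intro w_eq) (simp add: ess_preimage_def)
    then have "cocycle \<alpha> A y * G y = (w y * exp (- q y)) * F y" by (simp add: G_def mult_ac)
    also have "\<dots> \<le> 1 * F y"
      \<comment> \<open>This is where e^q must dominate g \<rho>: each preimage then has weight at
        most 1.\<close>
      using q(2)[of y] F0 by (intro mult_right_mono) (auto simp: exp_minus field_simps)
    finally show "cocycle \<alpha> A y * G y \<le> real (card (ess_preimage \<alpha> n y)) + d" using F_le[OF y] by simp
  qed
  also have "(\<Sum>y\<in>?P. real (card (ess_preimage \<alpha> n y)) + d) + d + d = real (card (ess_preimage \<alpha> (Suc n) x)) + e"
    using d(2) card_ess_preimage_Suc[of n x] fin_essential by (simp add: sum.distrib del: One_nat_def)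
  finally show ?thesis using p by auto
qed

lemma damped_pointwise:
  assumes "y \<in> essential_points \<alpha>" "0 < e"
  shows "\<exists>p\<in>corrections. (damped p ^^ n) (\<lambda>_. 1) y \<le> real (card (ess_preimage \<alpha> n y)) + e"
  using assms
proof (induction n arbitrary: y e)
  case 0
  then have "ess_preimage \<alpha> 0 y = {y}" by (auto simp: ess_preimage_def)
  moreover have "(\<lambda>_. 0) \<in> corrections" by (simp add: corrections_def)
  ultimately show ?case using 0 by (intro bexI[of _ "\<lambda>_. 0"]) auto
next
  case (Suc n)
  show ?case by (rule damped_step[OF Suc.IH Suc.prems(2)])
qed

text \<open>Dini's argument: the pointwise bounds are made uniform by compactness, since the iterates decrease
  when the correction grows.\<close>

lemma damped_uniform:
  assumes D: "\<And>x. real (card (ess_preimage \<alpha> (Suc n) x)) \<le> D"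
  obtains p where "p \<in> corrections" "\<And>x. (damped p ^^ Suc n) (\<lambda>_. 1) x \<le> D + 1"
proof -
  let ?V = "\<lambda>p. (damped p ^^ Suc n) (\<lambda>_. 1)"
  have "\<exists>p. p \<in> corrections \<and> ?V p x < D + 1" for x
  proof -
    obtain p where "p \<in> corrections" "?V p x \<le> real (card (ess_preimage \<alpha> (Suc n) x)) + 1/2"
      \<comment> \<open>The pointwise bound is known at essential points only; one more step extends
        it to every x, which explains the index \<open>Suc n\<close>.\<close>
      using damped_step[OF damped_pointwise, of "1/2" n x] by auto
    then show ?thesis using D[of x] by (intro exI[of _ p]) auto
  qed
  then obtain p where p: "\<And>x. p x \<in> corrections" "\<And>x. ?V (p x) x < D + 1" by metis
  have cp: "cont (p x)" and pn: "0 \<le> p x z" for x z using p(1)[of x] by (auto simp: corrections_def)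
  have op: "open {z. ?V (p x) z < D + 1}" for x
    by (intro open_Collect_less cont_damped_pow cp continuous_on_const)
  have cover: "UNIV \<subseteq> (\<Union>x\<in>UNIV. {z. ?V (p x) z < D + 1})" using p(2) by blast
  obtain C where C: "C \<subseteq> UNIV" "finite C" "UNIV \<subseteq> (\<Union>x\<in>C. {z. ?V (p x) z < D + 1})"
    by (rule compactE_image[OF compact_UNIV op cover])
  define r where "r = (\<lambda>z. \<Sum>x\<in>C. p x z)"
  have r: "r \<in> corrections" unfolding r_def by (rule corrections_sum[OF C(2) p(1)])
  have "?V r z \<le> D + 1" for z
  proof -
    obtain x where x: "x \<in> C" "?V (p x) z < D + 1" using C(3) by blast
    have "p x y \<le> r y" for y
      unfolding r_def using x C(2) pn by (intro member_le_sum[of x C "\<lambda>x. p x y"]) auto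
    then have "?V r z \<le> ?V (p x) z" using r cp by (intro damped_pow_mono) (auto simp: corrections_def)
    then show ?thesis using x by simp
  qed
  then show thesis using that r by blast
qed

lemma growth_rate_upper:
  assumes rami: "inverse_rami_rate \<alpha> = 0"
    and less: "\<And>\<phi>. \<phi> \<in> invariant_states \<alpha> \<Longrightarrow> \<phi> q < b" and b: "b < b'"
  shows "exp b' \<in> growth_rates W"
proof -
  \<comment> \<open>The count is at most D = exp (n e), and D + 1 \<le> D * D = exp (2 n e); the
    factor 2 uses up the gap between b and b'.\<close>
  define e where "e = (b' - b) / 2"
  have e: "0 < e" using b by (simp add: e_def)
  obtain N where N: "\<And>n x. N \<le> n \<Longrightarrow> real (card (ess_preimage \<alpha> n x)) \<le> exp (real n * e)"
    using card_ess_preimage_subexponential[OF fin_essential rami e] by metis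
  \<comment> \<open>This makes n e > 1, hence D \<ge> 2, so that the extra 1 of the uniform bound
    can be absorbed in D * D.\<close>
  obtain m :: nat where m: "1 < real m * e" using reals_Archimedean3[OF e] by blast
  define n' where "n' = max N m"
  define n where "n = Suc n'"
  define D where "D = exp (real n * e)"
  have D: "2 \<le> D"
  proof -
    have "real m * e \<le> real n * e" using e by (intro mult_right_mono) (auto simp: n_def n'_def)
    then show ?thesis using m exp_ge_add_one_self[of "real n * e"] unfolding D_def by linarith
  qed
  have cardD: "real (card (ess_preimage \<alpha> (Suc n') x)) \<le> D" for x
    unfolding D_def n_def by (rule N) (simp add: n'_def)
  obtain p where p: "p \<in> corrections" and V: "\<And>x. (damped p ^^ n) (\<lambda>_. 1) x \<le> D + 1"
    using damped_uniform[OF cardD, folded n_def] by metis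
  have cp: "cont p" and pX: "\<And>x. x \<in> essential_points \<alpha> \<Longrightarrow> p x = 0"
    using p by (auto simp: corrections_def)
  have "2 * D \<le> D * D" using D by (intro mult_right_mono) auto
  then have "D + 1 \<le> D * D" using D by linarith
  then have VD: "(damped p ^^ n) (\<lambda>_. 1) x \<le> D * D" for x using V[of x] by simp
  have cqp: "cont (\<lambda>x. q x + p x)" by (intro continuous_intros q cp)
  have "\<phi> (\<lambda>x. q x + p x) < b" if \<phi>: "\<phi> \<in> invariant_states \<alpha>" for \<phi>
  proof -
    have "pos_functional \<phi>" using \<phi> by (simp add: invariant_states_def states_def)
    then have "\<phi> (\<lambda>x. q x + p x) = \<phi> q + \<phi> p" by (rule pos_functional_add[OF _ q(1) cp])
    then show ?thesis using less[OF \<phi>] invariant_state_vanishing[OF \<phi> cp pX] by simp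
  qed
  then obtain k where k: "\<And>n y. k \<le> n \<Longrightarrow> birkhoff_sum \<alpha> (\<lambda>x. q x + p x) n y \<le> real n * b"
    using birkhoff_sum_bound[OF \<alpha> cqp, of b] by metis
  \<comment> \<open>A multiple of n, so that the bound for the n-th power of V can be iterated, and
    at least k, so that the Birkhoff sums are controlled.\<close>
  define r where "r = n * Suc k"
  have r: "k \<le> r" "0 < r" by (simp_all add: r_def n_def)
  have "(W ^^ r) (\<lambda>_. 1) x \<le> exp b' ^ r" for x
  proof -
    let ?E = "\<lambda>y. exp (- birkhoff_sum \<alpha> (\<lambda>z. q z + p z) r y)"
    have cE: "cont ?E"
      unfolding birkhoff_sum_def using cp q(1)
      by (intro continuous_intros continuous_on_compose2[OF _ cont_funpow]) auto
    \<comment> \<open>The Birkhoff bound at time r says precisely that 1 is at most the function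
      inserted here.\<close>
    have "(W ^^ r) (\<lambda>_. 1) x \<le> (W ^^ r) (\<lambda>y. exp (real r * b) * ?E y) x"
      using k[OF r(1)]
      by (intro L_pow_mono[OF positive_op_weighted] continuous_on_const continuous_on_mult cE)
        (simp add: exp_add[symmetric])
    also have "\<dots> = exp (real r * b) * (damped p ^^ r) (\<lambda>_. 1) x"
      unfolding damped_pow_eq[OF cp] by (subst L_pow_cmult[OF positive_op_weighted cE]) simp
    also have "\<dots> \<le> exp (real r * b) * (D * D) ^ Suc k"
      unfolding r_def using D VD
      by (intro mult_left_mono L_pow_le_power[OF positive_op_damped[OF cp]]) auto
    also have "(D * D) ^ Suc k = exp (real r * (2 * e))"
      unfolding D_def exp_add[symmetric] exp_of_nat_mult[symmetric] by (simp add: r_def algebra_simps)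
    also have "exp (real r * b) * exp (real r * (2 * e)) = exp b' ^ r"
      unfolding exp_add[symmetric] exp_of_nat_mult[symmetric] by (simp add: e_def field_simps)
    finally show ?thesis .
  qed
  then show ?thesis using r(2) by (intro growth_ratesI_power[OF positive_op_weighted]) auto
qed

end

section \<open>The variational principle\<close>

lemma log_integral_le_spectral_exponent:
  assumes \<mu>: "\<mu> \<in> invariant_measures \<alpha>"
  shows "log_integral \<alpha> A g \<mu> \<le> elog (spectral_radius weighted)"
\<comment> \<open>Comparing with arbitrary larger z reduces to real exponents and covers spectral
  radius 0 without a separate case.\<close>
proof (rule dense_ge)
  fix z assume z: "elog (spectral_radius weighted) < z"
  show "log_integral \<alpha> A g \<mu> \<le> z"
  proof (cases z)
    case (real b)
    then have "spectral_radius weighted < ennreal (exp b)" using z elog_lessD by blast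
    then have "exp b \<in> growth_rates W"
      by (intro growth_rate_of_spectral_radius_less[OF positive_op_weighted]) auto
    then show ?thesis using log_integral_le_growth_rate[OF \<mu>] real by fastforce
  qed (use z in auto)
qed

text \<open>Every real b below the spectral exponent is reached by some invariant state at each
  truncation level, as otherwise all exp b' with b' > b would be growth rates. The extremal state
  reaches all these b at all levels simultaneously.\<close>

lemma ergodic_maximizer:
  assumes rami: "inverse_rami_rate \<alpha> = 0"
    and fin: "\<And>x. x \<in> essential_points \<alpha> \<Longrightarrow> finite (ess_preimage \<alpha> 1 x)"
  obtains \<mu> where "\<mu> \<in> ergodic_measures \<alpha>" "log_integral \<alpha> A g \<mu> = elog (spectral_radius weighted)"
proof -
  obtain \<phi> where ext: "face (invariant_states \<alpha>) {\<phi>}"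
    and max: "\<And>k j. (\<And>i. \<exists>\<psi>\<in>invariant_states \<alpha>. k \<le> \<psi> (truncated_log i)) \<Longrightarrow> k \<le> \<phi> (truncated_log j)"
    using extremal_maximizer[of truncated_log, OF cont_truncated_log truncated_log_decreasing] by metis
  have \<phi>: "\<phi> \<in> invariant_states \<alpha>" using ext by (simp add: face_def)
  obtain \<mu> where \<mu>: "\<mu> \<in> invariant_measures \<alpha>" and int: "\<And>f. cont f \<Longrightarrow> (\<integral>x. f x \<partial>\<mu>) = \<phi> f"
    using invariant_state_measure[OF \<alpha> \<phi>] by metis
  have "\<mu> \<in> ergodic_measures \<alpha>" by (rule extreme_state_ergodic[OF \<alpha> ext \<mu> int])
  moreover have "elog (spectral_radius weighted) \<le> log_integral \<alpha> A g \<mu>"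
  proof (rule dense_le)
    fix z assume z: "z < elog (spectral_radius weighted)"
    show "z \<le> log_integral \<alpha> A g \<mu>"
    proof (cases z)
      case (real b)
      have "\<exists>\<psi>\<in>invariant_states \<alpha>. b \<le> \<psi> (truncated_log i)" for i
      proof (rule ccontr)
        assume "\<not> ?thesis"
        then have less: "\<And>\<psi>. \<psi> \<in> invariant_states \<alpha> \<Longrightarrow> \<psi> (truncated_log i) < b" by (auto simp: not_le)
        have "elog (spectral_radius weighted) \<le> ereal b"
        proof (rule dense_ge)
          fix y assume y: "ereal b < y"
          show "elog (spectral_radius weighted) \<le> y"
          proof (cases y)
            case (real b')
            have "exp b' \<in> growth_rates W"
            proof (rule growth_rate_upper[where q="truncated_log i" and b=b])
              show "\<psi> (truncated_log i) < b" if "\<psi> \<in> invariant_states \<alpha>" for \<psi> by (rule less[OF that])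
              show "b < b'" using y real by simp
            qed (rule cont_truncated_log w_le_exp_truncated_log fin rami; assumption?)+
            then have "spectral_radius weighted \<le> ennreal (exp b')"
              by (rule spectral_radius_le[OF positive_op_weighted])
            then show ?thesis unfolding real by (rule elog_leI)
          qed (use y in auto)
        qed
        then show False using z real by simp
      qed
      then have "b \<le> \<phi> (truncated_log j)" for j by (rule max)
      then have "ereal b \<le> log_integral \<alpha> A g \<mu>"
        using int[OF cont_truncated_log] by (intro log_integral_ge[OF \<mu>]) simp
      then show ?thesis using real by simp
    qed (use z in auto)
  qed
  ultimately show thesis
    using that log_integral_le_spectral_exponent[OF \<mu>] by (metis antisym)
qed

end

lemma spectral_exponent_is_max:
  assumes rami: "inverse_rami_rate \<alpha> = 0" and fin: "finite_sheeted \<alpha>"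
    and \<rho>: "continuous_on (essential_points \<alpha>) (cocycle \<alpha> A)"
  shows "is_max_over (log_integral \<alpha> A g) (ergodic_measures \<alpha>) (spectral_exponent A g)"
    "is_max_over (log_integral \<alpha> A g) (invariant_measures \<alpha>) (spectral_exponent A g)"
proof -
  have "continuous_on (essential_points \<alpha>) (\<lambda>x. Re (g x) * cocycle \<alpha> A x)"
    by (intro continuous_on_mult \<rho> continuous_on_subset[OF cont_Re_g]) auto
  from tietze[OF closed_essential_points this] obtain v where
    v: "cont v" "\<And>x. x \<in> essential_points \<alpha> \<Longrightarrow> v x = Re (g x) * cocycle \<alpha> A x" by blast
  \<comment> \<open>The Tietze extension may become negative off the essential set; on it, v is
    already nonnegative.\<close>
  define w where "w x = max (v x) 0" for x
  have w: "cont w" "\<And>x. 0 \<le> w x" unfolding w_def[abs_def] by (intro continuous_intros v) auto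
  have w_eq: "w x = Re (g x) * cocycle \<alpha> A x" if "x \<in> essential_points \<alpha>" for x
    using v(2)[OF that] Re_g_nonneg[of x] by (simp add: w_def cocycle_def)
  have fin': "finite (ess_preimage \<alpha> 1 x)" if "x \<in> essential_points \<alpha>" for x
    using fin that by (auto simp: finite_sheeted_def)
  have exp: "spectral_exponent A g = elog (spectral_radius weighted)"
    by (simp add: spectral_exponent_def weighted_def[abs_def])
  have sub: "ergodic_measures \<alpha> \<subseteq> invariant_measures \<alpha>" by (auto simp: ergodic_measures_def)
  have le: "log_integral \<alpha> A g \<mu> \<le> spectral_exponent A g" if "\<mu> \<in> invariant_measures \<alpha>" for \<mu>
    unfolding exp by (rule log_integral_le_spectral_exponent[OF w w_eq that])
  obtain \<mu> where \<mu>: "\<mu> \<in> ergodic_measures \<alpha>" "log_integral \<alpha> A g \<mu> = spectral_exponent A g"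
    unfolding exp using ergodic_maximizer[OF w w_eq rami fin'] by metis
  show "is_max_over (log_integral \<alpha> A g) (ergodic_measures \<alpha>) (spectral_exponent A g)"
    "is_max_over (log_integral \<alpha> A g) (invariant_measures \<alpha>) (spectral_exponent A g)"
    using \<mu> le sub unfolding is_max_over_def by blast+
qed

end

text \<open>The only essential preimage of \<alpha> y is y, so the mass that the transfer measure at
  \<alpha> y gives to the essential set is the cocycle at y; compatibility, applied to the constant
  1, makes this mass continuous.\<close>

lemma cocycle_continuous_homeomorphism:
  assumes hom: "homeomorphism (essential_points \<alpha>) (essential_points \<alpha>) \<alpha> \<beta>"
    and comp: "ess_compatible \<alpha> A"
  shows "continuous_on (essential_points \<alpha>) (cocycle \<alpha> A)"
proof -
  let ?X = "essential_points \<alpha>"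
  have "continuous_on ?X (\<lambda>x. LINT y:?X|transfer_measure A x. (1 :: complex))"
    using comp unfolding ess_compatible_def by (elim allE[of _ "\<lambda>_. 1"]) simp
  then have "continuous_on ?X (\<lambda>y. LINT z:?X|transfer_measure A (\<alpha> y). (1 :: complex))"
    by (rule continuous_on_compose2) (auto intro: continuous_on_subset[OF \<alpha>] essential_points_forward)
  then have c: "continuous_on ?X (\<lambda>y. Re (LINT z:?X|transfer_measure A (\<alpha> y). (1 :: complex)))"
    by (rule continuous_on_Re)
  have "Re (LINT z:?X|transfer_measure A (\<alpha> y). (1 :: complex)) = cocycle \<alpha> A y" if y: "y \<in> ?X" for y
  proof -
    have "ess_preimage \<alpha> 1 (\<alpha> y) = {\<beta> (\<alpha> y)}"
      using ess_preimage_homeomorphism[OF hom essential_points_forward[OF y], of 1] by simp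
    also have "\<beta> (\<alpha> y) = y" using hom y unfolding homeomorphism_def by blast
    finally have pre: "ess_preimage \<alpha> 1 (\<alpha> y) = {y}" .
    have "(LINT z:?X|transfer_measure A (\<alpha> y). (1 :: complex)) = cocycle \<alpha> A y *\<^sub>R 1"
      unfolding set_lebesgue_integral_def
      using integral_essential[of "\<lambda>_. 1 :: complex" "\<alpha> y"] pre by simp
    then show ?thesis by simp
  qed
  then show ?thesis using c by (simp cong: continuous_on_cong)
qed

end
end
end

theorem theorem32:
  fixes \<alpha> :: "'a::t2_space \<Rightarrow> 'a"
    and A :: "('a \<Rightarrow>\<^sub>C complex) \<Rightarrow> ('a \<Rightarrow>\<^sub>C complex)"
  assumes "compact (UNIV :: 'a set)"
    and "continuous_on UNIV \<alpha>"
    and "finite_sheeted \<alpha>"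
    and "transfer_operator \<alpha> A"
    and "ess_compatible \<alpha> A"
  shows "(inverse_rami_rate \<alpha> = 0 \<and> continuous_on (essential_points \<alpha>) (cocycle \<alpha> A) \<longrightarrow>
           (\<forall>g :: 'a \<Rightarrow>\<^sub>C complex. bc_nonneg g \<longrightarrow>
              is_max_over (log_integral \<alpha> A g) (ergodic_measures \<alpha>) (spectral_exponent A g) \<and>
              is_max_over (log_integral \<alpha> A g) (invariant_measures \<alpha>) (spectral_exponent A g))) \<and>
         ((\<exists>\<beta>. homeomorphism (essential_points \<alpha>) (essential_points \<alpha>) \<alpha> \<beta>) \<longrightarrow>
           inverse_rami_rate \<alpha> = 0 \<and> continuous_on (essential_points \<alpha>) (cocycle \<alpha> A))"
proof -
  have X: "compact_t2 TYPE('a)" by (rule compact_t2.intro[OF assms(1)])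
  note \<alpha> = assms(2) and tr = assms(4)
  show ?thesis
  proof (intro conjI impI allI; (elim conjE exE)?)
    fix g :: "'a \<Rightarrow>\<^sub>C complex"
    assume *: "bc_nonneg g" "inverse_rami_rate \<alpha> = 0" "continuous_on (essential_points \<alpha>) (cocycle \<alpha> A)"
    show "is_max_over (log_integral \<alpha> A g) (ergodic_measures \<alpha>) (spectral_exponent A g)"
      "is_max_over (log_integral \<alpha> A g) (invariant_measures \<alpha>) (spectral_exponent A g)"
      by (rule compact_t2.spectral_exponent_is_max[OF X \<alpha> tr *(1,2) assms(3) *(3)])+
  next
    fix \<beta> assume hom: "homeomorphism (essential_points \<alpha>) (essential_points \<alpha>) \<alpha> \<beta>"
    show "inverse_rami_rate \<alpha> = 0"
      by (rule compact_t2.inverse_rami_rate_homeomorphism[OF X \<alpha> hom])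
    show "continuous_on (essential_points \<alpha>) (cocycle \<alpha> A)"
      by (rule compact_t2.cocycle_continuous_homeomorphism[OF X \<alpha> tr hom assms(5)])
  qed
qed

end
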